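(* There exist universal constants $C\in(0,1]$ and $C'>0$ such that the following holds for all integers $n\ge3$ and $k\ge1$. Any $\rho$-estimator $\widehat s$ based on the model $\mathscr F_{k+2}$ satisfies, for every density $s\in\mathscr L_\mu$, $$C\,\mathbb E_s\left[h^2(s,\widehat s)\right]\le\inf_{\overline M>0}\left[h^2\left(s,\mathscr F_{k+2}(\overline M)\right)+(\log n)^2\left(\left(\overline Mn^{-2}\right)^{1/3}\vee\left(kn^{-1}\log n\right)\right)\right].$$ In particular, for every $\overline M>0$, $$\sup_{s\in\mathscr F_{k+2}(\overline M)}\mathbb E_s\left[h^2(s,\widehat s)\right]\le C'(\log n)^2\left[\left(\overline Mn^{-2}\right)^{1/3}\vee\left(kn^{-1}\log n\right)\right].$$
   Context: Setting. $\mu$ is the Lebesgue measure on $\mathbb R$ and $\mathscr L_\mu$ is the set of probability densities on $\mathbb R$ with respect to $\mu$. The Hellinger distance is $h(t,u)=\left[\frac12\int(\sqrt t-\sqrt u)^2d\mu\right]^{1/2}$, and $h(t,A)=\inf_{u\in A}h(t,u)$ for $A\subset\mathscr L_\mu$. One observes i.i.d. random variables $X_1,\dots,X_n$ ($n\ge3$) with density $s\in\mathscr L_\mu$; $\mathbb E_s$ is the expectation when the true density is $s$. $a\vee b=\max(a,b)$. Partitions. $\mathcal J(k)$ is the set of partitions of $\mathbb R$ into $k$ open intervals: $\mathcal I=\{I_0,\dots,I_{k-1}\}$ with $I_j=(x_j,x_{j+1})$, $-\infty=x_0<x_1<\dots<x_{k-1}<x_k=+\infty$. $\ell(I)$ denotes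 the length of $I$. Piecewise monotone densities. $f:\mathbb R\to\mathbb R$ is piecewise monotone based on $\mathcal I\in\mathcal J(k)$ if $f$ is monotone on each open interval $I_j$ of $\mathcal I$ (no condition at the endpoints; the direction may depend on $j$). For $k\ge2$, $\mathscr F_k$ is the set of densities in $\mathscr L_\mu$ that are piecewise monotone based on some $\mathcal I\in\mathcal J(k)$. Variation. For $f$ monotone on the interior $\mathring I$ of an interval $I$, $V_I(f)=\sup_{\mathring I}f-\inf_{\mathring I}f\in[0,+\infty]$. Functional $M_k$. For $t\in\mathscr F_k$ based on $\mathcal I=\{I_0,\dots,I_{k-1}\}$, with the convention $(+\infty)\times0=0$, $$M_k(t,\mathcal I)=\left[\sum_{j=0}^{k-1}\left[\ell(I_j)V_{I_j}^2(\sqrt t)\right]^{1/3}\right]^3\le+\infty,\qquad M_k(t)=\inf_{\mathcal I}M_k(t,\mathcal I),$$ the infimum being over all $\mathcal I\in\mathcal J(k)$ on which $t$ is based. $\mathscr F_{k+2}(\overline M)=\{t\in\mathscr F_{k+2}: M_{k+2}(t)\le\overline M\}$. $\rho$-estimators. Let $\psi(u)=\frac{u-1}{\sqrt{1+u^2}}$ for $u\in[0,+\infty)$ and $\psi(+\infty)=1$. For densities $t,t'$ put $$\mathbf T(\boldsymbol X,t,t')=\frac n2\left[h^2\left(t,\tfrac{t+t'}2\right)-h^2\left(t',\tfrac{t+t'}2\right)\right]+\frac1{\sqrt2}\sum_{i=1}^n\psi\left(\sqrt{\tfrac{t'}{t}(X_i)}\right),$$ with the conventions $0/0=1$ and $a/0=+\infty$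 for $a>0$. For a model $\overline S\subset\mathscr L_\mu$ and an at most countable subset $S$ of $\overline S$ which is dense in $\overline S$ for the Hellinger distance, let $\boldsymbol\Upsilon(S,t)=\sup_{t'\in S}\mathbf T(\boldsymbol X,t,t')$. A $\rho$-estimator on (based on) $\overline S$ is any (measurable) element $\widehat s$ of the closure (for $h$) of $\{t\in S:\ \boldsymbol\Upsilon(S,t)\le\inf_{t'\in S}\boldsymbol\Upsilon(S,t')+35.7\}$. *)

theory Defs
  imports "HOL-Analysis.Analysis"
begin

definition prob_densities :: "(real \<Rightarrow> real) set" where
  "prob_densities = {t \<in> borel_measurable borel.
     (\<forall>x. 0 \<le> t x) \<and> (\<integral>\<^sup>+ x. ennreal (t x) \<partial>lborel) = 1}"

definition hellinger :: "(real \<Rightarrow> real) \<Rightarrow> (real \<Rightarrow> real) \<Rightarrow> real" where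
  "hellinger t u = sqrt (1 / 2 * (\<integral>x. (sqrt (t x) - sqrt (u x))\<^sup>2 \<partial>lborel))"

text \<open>A real infimum; it is only used for nonempty sets of densities.\<close>

definition hellinger_set :: "(real \<Rightarrow> real) \<Rightarrow> (real \<Rightarrow> real) set \<Rightarrow> real" where
  "hellinger_set t A = (INF u\<in>A. hellinger t u)"

text \<open>On functions (rather than classes of functions modulo equality almost everywhere) the
  Hellinger distance is a pseudo-metric, so the closure, density and Borel sets it induces are
  spelled out here.\<close>

definition hellinger_closure :: "(real \<Rightarrow> real) set \<Rightarrow> (real \<Rightarrow> real) set" where
  "hellinger_closure A = {t \<in> prob_densities. \<forall>\<epsilon>>0. \<exists>u\<in>A. hellinger t u < \<epsilon>}"

definition hellinger_open :: "(real \<Rightarrow> real) set \<Rightarrow> bool" where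
  "hellinger_open U \<longleftrightarrow> U \<subseteq> prob_densities \<and>
     (\<forall>t\<in>U. \<exists>\<epsilon>>0. \<forall>u\<in>prob_densities. hellinger t u < \<epsilon> \<longrightarrow> u \<in> U)"

definition hellinger_borel :: "(real \<Rightarrow> real) measure" where
  "hellinger_borel = sigma prob_densities {U. hellinger_open U}"

text \<open>A partition of the real line into \<open>k\<close> open intervals is given by its endpoints
  \<open>x 0 = -\<infinity> < x 1 < \<dots> < x k = \<infinity>\<close>; the values of \<open>x\<close> beyond \<open>k\<close> are irrelevant.\<close>

definition partitions :: "nat \<Rightarrow> (nat \<Rightarrow> ereal) set" where
  "partitions k = {x. x 0 = -\<infinity> \<and> x k = \<infinity> \<and> (\<forall>j<k. x j < x (Suc j))}"

definition piece :: "(nat \<Rightarrow> ereal) \<Rightarrow> nat \<Rightarrow> real set" where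
  "piece x j = {y. x j < ereal y \<and> ereal y < x (Suc j)}"

definition piecewise_monotone_on_partition ::
    "nat \<Rightarrow> (nat \<Rightarrow> ereal) \<Rightarrow> (real \<Rightarrow> real) \<Rightarrow> bool" where
  "piecewise_monotone_on_partition k x f \<longleftrightarrow> x \<in> partitions k \<and>
     (\<forall>j<k. mono_on (piece x j) f \<or> antimono_on (piece x j) f)"

definition pm_densities :: "nat \<Rightarrow> (real \<Rightarrow> real) set" where
  "pm_densities k = {t \<in> prob_densities. \<exists>x. piecewise_monotone_on_partition k x t}"

text \<open>The supremum and infimum are taken in the extended reals.\<close>

definition variation :: "real set \<Rightarrow> (real \<Rightarrow> real) \<Rightarrow> ennreal" where
  "variation I f = e2ennreal ((SUP y\<in>interior I. ereal (f y)) - (INF y\<in>interior I. ereal (f y)))"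

definition cbrt :: "ennreal \<Rightarrow> ennreal" where
  "cbrt a = (if a = \<infinity> then \<infinity> else ennreal (root 3 (enn2real a)))"

text \<open>Multiplication on \<^typ>\<open>ennreal\<close> satisfies \<open>\<infinity> * 0 = 0\<close>.\<close>

definition M_partition :: "nat \<Rightarrow> (real \<Rightarrow> real) \<Rightarrow> (nat \<Rightarrow> ereal) \<Rightarrow> ennreal" where
  "M_partition k t x =
     (\<Sum>j<k. cbrt (emeasure lborel (piece x j) * (variation (piece x j) (\<lambda>y. sqrt (t y)))\<^sup>2)) ^ 3"

definition M_functional :: "nat \<Rightarrow> (real \<Rightarrow> real) \<Rightarrow> ennreal" where
  "M_functional k t = (INF x\<in>{x. piecewise_monotone_on_partition k x t}. M_partition k t x)"

definition pm_densities_le :: "nat \<Rightarrow> real \<Rightarrow> (real \<Rightarrow> real) set" where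
  "pm_densities_le k M = {t \<in> pm_densities k. M_functional k t \<le> ennreal M}"

definition psi :: "ennreal \<Rightarrow> real" where
  "psi u = (if u = \<infinity> then 1 else (enn2real u - 1) / sqrt (1 + (enn2real u)\<^sup>2))"

text \<open>\<open>sqrt_ratio a b\<close> is the square root of \<open>a / b\<close> for \<open>a, b \<ge> 0\<close>, with \<open>0 / 0 = 1\<close> and
  \<open>a / 0 = \<infinity>\<close> for \<open>a > 0\<close>.\<close>

definition sqrt_ratio :: "real \<Rightarrow> real \<Rightarrow> ennreal" where
  "sqrt_ratio a b = (if b = 0 then (if a = 0 then 1 else \<infinity>) else ennreal (sqrt (a / b)))"

definition T_stat ::
    "nat \<Rightarrow> (nat \<Rightarrow> real) \<Rightarrow> (real \<Rightarrow> real) \<Rightarrow> (real \<Rightarrow> real) \<Rightarrow> real" where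
  "T_stat n X t t' =
     real n / 2 * ((hellinger t (\<lambda>y. (t y + t' y) / 2))\<^sup>2 - (hellinger t' (\<lambda>y. (t y + t' y) / 2))\<^sup>2)
     + 1 / sqrt 2 * (\<Sum>i<n. psi (sqrt_ratio (t' (X i)) (t (X i))))"

text \<open>For densities \<open>\<bar>T_stat n X t t'\<bar> \<le> n / 2 + n / sqrt 2\<close>, so the real suprema and infima
  below are over bounded sets.\<close>

definition Upsilon :: "nat \<Rightarrow> (nat \<Rightarrow> real) \<Rightarrow> (real \<Rightarrow> real) set \<Rightarrow> (real \<Rightarrow> real) \<Rightarrow> real" where
  "Upsilon n X S t = (SUP t'\<in>S. T_stat n X t t')"

text \<open>The observations \<open>X 0, \<dots>, X (n - 1)\<close> are the coordinates of a point of the product space;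
  an estimator is a measurable map from that space to the densities.\<close>

definition rho_estimator ::
    "nat \<Rightarrow> (real \<Rightarrow> real) set \<Rightarrow> ((nat \<Rightarrow> real) \<Rightarrow> real \<Rightarrow> real) \<Rightarrow> bool" where
  "rho_estimator n Sbar shat \<longleftrightarrow>
     shat \<in> (\<Pi>\<^sub>M i\<in>{..<n}. borel) \<rightarrow>\<^sub>M hellinger_borel \<and>
     (\<exists>S. S \<subseteq> Sbar \<and> countable S \<and> Sbar \<subseteq> hellinger_closure S \<and>
        (\<forall>X \<in> space (\<Pi>\<^sub>M i\<in>{..<n}. (borel :: real measure)).
           shat X \<in> hellinger_closure
             {t \<in> S. Upsilon n X S t \<le> (INF t'\<in>S. Upsilon n X S t') + 357 / 10}))"

definition risk :: "nat \<Rightarrow> (real \<Rightarrow> real) \<Rightarrow> ((nat \<Rightarrow> real) \<Rightarrow> real \<Rightarrow> real) \<Rightarrow> real" where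
  "risk n s shat =
     (\<integral>X. (hellinger s (shat X))\<^sup>2 \<partial>(\<Pi>\<^sub>M i\<in>{..<n}. density lborel (\<lambda>x. ennreal (s x))))"

end

theory Submission
  imports Defs "HOL-Probability.Probability"
begin

text \<open>Let \<open>h\<close> be the Hellinger distance. The test statistic satisfies
  \<open>E\<^sub>s T(t, t') \<le> n (7/4 h\<^sup>2(s, t) - 1/4 h\<^sup>2(s, t'))\<close>, so the risk is controlled by the deviations of
  \<open>T(u, t')\<close> from its mean, uniformly in \<open>t'\<close>, for one well chosen \<open>u\<close>. If \<open>u\<close> is a step density with
  \<open>D\<close> steps then \<open>\<psi>(sqrt (t' / u))\<close> is bounded and monotone off \<open>O(D + k)\<close> points, and its superlevel
  sets are unions of that many intervals. A Chernoff bound for the \<open>O(n\<^sup>2)\<close> intervals of a quantile grid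
  controls all intervals simultaneously; summing over levels gives a deviation of at most a small
  multiple of \<open>n E\<^sub>s \<psi>\<^sup>2\<close>, which the negative term of the mean absorbs, plus
  \<open>O((D + k) log\<^sup>2 n)\<close>. Cutting each piece of \<open>t \<in> F\<^bsub>k+2\<^esub>(M)\<close> at equispaced levels of
  \<open>sqrt t\<close>, with a number of levels proportional to \<open>(\<ell> V\<^sup>2)\<^bsup>1/3\<^esup>\<close>, and averaging \<open>t\<close> in between yields a
  step density \<open>u\<close> at squared distance at most \<open>2 M / D\<^sup>2\<close>; the choice
  \<open>D = (M n)\<^bsup>1/3\<^esup> / log n\<close> balances the two errors.\<close>

section \<open>Hellinger distance and the test function\<close>

text \<open>The base of the test is a step density because a ratio of two piecewise monotone
  functions need not be piecewise monotone; only over a locally constant denominator do few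
  intervals describe the superlevel sets. The intervals of a quantile grid are polynomially many, so
  a union bound replaces any chaining argument. An error of order sqrt n for every interval would be
  too crude, however: the Chernoff bound is used with an error proportional to the mass of the
  interval, with a slope adapted to the level. One logarithm comes from the union bound, the other
  from the harmonic sum of the absolute errors. Everything random is collected in variables that do
  not depend on the competitor t'; this is why the bound may be applied at the density selected from
  the data.\<close>

lemma prob_densitiesD:
  assumes "t \<in> prob_densities"
  shows "t \<in> borel_measurable borel" "0 \<le> t x" "integrable lborel t" "(\<integral>x. t x \<partial>lborel) = 1"
proof -
  show m: "t \<in> borel_measurable borel" and nn: "0 \<le> t x" for x
    using assms by (auto simp: prob_densities_def)
  have I: "(\<integral>\<^sup>+ x. ennreal (t x) \<partial>lborel) = ennreal 1"
    using assms by (auto simp: prob_densities_def)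
  then show "integrable lborel t" "(\<integral>x. t x \<partial>lborel) = 1"
    using nn_integral_eq_integrable[of t lborel 1] m nn by auto
qed

lemma prob_densitiesI:
  assumes "t \<in> borel_measurable borel" "\<And>x. 0 \<le> t x" "integrable lborel t"
    "(\<integral>x. t x \<partial>lborel) = 1"
  shows "t \<in> prob_densities"
  using assms nn_integral_eq_integral[of lborel t] by (auto simp: prob_densities_def)

lemma sqrt_diff_sq_le:
  fixes a b :: real
  assumes "0 \<le> a" "0 \<le> b"
  shows "(sqrt a - sqrt b)\<^sup>2 \<le> a + b"
  using assms by (simp add: power2_diff)

lemma integrable_sqrt_diff_sq:
  assumes "t \<in> prob_densities" "u \<in> prob_densities"
  shows "integrable lborel (\<lambda>x. (sqrt (t x) - sqrt (u x))\<^sup>2)"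
proof (rule Bochner_Integration.integrable_bound[where f = "\<lambda>x. t x + u x"])
  show "integrable lborel (\<lambda>x. t x + u x)"
    using assms by (auto intro: prob_densitiesD)
  show "(\<lambda>x. (sqrt (t x) - sqrt (u x))\<^sup>2) \<in> borel_measurable lborel"
    using prob_densitiesD(1)[OF assms(1)] prob_densitiesD(1)[OF assms(2)] by measurable
qed (use assms sqrt_diff_sq_le prob_densitiesD(2) in \<open>auto intro!: AE_I2\<close>)

lemma hellinger_sq: "(hellinger t u)\<^sup>2 = 1 / 2 * (\<integral>x. (sqrt (t x) - sqrt (u x))\<^sup>2 \<partial>lborel)"
  unfolding hellinger_def by (subst real_sqrt_pow2) auto

lemma hellinger_nonneg: "0 \<le> hellinger t u"
  unfolding hellinger_def by auto

lemma hellinger_commute: "hellinger t u = hellinger u t"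
  unfolding hellinger_def by (simp add: power2_commute)

lemma hellinger_self: "hellinger t t = 0"
  unfolding hellinger_def by simp

lemma hellinger_sq_le_1:
  assumes "t \<in> prob_densities" "u \<in> prob_densities"
  shows "(hellinger t u)\<^sup>2 \<le> 1"
proof -
  have "(\<integral>x. (sqrt (t x) - sqrt (u x))\<^sup>2 \<partial>lborel) \<le> (\<integral>x. t x + u x \<partial>lborel)"
    by (rule integral_mono)
      (use assms in \<open>auto intro!: integrable_sqrt_diff_sq sqrt_diff_sq_le intro: prob_densitiesD\<close>)
  also have "\<dots> = 2"
    using assms by (subst Bochner_Integration.integral_add) (auto intro: prob_densitiesD simp: prob_densitiesD(4))
  finally show ?thesis by (simp add: hellinger_sq)
qed

text \<open>The factor 2 comes from the pointwise bound (a - c)^2 \<le> 2 (a - b)^2 + 2 (b - c)^2.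
  This squared form is the only triangle inequality used.\<close>

lemma hellinger_sq_triangle:
  assumes "s \<in> prob_densities" "t \<in> prob_densities" "u \<in> prob_densities"
  shows "(hellinger s u)\<^sup>2 \<le> 2 * (hellinger s t)\<^sup>2 + 2 * (hellinger t u)\<^sup>2"
proof -
  have "(\<integral>x. (sqrt (s x) - sqrt (u x))\<^sup>2 \<partial>lborel) \<le>
    (\<integral>x. 2 * (sqrt (s x) - sqrt (t x))\<^sup>2 + 2 * (sqrt (t x) - sqrt (u x))\<^sup>2 \<partial>lborel)"
  proof (rule integral_mono)
    fix x
    have "(a - c)\<^sup>2 \<le> 2 * (a - b)\<^sup>2 + 2 * (b - c)\<^sup>2" for a b c :: real
      using zero_le_power2[of "(a - b) - (b - c)"] by (simp add: power2_eq_square algebra_simps)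
    then show "(sqrt (s x) - sqrt (u x))\<^sup>2 \<le> 2 * (sqrt (s x) - sqrt (t x))\<^sup>2 + 2 * (sqrt (t x) - sqrt (u x))\<^sup>2" .
  qed (use assms in \<open>auto intro!: integrable_sqrt_diff_sq\<close>)
  also have "\<dots> = 2 * (\<integral>x. (sqrt (s x) - sqrt (t x))\<^sup>2 \<partial>lborel) + 2 * (\<integral>x. (sqrt (t x) - sqrt (u x))\<^sup>2 \<partial>lborel)"
    using assms by (subst Bochner_Integration.integral_add) (auto intro!: integrable_sqrt_diff_sq)
  finally show ?thesis by (simp add: hellinger_sq)
qed

lemma midpoint_prob_densities:
  assumes "t \<in> prob_densities" "u \<in> prob_densities"
  shows "(\<lambda>y. (t y + u y) / 2) \<in> prob_densities"
proof (rule prob_densitiesI)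
  show "(\<lambda>y. (t y + u y) / 2) \<in> borel_measurable borel"
    using prob_densitiesD(1)[OF assms(1)] prob_densitiesD(1)[OF assms(2)] by simp
qed (use assms in \<open>auto simp: prob_densitiesD\<close>)

text \<open>Division by zero absorbs the conventions on the ratio: a = b = 0 gives 0 =
  \<open>psi 1\<close>, and a = 0 < b gives 1 = \<open>psi \<infinity>\<close>. From here on the
  test function is (\<beta> - \<alpha>) divided by the Euclidean norm of (\<alpha>, \<beta>), the
  square roots of a and b.\<close>

lemma psi_sqrt_ratio:
  assumes "0 \<le> a" "0 \<le> b"
  shows "psi (sqrt_ratio b a) = (sqrt b - sqrt a) / sqrt (a + b)"
proof (cases "a = 0")
  case True
  then show ?thesis using assms by (auto simp: psi_def sqrt_ratio_def)
next
  case False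
  with assms have a: "a > 0" by simp
  have "psi (sqrt_ratio b a) = (sqrt (b / a) - 1) / sqrt (1 + b / a)"
    using a assms by (simp add: psi_def sqrt_ratio_def)
  also have "1 + b / a = (a + b) / a"
    using a by (simp add: add_divide_distrib)
  also have "(sqrt (b / a) - 1) / sqrt ((a + b) / a) = ((sqrt b - sqrt a) / sqrt a) / (sqrt (a + b) / sqrt a)"
    using a by (simp add: real_sqrt_divide diff_divide_distrib)
  also have "\<dots> = (sqrt b - sqrt a) / sqrt (a + b)"
    using a by simp
  finally show ?thesis .
qed

lemma abs_psi_sqrt_ratio_le:
  assumes "0 \<le> a" "0 \<le> b"
  shows "\<bar>psi (sqrt_ratio b a)\<bar> \<le> 1"
proof -
  have "\<bar>sqrt b - sqrt a\<bar> \<le> sqrt (a + b)"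
    using sqrt_diff_sq_le[OF assms(2,1)] by (intro real_le_rsqrt) (simp add: add.commute)
  then show ?thesis
    using assms by (auto simp: psi_sqrt_ratio divide_le_eq_1)
qed

lemma psi_sqrt_ratio_swap:
  assumes "0 \<le> a" "0 \<le> b"
  shows "psi (sqrt_ratio a b) = - psi (sqrt_ratio b a)"
  using assms by (simp add: psi_sqrt_ratio add.commute minus_divide_left)

lemma measurable_psi_sqrt_ratio:
  assumes "t \<in> prob_densities" "u \<in> prob_densities"
  shows "(\<lambda>x. psi (sqrt_ratio (u x) (t x))) \<in> borel_measurable borel"
proof -
  have "(\<lambda>x. psi (sqrt_ratio (u x) (t x))) = (\<lambda>x. (sqrt (u x) - sqrt (t x)) / sqrt (t x + u x))"
    using assms by (auto simp: psi_sqrt_ratio prob_densitiesD(2))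
  then show ?thesis
    using prob_densitiesD(1)[OF assms(1)] prob_densitiesD(1)[OF assms(2)] by simp
qed

lemma integrable_density_mult:
  assumes "s \<in> prob_densities" "f \<in> borel_measurable borel" "\<And>x. \<bar>f x\<bar> \<le> K"
  shows "integrable lborel (\<lambda>x. s x * f x)"
proof (rule Bochner_Integration.integrable_bound[where f = "\<lambda>x. K * s x"])
  show "integrable lborel (\<lambda>x. K * s x)" using assms(1) by (auto intro: prob_densitiesD)
  show "(\<lambda>x. s x * f x) \<in> borel_measurable lborel"
    using prob_densitiesD(1)[OF assms(1)] assms(2) by simp
  show "AE x in lborel. norm (s x * f x) \<le> norm (K * s x)"
  proof (rule AE_I2)
    fix x
    have "0 \<le> K" using assms(3)[of x] by linarith
    then show "norm (s x * f x) \<le> norm (K * s x)"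
      using mult_left_mono[OF assms(3) prob_densitiesD(2)[OF assms(1)], of x x]
      by (simp add: abs_mult prob_densitiesD(2)[OF assms(1)] mult.commute)
  qed
qed

text \<open>Since r^2 is the mean of a^2 and b^2, only cross terms remain after expansion; they
  compare because the quadratic mean dominates the arithmetic mean. Integrated, this is convexity of
  h^2 under mixing.\<close>

lemma quadratic_mean_sq_dist:
  fixes a b c r :: real
  assumes "0 \<le> a" "0 \<le> b" "0 \<le> c" "r = sqrt ((a\<^sup>2 + b\<^sup>2) / 2)"
  shows "(c - r)\<^sup>2 \<le> ((c - a)\<^sup>2 + (c - b)\<^sup>2) / 2"
proof -
  have r2: "r\<^sup>2 = (a\<^sup>2 + b\<^sup>2) / 2" unfolding assms(4) by (subst real_sqrt_pow2) auto
  have "(a + b) / 2 \<le> r"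
    unfolding assms(4)
    using zero_le_power2[of "a - b"]
    by (intro real_le_rsqrt) (simp add: power2_eq_square field_simps)
  then have "c * ((a + b) / 2) \<le> c * r" using assms(3) by (rule mult_left_mono)
  then show ?thesis using r2 by (simp add: power2_diff field_simps)
qed

text \<open>Here a, b, c, r stand for the square roots of t, u, s and (t + u) / 2. Writing c^2 = (c
  - r)^2 + 2 c r - r^2 splits the test term into a remainder and terms that combine with the
  midpoint distances to exactly (b^2 - a^2) / 4 + ((c - a)^2 - (c - b)^2) / 2. The remainder is at
  most 3/8 of the sum of both squares, whence 1/2 + 3/8 = 7/8 and 1/2 - 3/8 = 1/8. For densities
  (b^2 - a^2) / 4 integrates to zero.\<close>

lemma test_pointwise_bound:
  fixes a b c r :: real
  assumes "0 \<le> a" "0 \<le> b" "0 \<le> c" "r = sqrt ((a\<^sup>2 + b\<^sup>2) / 2)"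
  shows "((a - r)\<^sup>2 - (b - r)\<^sup>2) / 4 + 1 / sqrt 2 * (c\<^sup>2 * ((b - a) / sqrt (a\<^sup>2 + b\<^sup>2)))
    \<le> (b\<^sup>2 - a\<^sup>2) / 4 + 7 / 8 * (c - a)\<^sup>2 - 1 / 8 * (c - b)\<^sup>2"
proof (cases "a = 0 \<and> b = 0")
  case True
  then show ?thesis using assms by simp
next
  case False
  then have pos: "a\<^sup>2 + b\<^sup>2 > 0" by (simp add: sum_power2_gt_zero_iff)
  have r2: "r\<^sup>2 = (a\<^sup>2 + b\<^sup>2) / 2" unfolding assms(4) by (subst real_sqrt_pow2) auto
  have r: "r > 0" unfolding assms(4) using pos by simp
  have sq: "sqrt (a\<^sup>2 + b\<^sup>2) * sqrt 2 = 2 * r"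
    unfolding assms(4) using pos
    by (simp add: real_sqrt_divide field_simps)
  have "1 / sqrt 2 * (c\<^sup>2 * ((b - a) / sqrt (a\<^sup>2 + b\<^sup>2))) = c\<^sup>2 * (b - a) / (2 * r)"
    unfolding sq[symmetric] by simp
  also have "\<dots> = (b - a) * (c - r)\<^sup>2 / (2 * r) + (b - a) * c - (b - a) * r / 2"
    using r by (simp add: field_simps power2_eq_square)
  finally have 1: "1 / sqrt 2 * (c\<^sup>2 * ((b - a) / sqrt (a\<^sup>2 + b\<^sup>2))) =
    (b - a) * (c - r)\<^sup>2 / (2 * r) + (b - a) * c - (b - a) * r / 2" .
  \<comment> \<open>The sharp factor is sqrt 2; 3/2 is rational and still below 2, which leaves a
    negative multiple of (c - b)^2.\<close>
  have "b \<le> 3 / 2 * r"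
  proof (rule power2_le_imp_le)
    show "b\<^sup>2 \<le> (3 / 2 * r)\<^sup>2"
    proof -
      have "4 * b\<^sup>2 \<le> 9 * r\<^sup>2" unfolding r2 by (simp add: field_simps add_increasing)
      then show ?thesis unfolding power_mult_distrib by (simp add: power2_eq_square)
    qed
  qed (use r in auto)
  then have "(b - a) / (2 * r) \<le> 3 / 4" using assms(1) r by (simp add: field_simps)
  then have "(b - a) / (2 * r) * (c - r)\<^sup>2 \<le> 3 / 4 * (c - r)\<^sup>2"
    by (rule mult_right_mono) auto
  also have "\<dots> \<le> 3 / 8 * ((c - a)\<^sup>2 + (c - b)\<^sup>2)"
    using quadratic_mean_sq_dist[OF assms] by simp
  finally have 2: "(b - a) * (c - r)\<^sup>2 / (2 * r) \<le> 3 / 8 * ((c - a)\<^sup>2 + (c - b)\<^sup>2)" by simp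
  have 3: "((a - r)\<^sup>2 - (b - r)\<^sup>2) / 4 + (b - a) * c - (b - a) * r / 2 =
      (b\<^sup>2 - a\<^sup>2) / 4 + ((c - a)\<^sup>2 - (c - b)\<^sup>2) / 2"
    by (simp add: power2_eq_square field_simps)
  show ?thesis unfolding 1 using 2 3 by argo
qed

text \<open>The squared test function is w = (b - a)^2 / (2 r^2) \<le> 1. In c^2 \<le> 2 (c - r)^2 +
  2 r^2 the first part uses w \<le> 1, and in the second the denominator cancels, leaving (b - a)^2.
  This turns the second moment in the deviation bound into Hellinger distances.\<close>

lemma test_sq_pointwise_bound:
  fixes a b c :: real
  assumes "0 \<le> a" "0 \<le> b" "0 \<le> c"
  shows "c\<^sup>2 * ((b - a) / sqrt (a\<^sup>2 + b\<^sup>2))\<^sup>2 \<le> 3 * ((c - a)\<^sup>2 + (c - b)\<^sup>2)"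
proof (cases "a = 0 \<and> b = 0")
  case True
  then show ?thesis using assms by simp
next
  case False
  then have pos: "a\<^sup>2 + b\<^sup>2 > 0" by (simp add: sum_power2_gt_zero_iff)
  define r where "r = sqrt ((a\<^sup>2 + b\<^sup>2) / 2)"
  have r2: "r\<^sup>2 = (a\<^sup>2 + b\<^sup>2) / 2" unfolding r_def by (subst real_sqrt_pow2) auto
  define w where "w = ((b - a) / sqrt (a\<^sup>2 + b\<^sup>2))\<^sup>2"
  have w: "w = (b - a)\<^sup>2 / (a\<^sup>2 + b\<^sup>2)"
    unfolding w_def power_divide by simp
  have "(b - a)\<^sup>2 \<le> a\<^sup>2 + b\<^sup>2" using assms by (simp add: power2_diff)
  then have w1: "0 \<le> w" "w \<le> 1" unfolding w using pos by auto
  have w2: "2 * r\<^sup>2 * w = (b - a)\<^sup>2" unfolding w r2 using pos by simp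
  have "c\<^sup>2 \<le> 2 * (c - r)\<^sup>2 + 2 * r\<^sup>2"
    using zero_le_power2[of "c - 2 * r"] by (simp add: power2_eq_square algebra_simps)
  then have "c\<^sup>2 * w \<le> (2 * (c - r)\<^sup>2 + 2 * r\<^sup>2) * w" using w1 by (intro mult_right_mono)
  also have "\<dots> = 2 * (c - r)\<^sup>2 * w + (b - a)\<^sup>2" using w2 by (simp add: algebra_simps)
  also have "2 * (c - r)\<^sup>2 * w \<le> 2 * (c - r)\<^sup>2" using w1 by (simp add: mult_left_le)
  also have "2 * (c - r)\<^sup>2 \<le> (c - a)\<^sup>2 + (c - b)\<^sup>2"
    using quadratic_mean_sq_dist[OF assms r_def] by simp
  also have "(b - a)\<^sup>2 \<le> 2 * ((c - a)\<^sup>2 + (c - b)\<^sup>2)"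
    using zero_le_power2[of "(c - a) + (c - b)"] by (simp add: power2_eq_square algebra_simps)
  finally show ?thesis unfolding w_def by simp
qed

lemma expected_T_stat_le:
  assumes s: "s \<in> prob_densities" and t: "t \<in> prob_densities" and u: "u \<in> prob_densities"
  defines "r \<equiv> \<lambda>y. (t y + u y) / 2"
  shows "1 / 2 * ((hellinger t r)\<^sup>2 - (hellinger u r)\<^sup>2)
      + 1 / sqrt 2 * (\<integral>x. s x * psi (sqrt_ratio (u x) (t x)) \<partial>lborel)
    \<le> 7 / 4 * (hellinger s t)\<^sup>2 - 1 / 4 * (hellinger s u)\<^sup>2"
proof -
  note D = prob_densitiesD
  have r: "r \<in> prob_densities" unfolding r_def by (rule midpoint_prob_densities[OF t u])
  have i0: "integrable lborel (\<lambda>x. s x * psi (sqrt_ratio (u x) (t x)))"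
    by (rule integrable_density_mult[OF s measurable_psi_sqrt_ratio[OF t u], of 1])
      (auto intro: abs_psi_sqrt_ratio_le D t u)
  note i = i0 integrable_sqrt_diff_sq[OF t r] integrable_sqrt_diff_sq[OF u r]
    integrable_sqrt_diff_sq[OF s t] integrable_sqrt_diff_sq[OF s u] D(3)[OF t] D(3)[OF u]
  have "(\<integral>x. ((sqrt (t x) - sqrt (r x))\<^sup>2 - (sqrt (u x) - sqrt (r x))\<^sup>2) / 4
      + 1 / sqrt 2 * (s x * psi (sqrt_ratio (u x) (t x))) \<partial>lborel)
    \<le> (\<integral>x. (u x - t x) / 4 + 7 / 8 * (sqrt (s x) - sqrt (t x))\<^sup>2 - 1 / 8 * (sqrt (s x) - sqrt (u x))\<^sup>2 \<partial>lborel)"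
  proof (rule integral_mono)
    fix x
    show "((sqrt (t x) - sqrt (r x))\<^sup>2 - (sqrt (u x) - sqrt (r x))\<^sup>2) / 4
      + 1 / sqrt 2 * (s x * psi (sqrt_ratio (u x) (t x))) \<le>
      (u x - t x) / 4 + 7 / 8 * (sqrt (s x) - sqrt (t x))\<^sup>2 - 1 / 8 * (sqrt (s x) - sqrt (u x))\<^sup>2"
      using test_pointwise_bound[of "sqrt (t x)" "sqrt (u x)" "sqrt (s x)" "sqrt (r x)"]
      by (simp add: D[OF t] D[OF u] D[OF s] psi_sqrt_ratio r_def)
  qed (use i in auto)
  also have "\<dots> = 7 / 4 * (hellinger s t)\<^sup>2 - 1 / 4 * (hellinger s u)\<^sup>2"
    using i by (simp add: hellinger_sq D(4)[OF t] D(4)[OF u])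
  finally show ?thesis using i by (simp add: hellinger_sq diff_divide_distrib)
qed

lemma expected_psi_sq_le:
  assumes s: "s \<in> prob_densities" and t: "t \<in> prob_densities" and u: "u \<in> prob_densities"
  shows "(\<integral>x. s x * (psi (sqrt_ratio (u x) (t x)))\<^sup>2 \<partial>lborel)
    \<le> 6 * ((hellinger s t)\<^sup>2 + (hellinger s u)\<^sup>2)"
proof -
  note D = prob_densitiesD
  note i = integrable_sqrt_diff_sq[OF s t] integrable_sqrt_diff_sq[OF s u]
  have "(\<integral>x. s x * (psi (sqrt_ratio (u x) (t x)))\<^sup>2 \<partial>lborel)
    \<le> (\<integral>x. 3 * ((sqrt (s x) - sqrt (t x))\<^sup>2 + (sqrt (s x) - sqrt (u x))\<^sup>2) \<partial>lborel)"
  proof (rule integral_mono)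
    show "integrable lborel (\<lambda>x. s x * (psi (sqrt_ratio (u x) (t x)))\<^sup>2)"
    proof (rule integrable_density_mult[OF s, of _ 1])
      show "(\<lambda>x. (psi (sqrt_ratio (u x) (t x)))\<^sup>2) \<in> borel_measurable borel"
        using measurable_psi_sqrt_ratio[OF t u] by measurable
      show "\<bar>(psi (sqrt_ratio (u x) (t x)))\<^sup>2\<bar> \<le> 1" for x
        using abs_psi_sqrt_ratio_le[OF D(2)[OF t] D(2)[OF u], of x x]
        by (simp add: abs_square_le_1)
    qed
    fix x
    show "s x * (psi (sqrt_ratio (u x) (t x)))\<^sup>2 \<le>
       3 * ((sqrt (s x) - sqrt (t x))\<^sup>2 + (sqrt (s x) - sqrt (u x))\<^sup>2)"
      using test_sq_pointwise_bound[of "sqrt (t x)" "sqrt (u x)" "sqrt (s x)"]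
      by (simp add: D[OF t] D[OF u] D[OF s] psi_sqrt_ratio)
  qed (use i in auto)
  also have "\<dots> = 6 * ((hellinger s t)\<^sup>2 + (hellinger s u)\<^sup>2)"
    using i by (simp add: hellinger_sq)
  finally show ?thesis .
qed

section \<open>Replacing the base density of the test\<close>

definition base_change :: "real \<Rightarrow> real \<Rightarrow> real" where
  "base_change p q = (if q = 0 then 2 else min 2 (2 * \<bar>sqrt p - sqrt q\<bar> / sqrt q))"

text \<open>The bound is free of b, so a single function controls the change of base for all
  competitors at once. With r and r' the norms of (\<alpha>, \<beta>) and (\<alpha>', \<beta>), the
  norm is 1-Lipschitz; the changes of the numerator and of the denominator therefore cost at most
  \<bar>\<alpha> - \<alpha>'\<bar> / r' each, and r' \<ge> \<alpha>'.\<close>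

lemma psi_base_change:
  assumes "0 \<le> p" "0 \<le> q" "0 \<le> b"
  shows "\<bar>psi (sqrt_ratio b p) - psi (sqrt_ratio b q)\<bar> \<le> base_change p q"
proof -
  have two: "\<bar>psi (sqrt_ratio b p) - psi (sqrt_ratio b q)\<bar> \<le> 2"
    using abs_psi_sqrt_ratio_le[of p b] abs_psi_sqrt_ratio_le[of q b] assms by linarith
  have "\<bar>psi (sqrt_ratio b p) - psi (sqrt_ratio b q)\<bar> \<le> 2 * \<bar>sqrt p - sqrt q\<bar> / sqrt q" if "q \<noteq> 0"
  proof -
    have q: "q > 0" using that assms by simp
    define \<alpha> \<alpha>' \<beta> where "\<alpha> = sqrt p" "\<alpha>' = sqrt q" "\<beta> = sqrt b"
    define r r' where "r = sqrt (p + b)" "r' = sqrt (q + b)"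
    note defs = \<alpha>_\<alpha>'_\<beta>_def r_r'_def
    have r': "r' > 0" "\<alpha>' > 0" "\<alpha>' \<le> r'" using q assms by (auto simp: defs)
    have rr: "\<bar>r - r'\<bar> \<le> \<bar>\<alpha> - \<alpha>'\<bar>"
    proof (cases "r + r' = 0")
      case False
      have "\<bar>r - r'\<bar> * (r + r') = \<bar>\<alpha> - \<alpha>'\<bar> * (\<alpha> + \<alpha>')"
      proof -
        have nn: "0 \<le> r + r'" "0 \<le> \<alpha> + \<alpha>'" using assms by (auto simp: defs)
        have "(r - r') * (r + r') = (\<alpha> - \<alpha>') * (\<alpha> + \<alpha>')"
          using assms by (simp add: defs algebra_simps)
        then have "\<bar>(r - r') * (r + r')\<bar> = \<bar>(\<alpha> - \<alpha>') * (\<alpha> + \<alpha>')\<bar>" by simp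
        then show ?thesis using nn by (simp add: abs_mult)
      qed
      also have "\<dots> \<le> \<bar>\<alpha> - \<alpha>'\<bar> * (r + r')"
        using assms by (intro mult_left_mono add_mono) (auto simp: defs)
      finally show ?thesis using r' assms by (auto simp: defs add_nonneg_pos)
    qed (use r' assms in \<open>auto simp: defs add_nonneg_eq_0_iff\<close>)
    have le1: "\<bar>(\<beta> - \<alpha>) / r\<bar> \<le> 1"
      using abs_psi_sqrt_ratio_le[of p b] assms by (simp add: psi_sqrt_ratio defs)
    have "(\<beta> - \<alpha>) / r - (\<beta> - \<alpha>') / r' = (\<alpha>' - \<alpha>) / r' + (\<beta> - \<alpha>) / r * ((r' - r) / r')"
    proof (cases "r = 0")
      case True
      then have "p = 0" "b = 0" using assms by (auto simp: defs add_nonneg_eq_0_iff)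
      then show ?thesis using True by (simp add: defs)
    next
      case False
      then show ?thesis using r' by (simp add: field_simps)
    qed
    then have "\<bar>(\<beta> - \<alpha>) / r - (\<beta> - \<alpha>') / r'\<bar> \<le> \<bar>(\<alpha>' - \<alpha>) / r'\<bar> + \<bar>(\<beta> - \<alpha>) / r\<bar> * \<bar>(r' - r) / r'\<bar>"
      using abs_triangle_ineq abs_mult by metis
    also have "\<bar>(\<beta> - \<alpha>) / r\<bar> * \<bar>(r' - r) / r'\<bar> \<le> 1 * \<bar>(r' - r) / r'\<bar>"
      by (rule mult_right_mono[OF le1]) auto
    also have "\<bar>(r' - r) / r'\<bar> \<le> \<bar>\<alpha> - \<alpha>'\<bar> / r'"
      using rr r' by (simp add: abs_minus_commute divide_right_mono)
    also have "\<bar>(\<alpha>' - \<alpha>) / r'\<bar> + 1 * (\<bar>\<alpha> - \<alpha>'\<bar> / r') = 2 * \<bar>\<alpha> - \<alpha>'\<bar> / r'"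
      using r' by (simp add: abs_minus_commute)
    also have "\<dots> \<le> 2 * \<bar>\<alpha> - \<alpha>'\<bar> / \<alpha>'"
      using r' by (intro divide_left_mono) auto
    finally show ?thesis using assms by (simp add: psi_sqrt_ratio defs)
  qed
  with two show ?thesis by (auto simp: base_change_def)
qed

lemma base_change_bounds:
  assumes "0 \<le> q" shows "0 \<le> base_change p q" "base_change p q \<le> 2"
  using assms by (auto simp: base_change_def)

lemma measurable_base_change:
  assumes "p \<in> prob_densities" "q \<in> prob_densities"
  shows "(\<lambda>x. base_change (p x) (q x)) \<in> borel_measurable borel"
  unfolding base_change_def
  using prob_densitiesD(1)[OF assms(1)] prob_densitiesD(1)[OF assms(2)] by measurable

text \<open>The expectation under s is first compared with that under q, at the price of h^2(s, q).
  Under q the integrand is at most 2 a d, with d the difference of the square roots, and 2 a d \<le>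
  e a^2 + d^2 / e makes it of order e. As the bound is linear in e, it is e = 1/n that stays bounded
  after summation over n observations.\<close>

lemma expected_base_change_le:
  assumes s: "s \<in> prob_densities" and p: "p \<in> prob_densities" and q: "q \<in> prob_densities"
    and e: "0 < e" "hellinger p q \<le> e"
  shows "(\<integral>x. s x * base_change (p x) (q x) \<partial>lborel) \<le> 8 * (hellinger s q)\<^sup>2 + 6 * e"
proof -
  note D = prob_densitiesD
  have "(\<integral>x. s x * base_change (p x) (q x) \<partial>lborel) \<le>
    (\<integral>x. 4 * (sqrt (s x) - sqrt (q x))\<^sup>2 + 2 * (e * q x + (sqrt (p x) - sqrt (q x))\<^sup>2 / e) \<partial>lborel)"
  proof (rule integral_mono)
    show "integrable lborel (\<lambda>x. s x * base_change (p x) (q x))"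
      by (rule integrable_density_mult[OF s measurable_base_change[OF p q], of 2])
        (use base_change_bounds[OF D(2)[OF q]] in auto)
    show "integrable lborel (\<lambda>x. 4 * (sqrt (s x) - sqrt (q x))\<^sup>2 + 2 * (e * q x + (sqrt (p x) - sqrt (q x))\<^sup>2 / e))"
      using integrable_sqrt_diff_sq[OF s q] integrable_sqrt_diff_sq[OF p q] D(3)[OF q] by auto
    fix x
    define c a d where "c = sqrt (s x)" "a = sqrt (q x)" "d = \<bar>sqrt (p x) - sqrt (q x)\<bar>"
    note defs = c_a_d_def
    define \<delta> where "\<delta> = base_change (p x) (q x)"
    have \<delta>: "0 \<le> \<delta>" "\<delta> \<le> 2" using base_change_bounds D(2)[OF q] by (auto simp: \<delta>_def)
    have a: "0 \<le> a" using D(2)[OF q] by (simp add: defs)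
    have "a\<^sup>2 * \<delta> \<le> 2 * a * d"
    proof (cases "a = 0")
      case False
      then have "\<delta> \<le> 2 * d / a" by (auto simp: \<delta>_def base_change_def defs)
      then have "a\<^sup>2 * \<delta> \<le> a\<^sup>2 * (2 * d / a)" by (rule mult_left_mono) auto
      then show ?thesis using False by (simp add: power2_eq_square)
    qed simp
    also have "\<dots> \<le> e * a\<^sup>2 + d\<^sup>2 / e"
    proof -
      have "0 \<le> (e * a - d)\<^sup>2 / e" using e by simp
      also have "\<dots> = e * a\<^sup>2 + d\<^sup>2 / e - 2 * a * d" using e by (simp add: field_simps power2_eq_square)
      finally show ?thesis by simp
    qed
    finally have 1: "a\<^sup>2 * \<delta> \<le> e * a\<^sup>2 + d\<^sup>2 / e" .
    have "c\<^sup>2 \<le> 2 * (c - a)\<^sup>2 + 2 * a\<^sup>2"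
      using zero_le_power2[of "c - 2 * a"] by (simp add: power2_eq_square algebra_simps)
    then have "c\<^sup>2 * \<delta> \<le> (2 * (c - a)\<^sup>2 + 2 * a\<^sup>2) * \<delta>" using \<delta> by (intro mult_right_mono)
    also have "\<dots> = 2 * (c - a)\<^sup>2 * \<delta> + 2 * (a\<^sup>2 * \<delta>)" by (simp add: algebra_simps)
    also have "2 * (c - a)\<^sup>2 * \<delta> \<le> 2 * (c - a)\<^sup>2 * 2" using \<delta> by (intro mult_left_mono) auto
    finally have "c\<^sup>2 * \<delta> \<le> 4 * (c - a)\<^sup>2 + 2 * (e * a\<^sup>2 + d\<^sup>2 / e)" using 1 by simp
    then show "s x * base_change (p x) (q x) \<le>
      4 * (sqrt (s x) - sqrt (q x))\<^sup>2 + 2 * (e * q x + (sqrt (p x) - sqrt (q x))\<^sup>2 / e)"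
      using D(2)[OF s] D(2)[OF q] by (simp add: defs \<delta>_def)
  qed
  also have "\<dots> = 8 * (hellinger s q)\<^sup>2 + 2 * e + 4 * (hellinger p q)\<^sup>2 / e"
    using integrable_sqrt_diff_sq[OF s q] integrable_sqrt_diff_sq[OF p q] D(3)[OF q]
    by (simp add: hellinger_sq D(4)[OF q])
  also have "(hellinger p q)\<^sup>2 \<le> e\<^sup>2" using e hellinger_nonneg by (intro power_mono)
  then have "4 * (hellinger p q)\<^sup>2 / e \<le> 4 * e" using e by (simp add: field_simps power2_eq_square)
  finally show ?thesis by simp
qed

section \<open>Deviations of counts over intervals\<close>

abbreviation law :: "(real \<Rightarrow> real) \<Rightarrow> real measure" where
  "law s \<equiv> density lborel (\<lambda>x. ennreal (s x))"

abbreviation sample_law :: "nat \<Rightarrow> (real \<Rightarrow> real) \<Rightarrow> (nat \<Rightarrow> real) measure" where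
  "sample_law n s \<equiv> (\<Pi>\<^sub>M i\<in>{..<n}. law s)"

lemma prob_space_law: "s \<in> prob_densities \<Longrightarrow> prob_space (law s)"
  by (rule prob_spaceI) (auto simp: prob_densities_def emeasure_density)

lemma prob_space_sample_law: "s \<in> prob_densities \<Longrightarrow> prob_space (sample_law n s)"
  by (intro prob_space_PiM prob_space_law)

lemma integral_law:
  fixes f :: "real \<Rightarrow> real"
  assumes "s \<in> prob_densities" "f \<in> borel_measurable borel"
  shows "(\<integral>x. f x \<partial>law s) = (\<integral>x. s x * f x \<partial>lborel)"
  using assms prob_densitiesD(1,2)[OF assms(1)]
  by (subst integral_density) auto

lemma integrable_law:
  fixes f :: "real \<Rightarrow> real"
  assumes "s \<in> prob_densities" "f \<in> borel_measurable borel" "\<And>x. \<bar>f x\<bar> \<le> K"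
  shows "integrable (law s) f"
proof -
  interpret prob_space "law s" by (rule prob_space_law[OF assms(1)])
  show ?thesis
    using assms by (intro integrable_const_bound[of _ K]) auto
qed

text \<open>Without atoms the distribution function F is continuous, so the infimum u and the
  supremum v of a bounded part of the set, which lie in its closure, still satisfy a \<le> F(u) and
  F(v) \<le> b; the mass between them is F(v) - F(u). Intersecting with [-m, m] makes u and v
  finite.\<close>

lemma cdf_increment_bound:
  assumes s: "s \<in> prob_densities" and ab: "a \<le> b"
  shows "measure (law s) {x. a \<le> cdf (law s) x \<and> cdf (law s) x < b} \<le> b - a"
proof -
  interpret prob_space "law s" by (rule prob_space_law[OF s])
  interpret real_distribution "law s" by unfold_locales auto
  let ?F = "cdf (law s)"
  have null: "measure (law s) {x} = 0" for x
  proof -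
    have "emeasure (law s) {x} = 0"
      using prob_densitiesD(1)[OF s]
      by (subst emeasure_density) (auto simp: nn_integral_0_iff_AE intro!: AE_I[of _ _ "{x}"] simp: indicator_def)
    then show ?thesis by (simp add: measure_def)
  qed
  have cont: "isCont ?F x" for x using null by (simp add: isCont_cdf)
  have [measurable]: "?F \<in> borel_measurable borel"
    by (intro borel_measurable_continuous_onI continuous_at_imp_continuous_on) (auto intro: cont)
  let ?A = "{x. a \<le> ?F x \<and> ?F x < b}"
  let ?B = "\<lambda>m::nat. ?A \<inter> {- real m .. real m}"
  have meas: "?B m \<in> sets (law s)" for m by simp
  have le: "measure (law s) (?B m) \<le> b - a" for m
  proof (cases "?B m = {}")
    case True
    then show ?thesis using ab by (simp only: True measure_empty)
  next
    case False
    define u v where "u = Inf (?B m)" "v = Sup (?B m)"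
    have bd: "bdd_below (?B m)" "bdd_above (?B m)"
      by (auto intro: bdd_below_mono[of "{- real m .. real m}"] bdd_above_mono[of "{- real m .. real m}"])
    have cl: "u \<in> closure (?B m)" "v \<in> closure (?B m)"
      unfolding u_v_def using False bd by (auto intro: closure_contains_Inf closure_contains_Sup)
    have "closure (?B m) \<subseteq> {x. a \<le> ?F x \<and> ?F x \<le> b}"
    proof (rule closure_minimal)
      have "closed {x. a \<le> ?F x}" "closed {x. ?F x \<le> b}"
        by (auto intro!: closed_Collect_le continuous_at_imp_continuous_on cont)
      then show "closed {x. a \<le> ?F x \<and> ?F x \<le> b}" by (rule closed_Collect_conj)
    qed auto
    then have F: "a \<le> ?F u" "?F v \<le> b" using cl by auto
    have sub: "?B m \<subseteq> {u..v}" unfolding u_v_def using cInf_lower[OF _ bd(1)] cSup_upper[OF _ bd(2)] by (meson atLeastAtMost_iff subsetI)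
    have "u \<le> v" using sub False by fastforce
    have "measure (law s) (?B m) \<le> measure (law s) {u..v}"
      by (rule finite_measure_mono[OF sub]) auto
    also have "{u..v} = {u} \<union> {u<..v}" using \<open>u \<le> v\<close> by auto
    also have "measure (law s) \<dots> = measure (law s) {u} + measure (law s) {u<..v}"
      by (rule finite_measure_Union) auto
    also have "\<dots> = ?F v - ?F u"
    proof (cases "u = v")
      case False
      then show ?thesis using cdf_diff_eq[of u v] \<open>u \<le> v\<close> null by simp
    qed (use null in simp)
    also have "\<dots> \<le> b - a" using F by simp
    finally show ?thesis .
  qed
  have "(\<lambda>m. measure (law s) (?B m)) \<longlonglongrightarrow> measure (law s) (\<Union>m. ?B m)"
    by (rule finite_Lim_measure_incseq) (auto simp: incseq_def)
  moreover have "(\<Union>m. ?B m) = ?A"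
  proof -
    have "\<exists>m. - real m \<le> x \<and> x \<le> real m" for x
    proof -
      obtain m where "\<bar>x\<bar> \<le> real m" using real_arch_simple by blast
      then show ?thesis by (intro exI[of _ m]) auto
    qed
    then show ?thesis by auto
  qed
  ultimately have "(\<lambda>m. measure (law s) (?B m)) \<longlonglongrightarrow> measure (law s) ?A" by simp
  then show ?thesis by (rule LIMSEQ_le_const2) (use le in auto)
qed

text \<open>The grid is the integer part of n F, a monotone map, so unions of consecutive cells are
  given by inequalities on its values. The value n can occur where F = 1, hence n + 1 cells.\<close>

lemma quantile_grid:
  assumes s: "s \<in> prob_densities" and n: "0 < n"
  obtains q :: "real \<Rightarrow> nat" where "mono q" "q \<in> borel \<rightarrow>\<^sub>M count_space UNIV" "\<And>x. q x \<le> n"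
    "\<And>a. measure (law s) {x. q x = a} \<le> 1 / real n"
proof -
  interpret prob_space "law s" by (rule prob_space_law[OF s])
  interpret real_distribution "law s" by unfold_locales auto
  let ?F = "cdf (law s)"
  define q where "q x = nat \<lfloor>real n * ?F x\<rfloor>" for x
  have monoF: "mono ?F" by (auto simp: mono_def intro: cdf_nondecreasing)
  have [measurable]: "?F \<in> borel_measurable borel" by (rule borel_measurable_mono[OF monoF])
  show ?thesis
  proof
    show "mono q" unfolding q_def
      by (auto simp: mono_def intro!: nat_mono floor_mono mult_left_mono cdf_nondecreasing)
    show "q \<in> borel \<rightarrow>\<^sub>M count_space UNIV" unfolding q_def by measurable
    show "q x \<le> n" for x
    proof -
      have "real n * ?F x \<le> real n" using cdf_bounded_prob[of x] by (simp add: mult_left_le)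
      then show ?thesis unfolding q_def by (simp add: nat_le_iff floor_le_iff)
    qed
    show "measure (law s) {x. q x = a} \<le> 1 / real n" for a
    proof -
      have "{x. q x = a} \<subseteq> {x. real a / real n \<le> ?F x \<and> ?F x < (real a + 1) / real n}"
      proof
        fix x assume "x \<in> {x. q x = a}"
        then have "nat \<lfloor>real n * ?F x\<rfloor> = a" by (simp add: q_def)
        moreover have "0 \<le> real n * ?F x" by (simp add: cdf_nonneg)
        ultimately have "real a \<le> real n * ?F x \<and> real n * ?F x < real a + 1" by linarith
        then show "x \<in> {x. real a / real n \<le> ?F x \<and> ?F x < (real a + 1) / real n}"
          using n by (simp add: field_simps)
      qed
      then have "measure (law s) {x. q x = a} \<le> measure (law s) {x. real a / real n \<le> ?F x \<and> ?F x < (real a + 1) / real n}"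
        by (rule finite_measure_mono) simp
      also have "\<dots> \<le> (real a + 1) / real n - real a / real n"
        by (rule cdf_increment_bound[OF s]) (simp add: divide_right_mono)
      also have "\<dots> = 1 / real n" using n by (simp add: field_simps)
      finally show ?thesis .
    qed
  qed
qed

section \<open>Exponential moments of counts\<close>

lemma exp_le_quadratic:
  fixes x :: real
  assumes "\<bar>x\<bar> \<le> 1"
  shows "exp x \<le> 1 + x + x\<^sup>2"
proof (cases "0 \<le> x")
  case True
  then show ?thesis using assms by (intro exp_bound) auto
next
  case False
  define y where "y = - x"
  have y: "0 < y" "y \<le> 1" using False assms by (auto simp: y_def)
  have "exp x * (1 + y) \<le> exp x * exp y" by (intro mult_left_mono) auto
  also have "\<dots> = 1" by (simp add: y_def flip: exp_add)
  \<comment> \<open>The right-hand side is 1 + y^3.\<close>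
  also have "\<dots> \<le> (1 - y + y\<^sup>2) * (1 + y)" using y by (simp add: power2_eq_square algebra_simps)
  finally show ?thesis using y by (simp add: y_def)
qed

definition count_in :: "nat \<Rightarrow> real set \<Rightarrow> (nat \<Rightarrow> real) \<Rightarrow> real" where
  "count_in n A X = (\<Sum>i<n. indicator A (X i))"

lemma chernoff_moment:
  fixes n :: nat
  assumes s: "s \<in> prob_densities" and A: "A \<in> sets borel" and l: "\<bar>l\<bar> \<le> 1"
  defines "p \<equiv> measure (law s) A"
  defines "E \<equiv> \<lambda>X. exp (l * (count_in n A X - real n * p) - l\<^sup>2 * (real n * p))"
  shows "integrable (sample_law n s) E" "(\<integral>X. E X \<partial>sample_law n s) \<le> 1"
proof -
  interpret M: prob_space "law s" by (rule prob_space_law[OF s])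
  interpret product_prob_space "\<lambda>_. law s" "{..<n}" by unfold_locales
  define g where "g x = exp (l * (indicator A x - p) - l\<^sup>2 * p)" for x
  have E: "E X = (\<Prod>i<n. g (X i))" for X
    unfolding E_def g_def count_in_def
    by (simp add: exp_sum[symmetric] sum_subtractf sum_distrib_left algebra_simps)
  have gm: "g \<in> borel_measurable borel" unfolding g_def using A by measurable
  have gi: "integrable (law s) g"
  proof (rule integrable_law[OF s gm])
    fix x
    have "l * (indicator A x - p) \<le> \<bar>l * indicator A x\<bar> + \<bar>l * p\<bar>" by (simp add: algebra_simps)
    also have "\<bar>l * indicator A x\<bar> \<le> 1" using l by (simp add: indicator_def)
    finally have "l * (indicator A x - p) \<le> 1 + \<bar>l * p\<bar>" by simp
    moreover have "0 \<le> l\<^sup>2 * p" by (simp add: p_def)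
    ultimately have "l * (indicator A x - p) - l\<^sup>2 * p \<le> 1 + \<bar>l * p\<bar>" by linarith
    then show "\<bar>g x\<bar> \<le> exp (1 + \<bar>l * p\<bar>)" by (simp add: g_def)
  qed
  show "integrable (sample_law n s) E"
    unfolding E by (rule product_integrable_prod) (use gi in auto)
  have "(\<integral>X. E X \<partial>sample_law n s) = (\<Prod>i<n. \<integral>x. g x \<partial>law s)"
    unfolding E by (rule product_integral_prod) (use gi in auto)
  also have "\<dots> \<le> 1"
  proof (rule prod_le_1, safe)
    show "0 \<le> (\<integral>x. g x \<partial>law s)" by (rule Bochner_Integration.integral_nonneg) (simp add: g_def)
    have "g x = exp (- l * p - l\<^sup>2 * p) * (1 + (exp l - 1) * indicator A x)" for x
      by (auto simp: g_def indicator_def algebra_simps simp flip: exp_add)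
    then have "(\<integral>x. g x \<partial>law s) = exp (- l * p - l\<^sup>2 * p) * (1 + (exp l - 1) * p)"
      using A by (simp add: p_def M.prob_space[simplified] M.emeasure_eq_measure)
    also have "\<dots> \<le> exp (- l * p - l\<^sup>2 * p) * exp (l * p + l\<^sup>2 * p)"
    proof (rule mult_left_mono)
      have "(exp l - 1) * p \<le> (l + l\<^sup>2) * p"
        using exp_le_quadratic[OF l] by (intro mult_right_mono) (auto simp: p_def)
      then have "(exp l - 1) * p \<le> l * p + l\<^sup>2 * p" by (simp only: distrib_right)
      then show "1 + (exp l - 1) * p \<le> exp (l * p + l\<^sup>2 * p)"
        using exp_ge_add_one_self[of "l * p + l\<^sup>2 * p"] by linarith
    qed simp
    also have "\<dots> = 1" by (simp flip: exp_add)
    finally show "(\<integral>x. g x \<partial>law s) \<le> 1" .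
  qed
  finally show "(\<integral>X. E X \<partial>sample_law n s) \<le> 1" .
qed

lemma convex_realI:
  fixes C :: "real set"
  assumes "\<And>x y z. x \<in> C \<Longrightarrow> z \<in> C \<Longrightarrow> x \<le> y \<Longrightarrow> y \<le> z \<Longrightarrow> y \<in> C"
  shows "convex C"
  unfolding is_interval_convex_1[symmetric] is_interval_1 using assms by blast

lemma convex_realD:
  fixes C :: "real set"
  assumes "convex C" "x \<in> C" "z \<in> C" "x \<le> y" "y \<le> z"
  shows "y \<in> C"
  using assms unfolding is_interval_convex_1[symmetric] is_interval_1 by blast

lemma count_in_mono: "A \<subseteq> B \<Longrightarrow> count_in n A X \<le> count_in n B X"
  unfolding count_in_def by (intro sum_mono) (auto simp: indicator_def)

text \<open>An interval is sandwiched between two unions of consecutive quantile cells whose difference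
  has mass at most \<open>2 / n\<close>, so only finitely many intervals have to be controlled.\<close>

lemma uniform_interval_deviation:
  assumes s: "s \<in> prob_densities" and n: "3 \<le> n"
  obtains \<Phi> :: "(nat \<Rightarrow> real) \<Rightarrow> real" where
    "integrable (sample_law n s) \<Phi>" "(\<integral>X. \<Phi> X \<partial>sample_law n s) \<le> 5 * ln (real n)"
    "\<And>X. 0 \<le> \<Phi> X"
    "\<And>X I m. convex I \<Longrightarrow> I \<in> sets borel \<Longrightarrow> 1 \<le> m \<Longrightarrow> m \<le> n \<Longrightarrow>
      \<bar>count_in n I X - real n * measure (law s) I\<bar>
        \<le> real m / 48 * measure (law s) I + 48 * real n / real m * \<Phi> X + 4"
proof -
  interpret prob_space "law s" by (rule prob_space_law[OF s])
  interpret S: prob_space "sample_law n s" by (rule prob_space_sample_law[OF s])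
  let ?P = "measure (law s)"
  obtain q where q: "mono q" "q \<in> borel \<rightarrow>\<^sub>M count_space UNIV" "\<And>x. q x \<le> n"
    "\<And>a. ?P {x. q x = a} \<le> 1 / real n"
    using quantile_grid[OF s, of n] n by auto
  note [measurable] = q(2)
  define G where "G a b = {x. a \<le> q x \<and> q x < b}" for a b
  have G[measurable]: "G a b \<in> sets borel" for a b
    unfolding G_def by measurable
  \<comment> \<open>One slope l = m / (48 n) per level m, with both signs for the two tails:
    dividing l \<bar>d\<bar> \<le> l^2 n P + \<Phi> by l gives the relative error m P / 48 and the
    absolute error 48 n \<Phi> / m.\<close>
  define L where "L = (\<lambda>m. real m / (48 * real n)) ` {1..n} \<union> (\<lambda>m. - (real m / (48 * real n))) ` {1..n}"
  define J where "J = {..Suc n} \<times> {..Suc n} \<times> L"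
  have finJ: "finite J" unfolding J_def L_def by auto
  have cardJ: "card J \<le> (n + 2) * ((n + 2) * (2 * n))"
  proof -
    have "card L \<le> n + n" unfolding L_def
      by (rule order_trans[OF card_Un_le add_mono]) (auto intro: order_trans[OF card_image_le])
    then have "card L \<le> 2 * n" by simp
    then show ?thesis unfolding J_def card_cartesian_product card_atMost
      by (intro mult_mono) auto
  qed
  have L1: "\<bar>l\<bar> \<le> 1" if "l \<in> L" for l
  proof -
    have "real m / (48 * real n) \<le> 1" if "m \<in> {1..n}" for m using that by (simp add: divide_le_eq_1)
    then show ?thesis using that by (auto simp: L_def)
  qed
  define Y where "Y = (\<lambda>(a, b, l) X. l * (count_in n (G a b) X - real n * ?P (G a b)) - l\<^sup>2 * (real n * ?P (G a b)))"
  define Z where "Z X = (\<Sum>j\<in>J. exp (Y j X))" for X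
  \<comment> \<open>A soft maximum: it dominates every exponent, and the summand 1 makes it
    nonnegative.\<close>
  define \<Phi> where "\<Phi> X = ln (1 + Z X)" for X
  have Y: "integrable (sample_law n s) (\<lambda>X. exp (Y j X))" "(\<integral>X. exp (Y j X) \<partial>sample_law n s) \<le> 1"
    if "j \<in> J" for j
    using that chernoff_moment[OF s G L1, of _ n] unfolding Y_def J_def
    by (auto simp: case_prod_beta)
  have Zi: "integrable (sample_law n s) Z" unfolding Z_def by (rule Bochner_Integration.integrable_sum) (use Y in auto)
  have Z0: "0 \<le> Z X" for X unfolding Z_def by (intro sum_nonneg) auto
  have \<Phi>0: "0 \<le> \<Phi> X" for X unfolding \<Phi>_def using Z0[of X] by simp
  have Yle: "Y j X \<le> \<Phi> X" if "j \<in> J" for j X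
  proof -
    have "exp (Y j X) \<le> Z X" unfolding Z_def using that finJ by (intro member_le_sum) auto
    then have "exp (Y j X) \<le> 1 + Z X" by simp
    then show ?thesis unfolding \<Phi>_def using Z0[of X] by (simp add: ln_ge_iff)
  qed
  \<comment> \<open>Jensen's inequality is applied through the tangent of ln at c, which works as
    soon as 1 + \<open>card J\<close> \<le> c. The family has at most 2 n (n + 2)^2 members, and n^5
    exceeds this by at least 1 for n \<ge> 3; this is the origin of 5 ln n.\<close>
  define c where "c = real n ^ 5"
  have c1: "c \<ge> 1" unfolding c_def using n by simp
  have Kc: "1 + real (card J) \<le> c"
  proof -
    have "real (card J) \<le> real ((n + 2) * ((n + 2) * (2 * n)))" using cardJ of_nat_mono by blast
    also have "\<dots> = (real n + 2)\<^sup>2 * (2 * real n)" by (simp add: power2_eq_square algebra_simps)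
    also have "\<dots> \<le> (3 * (real n)\<^sup>2) * (2 * real n)"
    proof (rule mult_right_mono)
      have "3 * real n \<le> real n * real n" using n by (intro mult_right_mono) auto
      moreover have "3 \<le> real n" using n by simp
      ultimately have "4 + 4 * real n \<le> 2 * (real n * real n)" by linarith
      then show "(real n + 2)\<^sup>2 \<le> 3 * (real n)\<^sup>2"
        by (simp add: power2_eq_square algebra_simps)
    qed simp
    also have "\<dots> = 6 * real n ^ 3" by (simp add: power2_eq_square power3_eq_cube)
    finally have 1: "real (card J) \<le> 6 * real n ^ 3" .
    have "3 ^ 2 \<le> (real n)\<^sup>2" using n by (intro power_mono) auto
    then have "9 * real n ^ 3 \<le> (real n)\<^sup>2 * real n ^ 3" by (intro mult_right_mono) auto
    moreover have "1 \<le> real n ^ 3" using n by simp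
    ultimately show ?thesis using 1 unfolding c_def by (simp flip: power_add)
  qed
  have \<Phi>le: "\<Phi> X \<le> ln c + (1 + Z X) / c - 1" for X
  proof -
    have "ln ((1 + Z X) / c) \<le> (1 + Z X) / c - 1"
      using Z0[of X] c1 by (intro ln_le_minus_one) auto
    moreover have "ln ((1 + Z X) / c) = \<Phi> X - ln c"
      using Z0[of X] c1 by (simp add: \<Phi>_def ln_div)
    ultimately show ?thesis by simp
  qed
  have Bi: "integrable (sample_law n s) (\<lambda>X. ln c + (1 + Z X) / c - 1)" using Zi by auto
  have \<Phi>i: "integrable (sample_law n s) \<Phi>"
  proof (rule Bochner_Integration.integrable_bound[OF Bi])
    show "\<Phi> \<in> borel_measurable (sample_law n s)" unfolding \<Phi>_def using Zi by measurable
  qed (use \<Phi>0 \<Phi>le in \<open>auto intro!: AE_I2 order_trans[OF \<Phi>le]\<close>)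
  show ?thesis
  proof
    show "integrable (sample_law n s) \<Phi>" by fact
    show "0 \<le> \<Phi> X" for X by fact
    have "(\<integral>X. \<Phi> X \<partial>sample_law n s) \<le> (\<integral>X. ln c + (1 + Z X) / c - 1 \<partial>sample_law n s)"
      by (rule integral_mono[OF \<Phi>i Bi \<Phi>le])
    also have "\<dots> = ln c + (1 + (\<integral>X. Z X \<partial>sample_law n s)) / c - 1"
      using Zi by (simp add: S.prob_space)
    also have "\<dots> \<le> ln c"
    proof -
      have "(\<integral>X. Z X \<partial>sample_law n s) = (\<Sum>j\<in>J. \<integral>X. exp (Y j X) \<partial>sample_law n s)"
        unfolding Z_def by (rule Bochner_Integration.integral_sum) (use Y in auto)
      also have "\<dots> \<le> (\<Sum>j\<in>J. 1)" by (rule sum_mono) (use Y in auto)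
      finally have "1 + (\<integral>X. Z X \<partial>sample_law n s) \<le> c" using Kc by simp
      then show ?thesis using c1 by simp
    qed
    also have "\<dots> = 5 * ln (real n)" using n by (simp add: c_def ln_realpow)
    finally show "(\<integral>X. \<Phi> X \<partial>sample_law n s) \<le> 5 * ln (real n)" .
  next
    fix X and I :: "real set" and m :: nat
    assume I: "convex I" "I \<in> sets borel" and m: "1 \<le> m" "m \<le> n"
    define l where "l = real m / (48 * real n)"
    have l: "l > 0" "l \<in> L" "- l \<in> L" "l \<le> 1" using m n by (auto simp: l_def L_def)
    have dev: "\<bar>count_in n (G a b) X - real n * ?P (G a b)\<bar> \<le> l * real n * ?P (G a b) + \<Phi> X / l"
      if "a \<le> Suc n" "b \<le> Suc n" for a b
    proof -
      define d where "d = count_in n (G a b) X - real n * ?P (G a b)"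
      have "l * d - l\<^sup>2 * (real n * ?P (G a b)) \<le> \<Phi> X" "- l * d - l\<^sup>2 * (real n * ?P (G a b)) \<le> \<Phi> X"
        using Yle[of "(a, b, l)" X] Yle[of "(a, b, - l)" X] that l
        by (auto simp: J_def Y_def d_def)
      then have "l * \<bar>d\<bar> \<le> l * (l * real n * ?P (G a b) + \<Phi> X / l)"
        using l by (auto simp: abs_if algebra_simps power2_eq_square)
      then show ?thesis using l unfolding d_def[symmetric] by simp
    qed
    have n0: "real n > 0" using n by simp
    show "\<bar>count_in n I X - real n * ?P I\<bar> \<le> real m / 48 * ?P I + 48 * real n / real m * \<Phi> X + 4"
    proof (cases "I = {}")
      case True
      then show ?thesis using \<Phi>0[of X] by (simp add: count_in_def)
    next
      case False
      \<comment> \<open>Only the extreme cells a and b can be cut by the interval; all cells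
        strictly between them are contained in it by monotonicity of q. For a = b the inner union is
        empty.\<close>
      define a b where "a = Min (q ` I)" "b = Max (q ` I)"
      have fin: "finite (q ` I)" by (rule finite_subset[of _ "{..n}"]) (use q(3) in auto)
      have "a \<in> q ` I" "b \<in> q ` I" unfolding a_b_def using Min_in[OF fin] Max_in[OF fin] False by simp_all
      then obtain y z where y: "y \<in> I" "q y = a" and z: "z \<in> I" "q z = b" by blast
      have ab: "a \<le> n" "b \<le> n" using y z q(3) by auto
      have up: "I \<subseteq> G a (Suc b)"
        using fin by (auto simp: G_def a_b_def less_Suc_eq_le)
      have low: "G (Suc a) b \<subseteq> I"
      proof
        fix x assume "x \<in> G (Suc a) b"
        then have "q y < q x" "q x < q z" using y z by (auto simp: G_def)
        then have "y < x" "x < z" using monoD[OF q(1)] by (meson leD leI)+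
        then show "x \<in> I" using y z by (intro convex_realD[OF I(1), of y z x]) auto
      qed
      have sub: "G a (Suc b) \<subseteq> G (Suc a) b \<union> ({x. q x = a} \<union> {x. q x = b})"
        by (auto simp: G_def)
      have "?P (G a (Suc b)) \<le> ?P (G (Suc a) b \<union> ({x. q x = a} \<union> {x. q x = b}))"
        by (rule finite_measure_mono[OF sub]) simp
      also have "\<dots> \<le> ?P (G (Suc a) b) + (?P {x. q x = a} + ?P {x. q x = b})"
        by (intro order_trans[OF measure_Un_le] add_left_mono measure_Un_le) auto
      also have "\<dots> \<le> ?P (G (Suc a) b) + 2 / real n"
        using q(4)[of a] q(4)[of b] by simp
      finally have gap: "real n * ?P (G a (Suc b)) \<le> real n * ?P (G (Suc a) b) + 2"
        using n0 by (simp add: field_simps)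
      have lowP: "?P (G (Suc a) b) \<le> ?P I" by (rule finite_measure_mono[OF low]) (use I in auto)
      have upP: "?P I \<le> ?P (G a (Suc b))" by (rule finite_measure_mono[OF up]) auto
      note lowP' = mult_left_mono[OF lowP less_imp_le[OF n0]]
      note upP' = mult_left_mono[OF upP less_imp_le[OF n0]]
      have "l * (real n * ?P (G a (Suc b))) \<le> l * (real n * ?P I + 2)"
        using gap lowP' l by (intro mult_left_mono) auto
      then have lu: "l * real n * ?P (G a (Suc b)) \<le> l * real n * ?P I + 2" using l by (simp add: algebra_simps)
      have ll: "l * real n * ?P (G (Suc a) b) \<le> l * real n * ?P I"
        using lowP l n0 by (intro mult_left_mono) auto
      \<comment> \<open>Of the 4, one half pays for recentring from the union of cells to the
        interval, the other for the change of mass in the relative term, where l \<le> 1.\<close>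
      have "\<bar>count_in n I X - real n * ?P I\<bar> \<le> l * real n * ?P I + \<Phi> X / l + 4"
        using dev[of a "Suc b"] dev[of "Suc a" b] ab lu ll gap lowP' upP'
          count_in_mono[OF up, of n X] count_in_mono[OF low, of n X] by auto
      then show ?thesis using m n by (simp add: l_def field_simps)
    qed
  qed
qed

section \<open>Deviations of piecewise monotone functions\<close>

text \<open>Exceptional points are recorded as a set rather than as a partition: the breaks of two
  functions are then combined by a union, with no ordering to maintain. Values at the points of B
  are unrestricted.\<close>

definition monotone_off :: "real set \<Rightarrow> (real \<Rightarrow> real) \<Rightarrow> bool" where
  "monotone_off B f \<longleftrightarrow> (\<forall>C. convex C \<longrightarrow> C \<inter> B = {} \<longrightarrow> mono_on C f \<or> antimono_on C f)"

section \<open>The gaps between the points of a finite set\<close>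

definition cell_index :: "real set \<Rightarrow> real \<Rightarrow> nat" where
  "cell_index B x = card {b \<in> B. b \<le> x}"

text \<open>Counting the points of B up to x numbers the gaps without sorting B. A point of B has
  the index of the gap on its right, so a function of \<open>cell_index\<close> is defined on the
  whole line, breaks included.\<close>

definition open_cell :: "real set \<Rightarrow> nat \<Rightarrow> real set" where
  "open_cell B i = {x. x \<notin> B \<and> cell_index B x = i}"

lemma cell_index_mono: "finite B \<Longrightarrow> x \<le> y \<Longrightarrow> cell_index B x \<le> cell_index B y"
  unfolding cell_index_def by (intro card_mono) auto

lemma cell_index_le: "finite B \<Longrightarrow> cell_index B x \<le> card B"
  unfolding cell_index_def by (intro card_mono) auto

lemma cell_index_eq_iff:
  assumes "finite B" "x \<le> y"
  shows "cell_index B x = cell_index B y \<longleftrightarrow> B \<inter> {x<..y} = {}"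
proof -
  have "{b \<in> B. b \<le> y} = {b \<in> B. b \<le> x} \<union> (B \<inter> {x<..y})" using assms by auto
  then have "cell_index B y = cell_index B x + card (B \<inter> {x<..y})"
    unfolding cell_index_def using assms by (subst card_Un_disjoint[symmetric]) auto
  then show ?thesis using assms by auto
qed

lemma convex_open_cell:
  assumes "finite B"
  shows "convex (open_cell B i)"
proof (rule convex_realI)
  fix x y z assume xz: "x \<in> open_cell B i" "z \<in> open_cell B i" "x \<le> y" "y \<le> z"
  then have "B \<inter> {x<..z} = {}"
    using cell_index_eq_iff[OF assms, of x z] by (auto simp: open_cell_def)
  moreover have "cell_index B x = cell_index B y"
    using xz cell_index_mono[OF assms, of x y] cell_index_mono[OF assms, of y z] by (auto simp: open_cell_def)
  ultimately show "y \<in> open_cell B i" using xz by (cases "x = y") (auto simp: open_cell_def)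
qed

lemma open_cell_disjoint: "open_cell B i \<inter> B = {}"
  by (auto simp: open_cell_def)

lemma measurable_cell_index[measurable]:
  assumes "finite B"
  shows "cell_index B \<in> borel \<rightarrow>\<^sub>M count_space UNIV"
proof -
  have "cell_index B = (\<lambda>x. \<Sum>b\<in>B. if b \<le> x then 1 else 0)"
    using assms by (auto simp: cell_index_def sum.If_cases fun_eq_iff Int_def)
  moreover have "(\<lambda>x. \<Sum>b\<in>B. if b \<le> x then 1 else 0 :: nat) \<in> borel \<rightarrow>\<^sub>M count_space UNIV"
    by measurable
  ultimately show ?thesis by simp
qed

lemma open_cell_sets[measurable]:
  assumes "finite B"
  shows "open_cell B i \<in> sets borel"
proof -
  note measurable_cell_index[OF assms, measurable]
  have "open_cell B i = {x. cell_index B x = i} - B" by (auto simp: open_cell_def)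
  moreover have "{x. cell_index B x = i} \<in> sets borel" by measurable
  moreover have "B \<in> sets borel" using assms by (simp add: borel_closed finite_imp_closed)
  ultimately show ?thesis by simp
qed

text \<open>The set is cut into its traces on the singletons of B and on the at most
  \<open>card B + 1\<close> gaps, all of which are intervals. The relative errors add up without
  loss because measure is additive; only the absolute error e is multiplied by the number of
  parts.\<close>

lemma deviation_cells:
  assumes s: "s \<in> prob_densities" and B: "finite B" and A: "A \<in> sets borel"
    and conv: "\<And>C. convex C \<Longrightarrow> C \<inter> B = {} \<Longrightarrow> convex (A \<inter> C)"
    and dev: "\<And>I. convex I \<Longrightarrow> I \<in> sets borel \<Longrightarrow>
      \<bar>count_in n I X - real n * measure (law s) I\<bar> \<le> l * measure (law s) I + e"
  shows "\<bar>count_in n A X - real n * measure (law s) A\<bar> \<le>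
    l * measure (law s) A + (2 * real (card B) + 1) * e"
proof -
  interpret prob_space "law s" by (rule prob_space_law[OF s])
  let ?P = "measure (law s)"
  define U where "U = (\<lambda>b. {b}) ` B \<union> open_cell B ` {..card B}"
  define V where "V = (\<lambda>u. A \<inter> u) ` U - {{}}"
  have finV: "finite V" using B by (auto simp: V_def U_def)
  have cardV: "card V \<le> 2 * card B + 1"
  proof -
    have finU: "finite U" using B by (auto simp: U_def)
    have "card V \<le> card ((\<lambda>u. A \<inter> u) ` U)" unfolding V_def using finU by (intro card_mono) auto
    also have "\<dots> \<le> card U" by (rule card_image_le[OF finU])
    also have "\<dots> \<le> card ((\<lambda>b. {b}) ` B) + card (open_cell B ` {..card B})"
      unfolding U_def by (rule card_Un_le)
    also have "\<dots> \<le> card B + (card B + 1)"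
      using card_image_le[OF B, of "\<lambda>b. {b}"] card_image_le[of "{..card B}" "open_cell B"]
      by simp
    finally show ?thesis by simp
  qed
  have disj: "disjoint V"
  proof -
    have "disjoint U" unfolding U_def disjoint_def by (auto simp: open_cell_def)
    then show ?thesis unfolding V_def disjoint_def by fastforce
  qed
  have UnV: "\<Union>V = A"
  proof -
    have "x \<in> \<Union>U" for x
      using cell_index_le[OF B, of x] by (cases "x \<in> B") (auto simp: U_def open_cell_def)
    then have "\<Union>U = UNIV" by auto
    moreover have "\<Union>V = A \<inter> \<Union>U" unfolding V_def by blast
    ultimately show ?thesis by simp
  qed
  have convV: "convex v \<and> v \<in> sets borel" if "v \<in> V" for v
  proof -
    have 1: "convex (A \<inter> {b})" for b by (cases "b \<in> A") auto
    have 2: "convex (A \<inter> open_cell B i)" for i by (intro conv convex_open_cell B open_cell_disjoint)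
    show ?thesis using that 1 2 A open_cell_sets[OF B] by (auto simp: V_def U_def)
  qed
  have cnt: "count_in n A X = (\<Sum>v\<in>V. count_in n v X)"
  proof -
    have "indicator A x = (\<Sum>v\<in>V. indicator v x :: real)" for x
      using indicator_UN_disjoint[of V "\<lambda>v. v" x] finV disj UnV
      by (simp add: disjoint_family_on_def disjoint_def)
    then show ?thesis unfolding count_in_def by (simp add: sum.swap[of _ V])
  qed
  have P: "?P A = (\<Sum>v\<in>V. ?P v)"
    using finite_measure_finite_Union[of V "\<lambda>v. v"] finV convV disj UnV
    by (auto simp: disjoint_family_on_def disjoint_def)
  have "0 \<le> e" using dev[of "{}"] by (simp add: count_in_def)
  have "\<bar>count_in n A X - real n * ?P A\<bar> = \<bar>\<Sum>v\<in>V. count_in n v X - real n * ?P v\<bar>"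
    unfolding cnt P by (simp add: sum_subtractf sum_distrib_left)
  also have "\<dots> \<le> (\<Sum>v\<in>V. l * ?P v + e)"
    by (rule order_trans[OF sum_abs], rule sum_mono, rule dev) (use convV in auto)
  also have "\<dots> = l * ?P A + real (card V) * e"
    unfolding P by (simp add: sum.distrib sum_distrib_left)
  also have "real (card V) \<le> 2 * real (card B) + 1" using cardV by linarith
  then have "real (card V) * e \<le> (2 * real (card B) + 1) * e"
    using \<open>0 \<le> e\<close> by (intro mult_right_mono)
  finally show ?thesis by simp
qed

text \<open>An intermediate value of a monotone function is at least one of the two outer values.
  Here monotonicity, in either direction, becomes a statement about intervals.\<close>

lemma monotone_off_superlevel_convex:
  assumes "monotone_off B f" "convex C" "C \<inter> B = {}"
  shows "convex ({x. u \<le> f x} \<inter> C)"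
proof (rule convex_realI)
  fix x y z assume h: "x \<in> {x. u \<le> f x} \<inter> C" "z \<in> {x. u \<le> f x} \<inter> C" "x \<le> y" "y \<le> z"
  then have y: "y \<in> C" using convex_realD[OF assms(2), of x z y] by auto
  have "mono_on C f \<or> antimono_on C f" using assms by (auto simp: monotone_off_def)
  then have "f x \<le> f y \<or> f z \<le> f y"
    using h y by (auto simp: monotone_on_def)
  then show "y \<in> {x. u \<le> f x} \<inter> C" using h y by auto
qed

section \<open>Sums over the levels m / n\<close>

lemma harmonic_sum_le:
  assumes "1 \<le> n"
  shows "(\<Sum>m=1..n. 1 / real m) \<le> 1 + ln (real n)"
  using assms
proof (induction n rule: nat_induct_at_least)
  case base
  then show ?case by simp
next
  case (Suc n)
  have "ln (real n / real (Suc n)) \<le> real n / real (Suc n) - 1"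
    using Suc by (intro ln_le_minus_one) auto
  moreover have "ln (real n / real (Suc n)) = ln (real n) - ln (real (Suc n))"
    using Suc.hyps by (subst ln_div) auto
  moreover have "real n / real (Suc n) - 1 = - (1 / real (Suc n))" by (simp add: field_simps)
  ultimately show ?case using Suc by simp
qed

text \<open>With M the integer part of n y, the levels not exceeding y are those with m \<le> M;
  hence c = M / n, and the weighted sum has M nonzero terms of size at most M.\<close>

lemma sum_mult_indicator_levels:
  assumes "0 \<le> (y::real)" "y \<le> 1" "1 \<le> n"
  defines "c \<equiv> (\<Sum>m=1..n. of_bool (real m / real n \<le> y) / real n)"
  shows "\<bar>y - c\<bar> \<le> 1 / real n"
    "(\<Sum>m=1..n. real m * of_bool (real m / real n \<le> y)) \<le> (real n * y)\<^sup>2"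
proof -
  define M where "M = nat \<lfloor>real n * y\<rfloor>"
  have n: "real n > 0" using assms by simp
  have ny: "0 \<le> real n * y" "real n * y \<le> real n" using assms by (auto simp: mult_left_le)
  have M: "real M \<le> real n * y" "real n * y < real M + 1" unfolding M_def using ny by linarith+
  have "M \<le> n" using M ny by linarith
  have set: "{1..n} \<inter> {m. real m / real n \<le> y} = {1..M}"
  proof -
    have "real m / real n \<le> y \<longleftrightarrow> m \<le> M" for m
    proof -
      have "real m / real n \<le> y \<longleftrightarrow> real m \<le> real n * y" using n by (simp add: field_simps)
      also have "\<dots> \<longleftrightarrow> m \<le> M" unfolding M_def using ny by (simp add: le_nat_floor le_nat_iff le_floor_iff)
      finally show ?thesis .
    qed
    then have "{m. real m / real n \<le> y} = {..M}" by auto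
    then show ?thesis using \<open>M \<le> n\<close> by auto
  qed
  have "c = (\<Sum>m\<in>{1..n} \<inter> {m. real m / real n \<le> y}. 1 / real n)"
    unfolding c_def sum.inter_restrict[OF finite_atLeastAtMost] by (rule sum.cong) auto
  then have "c = real M / real n" unfolding set by simp
  then show "\<bar>y - c\<bar> \<le> 1 / real n" using M n by (simp add: field_simps abs_if)
  have "(\<Sum>m=1..n. real m * of_bool (real m / real n \<le> y)) = (\<Sum>m\<in>{1..n} \<inter> {m. real m / real n \<le> y}. real m)"
    unfolding sum.inter_restrict[OF finite_atLeastAtMost] by (rule sum.cong) auto
  also have "\<dots> = (\<Sum>m=1..M. real m)" unfolding set ..
  also have "\<dots> \<le> (\<Sum>m=1..M. real M)" by (intro sum_mono) auto
  also have "\<dots> = (real M)\<^sup>2" by (simp add: power2_eq_square)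
  also have "\<dots> \<le> (real n * y)\<^sup>2" using M by (intro power_mono) auto
  finally show "(\<Sum>m=1..n. real m * of_bool (real m / real n \<le> y)) \<le> (real n * y)\<^sup>2" .
qed

text \<open>The level \<open>m / n\<close> is compared at relative precision \<open>m / (48 n)\<close>: summed over the levels,
  the relative errors add up to a second moment and the absolute ones to a harmonic sum.\<close>

lemma deviation_nonneg_part:
  assumes s: "s \<in> prob_densities" and n: "1 \<le> n" and B: "finite B"
    and f: "f \<in> borel_measurable borel" "\<And>x. f x \<le> 1" and mono: "monotone_off B f" and \<phi>: "0 \<le> \<phi>"
    and dev: "\<And>I m. convex I \<Longrightarrow> I \<in> sets borel \<Longrightarrow> 1 \<le> m \<Longrightarrow> m \<le> n \<Longrightarrow>
      \<bar>count_in n I X - real n * measure (law s) I\<bar>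
        \<le> real m / 48 * measure (law s) I + 48 * real n / real m * \<phi> + 4"
  shows "\<bar>(\<Sum>i<n. max 0 (f (X i))) - real n * (\<integral>x. max 0 (f x) \<partial>law s)\<bar> \<le>
    real n / 48 * (\<integral>x. (max 0 (f x))\<^sup>2 \<partial>law s)
    + (2 * real (card B) + 1) * (48 * (1 + ln (real n)) * \<phi> + 4) + 2"
proof -
  interpret prob_space "law s" by (rule prob_space_law[OF s])
  let ?P = "measure (law s)"
  have n0: "real n > 0" using n by simp
  define g where "g x = max 0 (f x)" for x
  have g: "0 \<le> g x" "g x \<le> 1" for x using f(2)[of x] by (auto simp: g_def)
  have [measurable]: "f \<in> borel_measurable borel" by fact
  have gm[measurable]: "g \<in> borel_measurable borel" unfolding g_def by measurable
  define A where "A m = {x. real m / real n \<le> f x}" for m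
  have A[measurable]: "A m \<in> sets borel" for m unfolding A_def by measurable
  \<comment> \<open>Levels with m \<ge> 1 are positive, so the superlevel sets of f and of its
    positive part agree, and their interval structure can be read off from f itself.\<close>
  have Ag: "indicator (A m) x = (of_bool (real m / real n \<le> g x) :: real)" if "1 \<le> m" for m x
  proof -
    have "0 < real m / real n" using that n0 by simp
    then show ?thesis by (auto simp: A_def g_def indicator_def max_def)
  qed
  define c where "c x = (\<Sum>m=1..n. indicator (A m) x / real n :: real)" for x
  have c: "\<bar>g x - c x\<bar> \<le> 1 / real n" for x
  proof -
    have "c x = (\<Sum>m=1..n. of_bool (real m / real n \<le> g x) / real n)"
      unfolding c_def by (intro sum.cong) (auto simp: Ag)
    then show ?thesis using sum_mult_indicator_levels(1)[OF g n, of x] by simp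
  qed
  have cm[measurable]: "c \<in> borel_measurable borel" unfolding c_def by measurable
  have gi: "integrable (law s) g" by (rule integrable_law[OF s gm, of 1]) (use g in auto)
  have Ai: "integrable (law s) (indicator (A m) :: real \<Rightarrow> real)" for m
    by (rule integrable_law[OF s, of _ 1]) (auto simp: indicator_def)
  have ci: "integrable (law s) c" unfolding c_def using Ai by (intro Bochner_Integration.integrable_sum integrable_divide) auto
  have g2i: "integrable (law s) (\<lambda>x. (g x)\<^sup>2)"
    by (rule integrable_law[OF s, of _ 1]) (use g in \<open>auto simp: abs_square_le_1 power_le_one\<close>)
  have c_sum: "(\<Sum>i<n. c (X i)) = (\<Sum>m=1..n. count_in n (A m) X / real n)"
    unfolding c_def count_in_def by (subst sum.swap) (simp add: sum_divide_distrib)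
  have c_int: "(\<integral>x. c x \<partial>law s) = (\<Sum>m=1..n. ?P (A m) / real n)"
    unfolding c_def by (subst Bochner_Integration.integral_sum) (use Ai in auto)
  let ?e = "\<lambda>m. 48 * real n / real m * \<phi> + 4"
  let ?K = "2 * real (card B) + 1"
  have devA: "\<bar>count_in n (A m) X - real n * ?P (A m)\<bar> \<le> real m / 48 * ?P (A m) + ?K * ?e m"
    if "1 \<le> m" "m \<le> n" for m
  proof (rule deviation_cells[OF s B A])
    fix C :: "real set" assume "convex C" "C \<inter> B = {}"
    then show "convex (A m \<inter> C)" unfolding A_def by (rule monotone_off_superlevel_convex[OF mono])
  next
    fix I :: "real set" assume "convex I" "I \<in> sets borel"
    then show "\<bar>count_in n I X - real n * ?P I\<bar> \<le> real m / 48 * ?P I + ?e m"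
      using dev[of I m] that by (simp add: add.assoc)
  qed
  have second: "(\<Sum>m=1..n. real m * ?P (A m)) \<le> (real n)\<^sup>2 * (\<integral>x. (g x)\<^sup>2 \<partial>law s)"
  proof -
    have "(\<Sum>m=1..n. real m * ?P (A m)) = (\<integral>x. (\<Sum>m=1..n. real m * indicator (A m) x) \<partial>law s)"
      by (subst Bochner_Integration.integral_sum) (use Ai in auto)
    also have "\<dots> \<le> (\<integral>x. (real n)\<^sup>2 * (g x)\<^sup>2 \<partial>law s)"
    proof (rule integral_mono)
      fix x
      have "(\<Sum>m=1..n. real m * indicator (A m) x) = (\<Sum>m=1..n. real m * of_bool (real m / real n \<le> g x))"
        by (intro sum.cong) (auto simp: Ag)
      also have "\<dots> \<le> (real n * g x)\<^sup>2" by (rule sum_mult_indicator_levels(2)[OF g n])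
      finally show "(\<Sum>m=1..n. real m * indicator (A m) x) \<le> (real n)\<^sup>2 * (g x)\<^sup>2" by (simp add: power_mult_distrib)
    next
      show "integrable (law s) (\<lambda>x. \<Sum>m=1..n. real m * indicator (A m) x)"
        by (intro Bochner_Integration.integrable_sum integrable_mult_right Ai)
    qed (use g2i in simp)
    finally show ?thesis using g2i by simp
  qed
  have main: "\<bar>(\<Sum>i<n. c (X i)) - real n * (\<integral>x. c x \<partial>law s)\<bar> \<le>
    real n / 48 * (\<integral>x. (g x)\<^sup>2 \<partial>law s) + ?K * (48 * (1 + ln (real n)) * \<phi> + 4)"
  proof -
    have "\<bar>(\<Sum>i<n. c (X i)) - real n * (\<integral>x. c x \<partial>law s)\<bar> =
      \<bar>\<Sum>m=1..n. (count_in n (A m) X - real n * ?P (A m)) / real n\<bar>"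
      unfolding c_sum c_int
      by (simp add: sum_subtractf[symmetric] sum_distrib_left diff_divide_distrib)
    also have "\<dots> \<le> (\<Sum>m=1..n. (real m / 48 * ?P (A m) + ?K * ?e m) / real n)"
    proof (rule order_trans[OF sum_abs], rule sum_mono)
      fix m assume "m \<in> {1..n}"
      then have "\<bar>count_in n (A m) X - real n * ?P (A m)\<bar> \<le> real m / 48 * ?P (A m) + ?K * ?e m"
        by (intro devA) auto
      then show "\<bar>(count_in n (A m) X - real n * ?P (A m)) / real n\<bar> \<le> (real m / 48 * ?P (A m) + ?K * ?e m) / real n"
        using n0 unfolding abs_divide by (simp only: abs_of_pos divide_right_mono less_imp_le)
    qed
    also have "\<dots> = (\<Sum>m=1..n. real m * ?P (A m)) / (48 * real n)
      + ?K * (48 * \<phi> * (\<Sum>m=1..n. 1 / real m) + 4)"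
    proof -
      have "(real m / 48 * ?P (A m) + ?K * ?e m) / real n =
        real m * ?P (A m) / (48 * real n) + ?K * (48 * \<phi> * (1 / real m) + 4 / real n)" if "m \<in> {1..n}" for m
      proof -
        have "real m \<noteq> 0" "real n \<noteq> 0" using that by auto
        then show ?thesis by (simp add: field_simps)
      qed
      then have "(\<Sum>m=1..n. (real m / 48 * ?P (A m) + ?K * ?e m) / real n) =
        (\<Sum>m=1..n. real m * ?P (A m) / (48 * real n) + ?K * (48 * \<phi> * (1 / real m) + 4 / real n))"
        by (intro sum.cong) auto
      also have "\<dots> = (\<Sum>m=1..n. real m * ?P (A m)) / (48 * real n)
         + ?K * (48 * \<phi> * (\<Sum>m=1..n. 1 / real m) + (\<Sum>m=1..n. 4 / real n))"
        by (simp only: sum.distrib sum_distrib_left[symmetric] sum_divide_distrib[symmetric])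
      also have "(\<Sum>m=1..n. 4 / real n) = 4" using n0 by simp
      finally show ?thesis .
    qed
    also have "\<dots> \<le> (real n)\<^sup>2 * (\<integral>x. (g x)\<^sup>2 \<partial>law s) / (48 * real n)
      + ?K * (48 * \<phi> * (1 + ln (real n)) + 4)"
      using second n0 harmonic_sum_le[OF n] \<phi>
      by (intro add_mono divide_right_mono mult_left_mono) auto
    also have "(real n)\<^sup>2 * (\<integral>x. (g x)\<^sup>2 \<partial>law s) / (48 * real n) = real n / 48 * (\<integral>x. (g x)\<^sup>2 \<partial>law s)"
      using n0 by (simp add: power2_eq_square)
    finally show ?thesis by (simp add: mult_ac)
  qed
  \<comment> \<open>Rounding g down to the grid costs 1/n per observation and 1/n in the mean, which
    is multiplied by n: together the summand 2.\<close>
  have err1: "\<bar>(\<Sum>i<n. g (X i)) - (\<Sum>i<n. c (X i))\<bar> \<le> 1"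
  proof -
    have "\<bar>(\<Sum>i<n. g (X i)) - (\<Sum>i<n. c (X i))\<bar> \<le> (\<Sum>i<n. \<bar>g (X i) - c (X i)\<bar>)"
      by (simp add: sum_subtractf[symmetric])
    also have "\<dots> \<le> (\<Sum>i<n. 1 / real n)" by (intro sum_mono c)
    also have "\<dots> = 1" using n0 by simp
    finally show ?thesis .
  qed
  have err2: "\<bar>(\<integral>x. g x \<partial>law s) - (\<integral>x. c x \<partial>law s)\<bar> \<le> 1 / real n"
  proof -
    have "\<bar>(\<integral>x. g x \<partial>law s) - (\<integral>x. c x \<partial>law s)\<bar> = \<bar>\<integral>x. g x - c x \<partial>law s\<bar>"
      using gi ci by simp
    also have "\<dots> \<le> (\<integral>x. \<bar>g x - c x\<bar> \<partial>law s)" by (rule integral_abs_bound)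
    also have "\<dots> \<le> (\<integral>x. 1 / real n \<partial>law s)"
      using gi ci c by (intro integral_mono) auto
    finally show ?thesis by (simp add: prob_space[simplified])
  qed
  have "\<bar>real n * (\<integral>x. g x \<partial>law s) - real n * (\<integral>x. c x \<partial>law s)\<bar> \<le> 1"
  proof -
    have "\<bar>real n * (\<integral>x. g x \<partial>law s) - real n * (\<integral>x. c x \<partial>law s)\<bar> =
      real n * \<bar>(\<integral>x. g x \<partial>law s) - (\<integral>x. c x \<partial>law s)\<bar>"
      using n0 by (simp add: abs_mult flip: right_diff_distrib)
    also have "\<dots> \<le> real n * (1 / real n)" using n0 by (intro mult_left_mono err2) auto
    finally show ?thesis using n0 by simp
  qed
  then show ?thesis using main err1 unfolding g_def by linarith
qed

lemma monotone_off_uminus: "monotone_off B f \<Longrightarrow> monotone_off B (\<lambda>x. - f x)"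
  unfolding monotone_off_def monotone_on_def neg_le_iff_le by blast

text \<open>The squares of the positive and the negative part add up to f^2, so treating them
  separately keeps the factor 1/48 of the relative error and only doubles the absolute one.\<close>

lemma deviation_monotone_off:
  assumes s: "s \<in> prob_densities" and n: "3 \<le> n" and B: "finite B"
    and f: "f \<in> borel_measurable borel" "\<And>x. \<bar>f x\<bar> \<le> 1" and mono: "monotone_off B f" and \<phi>: "0 \<le> \<phi>"
    and dev: "\<And>I m. convex I \<Longrightarrow> I \<in> sets borel \<Longrightarrow> 1 \<le> m \<Longrightarrow> m \<le> n \<Longrightarrow>
      \<bar>count_in n I X - real n * measure (law s) I\<bar>
        \<le> real m / 48 * measure (law s) I + 48 * real n / real m * \<phi> + 4"
  shows "\<bar>(\<Sum>i<n. f (X i)) - real n * (\<integral>x. f x \<partial>law s)\<bar> \<le>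
    real n / 48 * (\<integral>x. (f x)\<^sup>2 \<partial>law s)
    + 2 * (2 * real (card B) + 1) * (48 * (1 + ln (real n)) * \<phi> + 4) + 4"
proof -
  have n1: "1 \<le> n" using n by simp
  have [measurable]: "f \<in> borel_measurable borel" by fact
  have b: "f x \<le> 1" "- f x \<le> 1" for x using f(2)[of x] by auto
  have up: "\<bar>(\<Sum>i<n. max 0 (f (X i))) - real n * (\<integral>x. max 0 (f x) \<partial>law s)\<bar> \<le>
    real n / 48 * (\<integral>x. (max 0 (f x))\<^sup>2 \<partial>law s)
    + (2 * real (card B) + 1) * (48 * (1 + ln (real n)) * \<phi> + 4) + 2"
    by (rule deviation_nonneg_part[OF s n1 B f(1) b(1) mono \<phi>]) (rule dev)
  have low: "\<bar>(\<Sum>i<n. max 0 (- f (X i))) - real n * (\<integral>x. max 0 (- f x) \<partial>law s)\<bar> \<le>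
    real n / 48 * (\<integral>x. (max 0 (- f x))\<^sup>2 \<partial>law s)
    + (2 * real (card B) + 1) * (48 * (1 + ln (real n)) * \<phi> + 4) + 2"
    by (rule deviation_nonneg_part[OF s n1 B _ b(2) monotone_off_uminus[OF mono] \<phi>]) (simp, rule dev)
  have i: "integrable (law s) (\<lambda>x. max 0 (f x))" "integrable (law s) (\<lambda>x. max 0 (- f x))"
    "integrable (law s) (\<lambda>x. (max 0 (f x))\<^sup>2)" "integrable (law s) (\<lambda>x. (max 0 (- f x))\<^sup>2)"
    by (rule integrable_law[OF s, of _ 1]; use b in \<open>auto simp: abs_square_le_1 power_le_one\<close>)+
  have "(\<Sum>i<n. f (X i)) = (\<Sum>i<n. max 0 (f (X i))) - (\<Sum>i<n. max 0 (- f (X i)))"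
    unfolding sum_subtractf[symmetric] by (intro sum.cong) auto
  moreover have "(\<integral>x. f x \<partial>law s) = (\<integral>x. max 0 (f x) \<partial>law s) - (\<integral>x. max 0 (- f x) \<partial>law s)"
    by (subst Bochner_Integration.integral_diff[symmetric, OF i(1,2)])
       (auto intro!: Bochner_Integration.integral_cong)
  then have "real n * (\<integral>x. f x \<partial>law s) = real n * (\<integral>x. max 0 (f x) \<partial>law s) - real n * (\<integral>x. max 0 (- f x) \<partial>law s)"
    by (simp add: right_diff_distrib)
  moreover have "(\<integral>x. (f x)\<^sup>2 \<partial>law s) = (\<integral>x. (max 0 (f x))\<^sup>2 \<partial>law s) + (\<integral>x. (max 0 (- f x))\<^sup>2 \<partial>law s)"
    by (subst Bochner_Integration.integral_add[symmetric, OF i(3,4)])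
       (auto intro!: Bochner_Integration.integral_cong simp: max_def)
  then have "real n / 48 * (\<integral>x. (f x)\<^sup>2 \<partial>law s) = real n / 48 * (\<integral>x. (max 0 (f x))\<^sup>2 \<partial>law s) + real n / 48 * (\<integral>x. (max 0 (- f x))\<^sup>2 \<partial>law s)"
    by (simp add: distrib_left)
  moreover have "2 * (2 * real (card B) + 1) * (48 * (1 + ln (real n)) * \<phi> + 4) =
    (2 * real (card B) + 1) * (48 * (1 + ln (real n)) * \<phi> + 4) + (2 * real (card B) + 1) * (48 * (1 + ln (real n)) * \<phi> + 4)"
    by simp
  ultimately show ?thesis using up low by linarith
qed

section \<open>Level breaks on the pieces of a partition\<close>

definition breaks :: "nat \<Rightarrow> (nat \<Rightarrow> ereal) \<Rightarrow> real set" where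
  "breaks k x = {y. \<exists>j. 0 < j \<and> j < k \<and> x j = ereal y}"

lemma breaks_finite_card: "finite (breaks k x)" "card (breaks k x) \<le> k - 1"
proof -
  have sub: "breaks k x \<subseteq> (\<lambda>j. real_of_ereal (x j)) ` {1..<k}"
  proof
    fix y assume "y \<in> breaks k x"
    then obtain j where "0 < j" "j < k" "x j = ereal y" by (auto simp: breaks_def)
    then show "y \<in> (\<lambda>j. real_of_ereal (x j)) ` {1..<k}" by (intro image_eqI[of _ _ j]) auto
  qed
  then show "finite (breaks k x)" by (rule finite_subset) auto
  have "card (breaks k x) \<le> card ((\<lambda>j. real_of_ereal (x j)) ` {1..<k})" by (rule card_mono[OF _ sub]) auto
  also have "\<dots> \<le> card {1..<k}" by (rule card_image_le) auto
  finally show "card (breaks k x) \<le> k - 1" by simp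
qed

lemma partitions_less:
  assumes "x \<in> partitions k" "i < j" "j \<le> k"
  shows "x i < x j"
  using assms(2,3)
proof (induction j)
  case (Suc j)
  have step: "x j < x (Suc j)" using assms(1) Suc.prems by (auto simp: partitions_def)
  show ?case
  proof (cases "i = j")
    case False
    then have "x i < x j" using Suc by auto
    then show ?thesis using step by simp
  qed (use step in simp)
qed simp

lemma partitions_inner_real:
  assumes "x \<in> partitions k" "0 < j" "j < k"
  obtains y where "x j = ereal y" "y \<in> breaks k x"
proof -
  have "x 0 < x j" "x j < x k" using assms by (auto intro: partitions_less)
  then have "x j \<noteq> - \<infinity>" "x j \<noteq> \<infinity>" by auto
  then obtain y where "x j = ereal y" by (cases "x j") auto
  then show ?thesis using that assms by (auto simp: breaks_def)
qed

lemma piece_cover: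
  assumes x: "x \<in> partitions k" and y: "y \<notin> breaks k x"
  obtains j where "j < k" "y \<in> piece x j"
proof -
  have k: "x 0 = - \<infinity>" "x k = \<infinity>" using x by (auto simp: partitions_def)
  then have "0 < k" by (cases k) auto
  define J where "J = {i. i < k \<and> x i < ereal y}"
  have J: "finite J" "0 \<in> J" using \<open>0 < k\<close> k by (auto simp: J_def)
  define j where "j = Max J"
  have "j \<in> J" unfolding j_def using J by (intro Max_in) auto
  then have j: "j < k" "x j < ereal y" by (auto simp: J_def)
  have "ereal y < x (Suc j)"
  proof (cases "Suc j = k")
    case False
    then have sj: "Suc j < k" using j by simp
    have "Suc j \<notin> J"
    proof
      assume "Suc j \<in> J"
      then have "Suc j \<le> j" unfolding j_def by (rule Max_ge[OF J(1)])
      then show False by simp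
    qed
    then have "ereal y \<le> x (Suc j)" using sj by (auto simp: J_def)
    moreover have "x (Suc j) \<noteq> ereal y" using y sj by (auto simp: breaks_def)
    ultimately show ?thesis by auto
  qed (use k in simp)
  then show ?thesis using that j by (auto simp: piece_def)
qed

lemma convex_subset_piece:
  assumes x: "x \<in> partitions k" and j: "j < k" and C: "convex C" "C \<inter> breaks k x = {}"
    and y: "y \<in> C" "y \<in> piece x j"
  shows "C \<subseteq> piece x j"
proof
  fix z assume z: "z \<in> C"
  have k: "x 0 = - \<infinity>" "x k = \<infinity>" using x by (auto simp: partitions_def)
  have "x j < ereal z"
  proof (cases "j = 0")
    case False
    then obtain b where b: "x j = ereal b" "b \<in> breaks k x" using partitions_inner_real[OF x, of j] j by auto
    have "b < z"
    proof (rule ccontr)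
      assume "\<not> b < z"
      then have "b \<in> C" using convex_realD[OF C(1) z y(1), of b] y b by (auto simp: piece_def)
      then show False using b C by auto
    qed
    then show ?thesis using b by simp
  qed (use k in simp)
  moreover have "ereal z < x (Suc j)"
  proof (cases "Suc j = k")
    case False
    then obtain b where b: "x (Suc j) = ereal b" "b \<in> breaks k x"
      using partitions_inner_real[OF x, of "Suc j"] j by auto
    have "z < b"
    proof (rule ccontr)
      assume "\<not> z < b"
      then have "b \<in> C" using convex_realD[OF C(1) y(1) z, of b] y b by (auto simp: piece_def)
      then show False using b C by auto
    qed
    then show ?thesis using b by simp
  qed (use k in simp)
  ultimately show "z \<in> piece x j" by (simp add: piece_def)
qed

lemma monotone_off_breaks:
  assumes "piecewise_monotone_on_partition k x f"
  shows "monotone_off (breaks k x) f"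
  unfolding monotone_off_def
proof (intro allI impI)
  fix C :: "real set" assume C: "convex C" "C \<inter> breaks k x = {}"
  have x: "x \<in> partitions k" using assms by (simp add: piecewise_monotone_on_partition_def)
  show "mono_on C f \<or> antimono_on C f"
  proof (cases "C = {}")
    case False
    then obtain y where y: "y \<in> C" by auto
    then obtain j where j: "j < k" "y \<in> piece x j" using piece_cover[OF x, of y] C by auto
    have "C \<subseteq> piece x j" by (rule convex_subset_piece[OF x j(1) C y j(2)])
    moreover have "mono_on (piece x j) f \<or> antimono_on (piece x j) f"
      using assms j by (simp add: piecewise_monotone_on_partition_def)
    ultimately show ?thesis by (meson monotone_on_subset)
  qed (simp add: monotone_on_def)
qed

lemma open_piece: "open (piece x j)"
proof -
  have "piece x j = ereal -` {x j<..<x (Suc j)}" by (auto simp: piece_def)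
  then show ?thesis by (simp add: open_vimage continuous_on_ereal continuous_on_id)
qed

lemma piece_nonnull:
  assumes "x \<in> partitions k" "j < k"
  shows "0 < emeasure lborel (piece x j)" "piece x j \<noteq> {}"
proof -
  have "x j < x (Suc j)" using assms by (auto simp: partitions_def)
  then obtain a where a: "x j < ereal a" "ereal a < x (Suc j)" using ereal_dense2 by blast
  then obtain b where b: "ereal a < ereal b" "ereal b < x (Suc j)" using ereal_dense2 by blast
  show "piece x j \<noteq> {}" using a by (auto simp: piece_def)
  have sub: "{a..b} \<subseteq> piece x j"
  proof
    fix y assume "y \<in> {a..b}"
    then have "ereal a \<le> ereal y" "ereal y \<le> ereal b" by auto
    then have "x j < ereal y" "ereal y < x (Suc j)"
      using less_le_trans[OF a(1)] le_less_trans[OF _ b(2)] by blast+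
    then show "y \<in> piece x j" by (simp add: piece_def)
  qed
  have "0 < emeasure lborel {a..b}" using b by simp
  also have "\<dots> \<le> emeasure lborel (piece x j)"
    by (rule emeasure_mono[OF sub]) (simp add: open_piece borel_open)
  finally show "0 < emeasure lborel (piece x j)" .
qed

lemma variation_bound:
  assumes "variation I g \<le> ennreal v" "0 \<le> v" "open I" "y \<in> I" "z \<in> I"
  shows "g y - g z \<le> v"
proof -
  have "ereal (g y) - ereal (g z) \<le> (SUP y\<in>interior I. ereal (g y)) - (INF y\<in>interior I. ereal (g y))"
    using assms by (intro ereal_minus_mono SUP_upper INF_lower) (auto simp: interior_open)
  then have "e2ennreal (ereal (g y - g z)) \<le> variation I g"
    unfolding variation_def by (intro e2ennreal_mono) simp
  then have "ennreal (g y - g z) \<le> ennreal v" using assms(1) by (simp add: ennreal_def[symmetric] e2ennreal_ereal)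
  then show ?thesis using assms(2) by simp
qed

text \<open>The breaks are the points where g passes the levels \<alpha> + m V / D. If g rose by
  more than V / D from y to z in C, some level would lie above g(y) and not above g(z); its crossing
  lies between y and z, hence in C by convexity, although it belongs to B.\<close>

lemma level_breaks_mono:
  fixes g :: "real \<Rightarrow> real"
  assumes mono: "mono_on I g" and V: "\<And>y z. y \<in> I \<Longrightarrow> z \<in> I \<Longrightarrow> g y - g z \<le> V" and D: "1 \<le> D"
  obtains B where "finite B" "card B \<le> D"
    "\<And>C y z. convex C \<Longrightarrow> C \<subseteq> I \<Longrightarrow> C \<inter> B = {} \<Longrightarrow> y \<in> C \<Longrightarrow> z \<in> C \<Longrightarrow> \<bar>g y - g z\<bar> \<le> V / real D"
proof -
  define \<alpha> where "\<alpha> = Inf (g ` I)"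
  define U where "U m = {x \<in> I. \<alpha> + real m * V / real D \<le> g x}" for m
  \<comment> \<open>For a level that is never reached, \<open>Inf\<close> of the empty set is some
    unspecified point, which harms neither the count nor the oscillation.\<close>
  define B where "B = (\<lambda>m. Inf (U m)) ` {1..D}"
  have key: "g z - g y \<le> V / real D" if C: "convex C" "C \<subseteq> I" "C \<inter> B = {}" "y \<in> C" "z \<in> C" for C y z
  proof (rule ccontr)
    assume neg: "\<not> g z - g y \<le> V / real D"
    have yz: "y \<in> I" "z \<in> I" using C by auto
    have D0: "real D > 0" using D by simp
    have V0: "0 \<le> V" using V[OF yz(1) yz(1)] by simp
    have "V > 0" using neg V0 D0 V[OF yz(2,1)] by (cases "V = 0") auto
    have bdd: "bdd_below (g ` I)"
    proof (rule bdd_belowI)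
      fix u assume "u \<in> g ` I"
      then show "g y - V \<le> u" using V[OF yz(1)] by force
    qed
    have \<alpha>: "\<alpha> \<le> g w" if "w \<in> I" for w unfolding \<alpha>_def using that bdd by (intro cInf_lower) auto
    have "g z - V \<le> \<alpha>" unfolding \<alpha>_def
      by (rule cInf_greatest) (use yz V[OF yz(2)] in \<open>auto simp: algebra_simps\<close>)
    \<comment> \<open>The highest level not above g(z); a rise of more than V / D forces g(y) below
      it. It is not level 0, since \<alpha> \<le> g(y), and not beyond D, since g(z) \<le> \<alpha>
      + V.\<close>
    define m where "m = nat \<lfloor>(g z - \<alpha>) * real D / V\<rfloor>"
    have q: "0 \<le> (g z - \<alpha>) * real D / V" using \<alpha>[OF yz(2)] D0 \<open>V > 0\<close> by simp
    have m: "real m \<le> (g z - \<alpha>) * real D / V" "(g z - \<alpha>) * real D / V < real m + 1"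
      unfolding m_def using q by linarith+
    have mz: "\<alpha> + real m * V / real D \<le> g z" using m(1) D0 \<open>V > 0\<close> by (simp add: field_simps)
    have "g z < \<alpha> + real m * V / real D + V / real D" using m(2) D0 \<open>V > 0\<close> by (simp add: field_simps)
    then have my: "g y < \<alpha> + real m * V / real D" using neg by simp
    have "m \<noteq> 0"
    proof
      assume "m = 0"
      then show False using my \<alpha>[OF yz(1)] by simp
    qed
    moreover have "m \<le> D"
    proof -
      have "(g z - \<alpha>) * real D / V \<le> real D"
        using \<open>g z - V \<le> \<alpha>\<close> \<open>V > 0\<close> mult_right_mono[of "g z - \<alpha>" V "real D"]
        by (simp add: divide_le_eq mult.commute)
      then show ?thesis using m(1) by linarith
    qed
    ultimately have inB: "Inf (U m) \<in> B" unfolding B_def by auto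
    have low: "y \<le> w" if "w \<in> U m" for w
    proof (rule ccontr)
      assume "\<not> y \<le> w"
      then have "g w \<le> g y" using mono that yz by (auto simp: U_def monotone_on_def)
      then show False using that my by (auto simp: U_def)
    qed
    have zU: "z \<in> U m" using yz mz by (simp add: U_def)
    have "y \<le> Inf (U m)" using zU low by (intro cInf_greatest) auto
    moreover have "Inf (U m) \<le> z" using zU low by (intro cInf_lower) (auto intro!: bdd_belowI)
    ultimately have "Inf (U m) \<in> C" using C convex_realD by blast
    then show False using inB C by auto
  qed
  show ?thesis
  proof
    show "finite B" unfolding B_def by auto
    show "card B \<le> D" unfolding B_def using card_image_le[of "{1..D}" "\<lambda>m. Inf (U m)"] by simp
  qed (use key in \<open>auto simp: abs_if\<close>)
qed

lemma level_breaks: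
  fixes g :: "real \<Rightarrow> real"
  assumes mono: "mono_on I g \<or> antimono_on I g" and V: "\<And>y z. y \<in> I \<Longrightarrow> z \<in> I \<Longrightarrow> g y - g z \<le> V"
    and D: "1 \<le> D"
  obtains B where "finite B" "card B \<le> D"
    "\<And>C y z. convex C \<Longrightarrow> C \<subseteq> I \<Longrightarrow> C \<inter> B = {} \<Longrightarrow> y \<in> C \<Longrightarrow> z \<in> C \<Longrightarrow> \<bar>g y - g z\<bar> \<le> V / real D"
  using mono
proof
  assume "mono_on I g"
  from level_breaks_mono[OF this V D] show ?thesis using that by metis
next
  assume "antimono_on I g"
  then have m: "mono_on I (\<lambda>x. - g x)" by (auto simp: monotone_on_def)
  have V': "- g y - - g z \<le> V" if "y \<in> I" "z \<in> I" for y z using V[OF that(2,1)] by simp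
  obtain B where B: "finite B" "card B \<le> D"
    "\<And>C y z. convex C \<Longrightarrow> C \<subseteq> I \<Longrightarrow> C \<inter> B = {} \<Longrightarrow> y \<in> C \<Longrightarrow> z \<in> C \<Longrightarrow> \<bar>- g y - - g z\<bar> \<le> V / real D"
    using level_breaks_mono[OF m V' D] by metis
  show ?thesis
  proof (rule that[OF B(1,2)])
    show "\<bar>g y - g z\<bar> \<le> V / real D" if "convex C" "C \<subseteq> I" "C \<inter> B = {}" "y \<in> C" "z \<in> C" for C y z
      using B(3)[OF that] by (simp add: abs_minus_commute)
  qed
qed

text \<open>With r^3 = length * V^2 and about D r / R levels, the squared error r^3 / d^2 is at most
  r R^2 / D^2. Both this error and the number of breaks are linear in r, up to rounding, so each can
  be summed over the pieces knowing only that the sum of the r is at most R. This explains the cube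
  root in the functional.\<close>

lemma piece_level_breaks:
  assumes t: "t \<in> prob_densities" and pm: "piecewise_monotone_on_partition k x t" and j: "j < k"
    and fin: "cbrt (emeasure lborel (piece x j) * (variation (piece x j) (\<lambda>y. sqrt (t y)))\<^sup>2) = ennreal r"
    and r: "0 \<le> r" and R: "0 < R" and D: "1 \<le> D"
  obtains B \<delta> where "finite B" "real (card B) \<le> real D * r / R + 1" "0 \<le> \<delta>"
    "\<And>C y z. convex C \<Longrightarrow> C \<subseteq> piece x j \<Longrightarrow> C \<inter> B = {} \<Longrightarrow> y \<in> C \<Longrightarrow> z \<in> C \<Longrightarrow>
       \<bar>sqrt (t y) - sqrt (t z)\<bar> \<le> \<delta>"
    "emeasure lborel (piece x j) = \<infinity> \<Longrightarrow> \<delta> = 0 \<and> (\<forall>y\<in>piece x j. t y = 0)"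
    "measure lborel (piece x j) * \<delta>\<^sup>2 \<le> r * R\<^sup>2 / (real D)\<^sup>2"
proof -
  let ?I = "piece x j" and ?g = "\<lambda>y. sqrt (t y)"
  let ?W = "variation ?I ?g"
  have x: "x \<in> partitions k" using pm by (simp add: piecewise_monotone_on_partition_def)
  have Im[measurable]: "?I \<in> sets borel" by (simp add: open_piece borel_open)
  have prod_fin: "emeasure lborel ?I * ?W\<^sup>2 \<noteq> \<infinity>" using fin by (auto simp: cbrt_def)
  show ?thesis
  proof (cases "emeasure lborel ?I = \<infinity>")
    \<comment> \<open>On a piece of infinite length, finiteness of the product makes the variation
      vanish; then t is constant and, being integrable, zero. No breaks are spent there.\<close>
    case True
    then have "?W\<^sup>2 = 0" using prod_fin by (auto simp: ennreal_top_mult split: if_splits)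
    then have W0: "?W \<le> ennreal 0" by simp
    have const: "t y = t z" if "y \<in> ?I" "z \<in> ?I" for y z
      using variation_bound[OF W0 order_refl open_piece that] variation_bound[OF W0 order_refl open_piece that(2,1)]
      by simp
    have zero: "t y = 0" if y: "y \<in> ?I" for y
    proof (rule ccontr)
      assume "t y \<noteq> 0"
      then have pos: "0 < t y" using prob_densitiesD(2)[OF t, of y] by simp
      have "\<infinity> = ennreal (t y) * emeasure lborel ?I" using True pos by (simp add: ennreal_mult_top)
      also have "\<dots> = (\<integral>\<^sup>+ z. ennreal (t y) * indicator ?I z \<partial>lborel)" by (simp add: nn_integral_cmult_indicator)
      also have "\<dots> \<le> (\<integral>\<^sup>+ z. ennreal (t z) \<partial>lborel)"
        by (rule nn_integral_mono) (use const[OF y] in \<open>auto simp: indicator_def\<close>)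
      also have "\<dots> = 1" using t by (simp add: prob_densities_def)
      finally show False by (simp add: top_unique)
    qed
    show ?thesis
    proof (rule that[of "{}" 0])
      show "\<bar>sqrt (t y) - sqrt (t z)\<bar> \<le> 0" if "convex C" "C \<subseteq> ?I" "C \<inter> {} = {}" "y \<in> C" "z \<in> C" for C y z
        using zero that by (simp add: subset_iff)
    qed (use zero r R in auto)
  next
    case False
    define L where "L = measure lborel ?I"
    have L: "emeasure lborel ?I = ennreal L" unfolding L_def using False by (simp add: emeasure_eq_ennreal_measure)
    have "0 < L" using piece_nonnull(1)[OF x j] unfolding L by simp
    have Wfin: "?W \<noteq> \<infinity>"
    proof
      assume W: "?W = \<infinity>"
      have "ennreal L * \<infinity> = \<infinity>" using \<open>0 < L\<close> by (simp add: ennreal_mult_top)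
      then show False using prod_fin unfolding L W by (simp add: power2_eq_square)
    qed
    define v where "v = enn2real ?W"
    have W: "?W = ennreal v" "0 \<le> v" unfolding v_def using Wfin by (auto simp: ennreal_enn2real_if)
    have osc: "?g y - ?g z \<le> v" if "y \<in> ?I" "z \<in> ?I" for y z
      by (rule variation_bound[OF _ W(2) open_piece that, of ?g]) (simp add: W)
    have "emeasure lborel ?I * ?W\<^sup>2 = ennreal (L * v\<^sup>2)"
      unfolding L W(1) using W(2) \<open>0 < L\<close> by (simp add: ennreal_mult power2_eq_square)
    then have "ennreal r = ennreal (root 3 (L * v\<^sup>2))"
      using fin \<open>0 < L\<close> by (simp add: cbrt_def)
    then have "r = root 3 (L * v\<^sup>2)" using r \<open>0 < L\<close> by (simp add: ennreal_inj)
    then have r3: "r ^ 3 = L * v\<^sup>2" using \<open>0 < L\<close> by simp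
    define d where "d = nat \<lfloor>real D * r / R\<rfloor> + 1"
    have q: "0 \<le> real D * r / R" using r R by simp
    have d: "real d \<le> real D * r / R + 1" "real D * r / R \<le> real d" "1 \<le> d"
      unfolding d_def using q by (auto, linarith+)
    have mono: "mono_on ?I ?g \<or> antimono_on ?I ?g"
    proof -
      have "mono_on ?I t \<or> antimono_on ?I t" using pm j by (simp add: piecewise_monotone_on_partition_def)
      then show ?thesis by (auto simp: monotone_on_def)
    qed
    obtain B where B: "finite B" "card B \<le> d"
      "\<And>C y z. convex C \<Longrightarrow> C \<subseteq> ?I \<Longrightarrow> C \<inter> B = {} \<Longrightarrow> y \<in> C \<Longrightarrow> z \<in> C \<Longrightarrow> \<bar>?g y - ?g z\<bar> \<le> v / real d"
      using level_breaks[OF mono osc d(3)] by metis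
    show ?thesis
    proof (rule that[of B "v / real d"])
      show "real (card B) \<le> real D * r / R + 1" using B(2) d(1) by linarith
      show "measure lborel ?I * (v / real d)\<^sup>2 \<le> r * R\<^sup>2 / (real D)\<^sup>2"
      proof (cases "r = 0")
        case True
        then have "L * v\<^sup>2 = 0" using r3 by simp
        then have "L * (v / real d)\<^sup>2 = 0" by auto
        then show ?thesis using True unfolding L_def[symmetric] by (simp only: mult_zero_left div_0)
      next
        case False
        then have rp: "0 < r" using r by simp
        have "measure lborel ?I * (v / real d)\<^sup>2 = r ^ 3 / (real d)\<^sup>2"
          unfolding L_def[symmetric] r3 by (simp add: power_divide)
        also have "\<dots> \<le> r ^ 3 / (real D * r / R)\<^sup>2"
          using d rp R D by (intro divide_left_mono power_mono) auto
        also have "\<dots> = r * R\<^sup>2 / (real D)\<^sup>2"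
          using rp R D by (simp add: power2_eq_square power3_eq_cube field_simps)
        finally show ?thesis .
      qed
    qed (use B W False in auto)
  qed
qed

text \<open>This covers points w of B as well, since they carry the index of the gap on their right.
  Hence a gap whose index occurs has positive measure and meets every open set containing w.\<close>

lemma open_cell_right_interval:
  assumes "finite B"
  obtains e where "0 < e" "{w<..<w + e} \<subseteq> open_cell B (cell_index B w)"
proof -
  define E where "E = insert 1 ((\<lambda>b. b - w) ` (B \<inter> {w<..}))"
  have E: "finite E" "E \<noteq> {}" "\<forall>e\<in>E. 0 < e" using assms by (auto simp: E_def)
  define e where "e = Min E"
  have "0 < e" unfolding e_def using E by simp
  moreover have "{w<..<w + e} \<subseteq> open_cell B (cell_index B w)"
  proof
    fix z assume z: "z \<in> {w<..<w + e}"
    have "B \<inter> {w<..z} = {}"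
    proof (rule ccontr)
      assume "B \<inter> {w<..z} \<noteq> {}"
      then obtain b where b: "b \<in> B" "w < b" "b \<le> z" by auto
      then have "e \<le> b - w" unfolding e_def using E by (intro Min_le) (auto simp: E_def)
      then show False using b z by auto
    qed
    then show "z \<in> open_cell B (cell_index B w)"
      using cell_index_eq_iff[OF assms, of w z] z by (auto simp: open_cell_def)
  qed
  ultimately show ?thesis using that by blast
qed

section \<open>Approximation by step densities\<close>

text \<open>On a gap of infinite length \<open>measure\<close> is 0 and division by 0 returns 0.
  This is the correct value where the averages are used, because t is assumed to vanish on such
  gaps.\<close>

definition cell_average :: "real set \<Rightarrow> (real \<Rightarrow> real) \<Rightarrow> nat \<Rightarrow> real" where
  "cell_average B t i = (\<integral>y. indicator (open_cell B i) y * t y \<partial>lborel) / measure lborel (open_cell B i)"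

lemma open_cell_nonnull:
  assumes "finite B"
  shows "0 < emeasure lborel (open_cell B (cell_index B w))"
proof -
  obtain e where e: "0 < e" "{w<..<w + e} \<subseteq> open_cell B (cell_index B w)"
    using open_cell_right_interval[OF assms] by metis
  have "0 < emeasure lborel {w<..<w + e}" using e by simp
  also have "\<dots> \<le> emeasure lborel (open_cell B (cell_index B w))"
    by (rule emeasure_mono[OF e(2)]) (simp add: open_cell_sets[OF assms])
  finally show ?thesis .
qed

lemma integrable_indicator_mult_density:
  assumes "t \<in> prob_densities" "A \<in> sets borel"
  shows "integrable lborel (\<lambda>y. indicator A y * t y)"
  using prob_densitiesD(3)[OF assms(1)] assms(2) integrable_mult_indicator[of A lborel t] by simp

lemma cell_average_bounds:
  assumes B: "finite B" and t: "t \<in> prob_densities"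
    and inf: "\<And>i y. emeasure lborel (open_cell B i) = \<infinity> \<Longrightarrow> y \<in> open_cell B i \<Longrightarrow> t y = 0"
  shows "(\<And>y. y \<in> open_cell B (cell_index B w) \<Longrightarrow> t y \<le> hi) \<Longrightarrow> cell_average B t (cell_index B w) \<le> hi"
    "(\<And>y. y \<in> open_cell B (cell_index B w) \<Longrightarrow> lo \<le> t y) \<Longrightarrow> lo \<le> cell_average B t (cell_index B w)"
proof -
  let ?C = "open_cell B (cell_index B w)"
  have Cm[measurable]: "?C \<in> sets borel" by (rule open_cell_sets[OF B])
  have pos: "0 < emeasure lborel ?C" by (rule open_cell_nonnull[OF B])
  then have "?C \<noteq> {}" by (metis emeasure_empty less_irrefl)
  then obtain y0 where y0: "y0 \<in> ?C" by auto
  note ti = integrable_indicator_mult_density[OF t Cm]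
  show "cell_average B t (cell_index B w) \<le> hi" if h: "\<And>y. y \<in> ?C \<Longrightarrow> t y \<le> hi"
  proof (cases "emeasure lborel ?C = \<infinity>")
    case True
    then show ?thesis using h[OF y0] inf[OF True y0] by (simp add: cell_average_def measure_def)
  next
    case False
    then have mp: "0 < measure lborel ?C" using pos
      by (metis emeasure_eq_ennreal_measure ennreal_less_zero_iff infinity_ennreal_def)
    have "(\<integral>y. indicator ?C y * t y \<partial>lborel) \<le> (\<integral>y. indicator ?C y * hi \<partial>lborel)"
    proof (rule integral_mono)
      show "integrable lborel (\<lambda>y. indicator ?C y * hi)" using False by (auto simp: top.not_eq_extremum)
    qed (use ti h in \<open>auto simp: indicator_def\<close>)
    then show ?thesis using mp by (simp add: cell_average_def divide_le_eq mult.commute)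
  qed
  show "lo \<le> cell_average B t (cell_index B w)" if h: "\<And>y. y \<in> ?C \<Longrightarrow> lo \<le> t y"
  proof (cases "emeasure lborel ?C = \<infinity>")
    case True
    then show ?thesis using h[OF y0] inf[OF True y0] by (simp add: cell_average_def measure_def)
  next
    case False
    then have mp: "0 < measure lborel ?C" using pos
      by (metis emeasure_eq_ennreal_measure ennreal_less_zero_iff infinity_ennreal_def)
    have "(\<integral>y. indicator ?C y * lo \<partial>lborel) \<le> (\<integral>y. indicator ?C y * t y \<partial>lborel)"
    proof (rule integral_mono)
      show "integrable lborel (\<lambda>y. indicator ?C y * lo)" using False by (auto simp: top.not_eq_extremum)
    qed (use ti h in \<open>auto simp: indicator_def\<close>)
    then show ?thesis using mp by (simp add: cell_average_def le_divide_eq mult.commute)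
  qed
qed

lemma AE_not_in_finite: "finite B \<Longrightarrow> AE x in lborel. (x::real) \<notin> B"
  by (rule AE_I[of _ _ B]) (auto intro: emeasure_lborel_countable simp: countable_finite borel_closed finite_imp_closed)

lemma sum_open_cells:
  assumes "finite B" "x \<notin> B"
  shows "(\<Sum>i\<le>card B. indicator (open_cell B i) x * f i) = (f (cell_index B x) :: real)"
proof -
  have "(\<Sum>i\<le>card B. indicator (open_cell B i) x * f i) = (\<Sum>i\<le>card B. if i = cell_index B x then f i else 0)"
    using assms by (intro sum.cong) (auto simp: open_cell_def indicator_def)
  also have "\<dots> = f (cell_index B x)" using cell_index_le[OF assms(1), of x] by simp
  finally show ?thesis .
qed

text \<open>Averaging preserves the integral over each gap, and the finite set B is null, so the
  total mass is kept. Infinite and null gaps contribute 0 on both sides.\<close>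

lemma cell_average_density:
  assumes B: "finite B" and t: "t \<in> prob_densities"
    and inf: "\<And>i y. emeasure lborel (open_cell B i) = \<infinity> \<Longrightarrow> y \<in> open_cell B i \<Longrightarrow> t y = 0"
  shows "(\<lambda>x. cell_average B t (cell_index B x)) \<in> prob_densities"
proof -
  let ?h = "cell_average B t" and ?C = "open_cell B"
  let ?u = "\<lambda>x. ?h (cell_index B x)"
  note [measurable] = measurable_cell_index[OF B] open_cell_sets[OF B]
  have um: "?u \<in> borel_measurable borel" by measurable
  have h_i: "integrable lborel (\<lambda>x. indicator (?C i) x * ?h i)"
    and h_int: "(\<integral>x. indicator (?C i) x * ?h i \<partial>lborel) = (\<integral>y. indicator (?C i) y * t y \<partial>lborel)" for i
  proof -
    consider "emeasure lborel (?C i) = \<infinity>" | "emeasure lborel (?C i) \<noteq> \<infinity>" "measure lborel (?C i) = 0"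
      | "emeasure lborel (?C i) \<noteq> \<infinity>" "measure lborel (?C i) \<noteq> 0" by blast
    then have "integrable lborel (\<lambda>x. indicator (?C i) x * ?h i) \<and>
      (\<integral>x. indicator (?C i) x * ?h i \<partial>lborel) = (\<integral>y. indicator (?C i) y * t y \<partial>lborel)"
    proof cases
      case 1
      then have h0: "?h i = 0" by (simp add: cell_average_def measure_def)
      have "indicator (?C i) y * t y = 0" for y using inf[OF 1, of y] by (auto simp: indicator_def)
      then have "(\<lambda>y. indicator (?C i) y * t y) = (\<lambda>y. 0)" by blast
      then show ?thesis by (simp add: h0)
    next
      case 2
      then have "emeasure lborel (?C i) = 0" by (simp add: emeasure_eq_ennreal_measure)
      then have "AE y in lborel. y \<notin> ?C i" by (intro AE_I[of _ _ "?C i"]) auto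
      then have "(\<integral>y. indicator (?C i) y * t y \<partial>lborel) = (\<integral>y. 0 \<partial>lborel)"
        using prob_densitiesD(1)[OF t]
        by (subst integral_cong_AE[where g = "\<lambda>_. 0"]) (auto simp: indicator_def)
      moreover have "?h i = 0" using 2 by (simp add: cell_average_def)
      ultimately show ?thesis by simp
    next
      case 3
      then show ?thesis by (auto simp: cell_average_def top.not_eq_extremum)
    qed
    then show "integrable lborel (\<lambda>x. indicator (?C i) x * ?h i)"
      "(\<integral>x. indicator (?C i) x * ?h i \<partial>lborel) = (\<integral>y. indicator (?C i) y * t y \<partial>lborel)" by auto
  qed
  have AEu: "AE x in lborel. (\<Sum>i\<le>card B. indicator (?C i) x * ?h i) = ?u x"
    using AE_not_in_finite[OF B] by eventually_elim (rule sum_open_cells[OF B])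
  have AEt: "AE x in lborel. (\<Sum>i\<le>card B. indicator (?C i) x * t x) = t x"
    using AE_not_in_finite[OF B] by eventually_elim (rule sum_open_cells[OF B])
  have sum_i: "integrable lborel (\<lambda>x. \<Sum>i\<le>card B. indicator (?C i) x * ?h i)"
    using h_i by (intro Bochner_Integration.integrable_sum) auto
  show ?thesis
  proof (rule prob_densitiesI[OF um])
    show "0 \<le> ?u x" for x
      by (rule cell_average_bounds(2)[OF B t]) (use inf prob_densitiesD(2)[OF t] in auto)
    show "integrable lborel ?u"
      by (rule integrable_cong_AE_imp[OF sum_i]) (use um AEu in auto)
    have "(\<integral>x. ?u x \<partial>lborel) = (\<integral>x. (\<Sum>i\<le>card B. indicator (?C i) x * ?h i) \<partial>lborel)"
    proof (rule integral_cong_AE)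
      show "AE x in lborel. ?u x = (\<Sum>i\<le>card B. indicator (?C i) x * ?h i)"
        using AEu by eventually_elim simp
    qed (use um sum_i in \<open>auto dest: borel_measurable_integrable\<close>)
    also have "\<dots> = (\<Sum>i\<le>card B. \<integral>x. indicator (?C i) x * ?h i \<partial>lborel)"
      by (rule Bochner_Integration.integral_sum) (rule h_i)
    also have "\<dots> = (\<Sum>i\<le>card B. \<integral>x. indicator (?C i) x * t x \<partial>lborel)" by (simp only: h_int)
    also have "\<dots> = (\<integral>x. (\<Sum>i\<le>card B. indicator (?C i) x * t x) \<partial>lborel)"
      by (rule Bochner_Integration.integral_sum[symmetric]) (rule integrable_indicator_mult_density[OF t], simp)
    also have "\<dots> = (\<integral>x. t x \<partial>lborel)"
      by (rule integral_cong_AE[OF _ _ AEt]) (use prob_densitiesD(1)[OF t] in \<open>measurable\<close>)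
    finally show "(\<integral>x. ?u x \<partial>lborel) = 1" by (simp add: prob_densitiesD(4)[OF t])
  qed
qed

lemma M_partition_cbrt:
  assumes "M_partition k t x \<le> ennreal M" "0 \<le> M"
  obtains r where "\<And>j. j < k \<Longrightarrow> cbrt (emeasure lborel (piece x j) * (variation (piece x j) (\<lambda>y. sqrt (t y)))\<^sup>2) = ennreal (r j)"
    "\<And>j. 0 \<le> (r j :: real)" "(\<Sum>j<k. r j) \<le> root 3 M"
proof -
  let ?c = "\<lambda>j. cbrt (emeasure lborel (piece x j) * (variation (piece x j) (\<lambda>y. sqrt (t y)))\<^sup>2)"
  define r where "r j = enn2real (?c j)" for j
  have "(\<Sum>j<k. ?c j) ^ 3 \<noteq> \<infinity>" using assms(1) unfolding M_partition_def
    by (metis ennreal_less_top infinity_ennreal_def leD top.not_eq_extremum)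
  then have "(\<Sum>j<k. ?c j) \<noteq> \<infinity>" by (metis infinity_ennreal_def top_power_ennreal zero_neq_numeral)
  then have fin: "?c j \<noteq> \<infinity>" if "j < k" for j
    using that by auto
  then have c: "?c j = ennreal (r j)" if "j < k" for j using that by (simp add: r_def ennreal_enn2real_if)
  have r0: "0 \<le> r j" for j by (simp add: r_def)
  have "(\<Sum>j<k. ?c j) = ennreal (\<Sum>j<k. r j)" using r0 c by (simp add: sum_ennreal)
  then have "ennreal ((\<Sum>j<k. r j) ^ 3) \<le> ennreal M"
    using assms(1) r0 unfolding M_partition_def by (simp add: ennreal_power sum_nonneg)
  then have "(\<Sum>j<k. r j) ^ 3 \<le> M" using assms(2) by simp
  then have "root 3 ((\<Sum>j<k. r j) ^ 3) \<le> root 3 M" by simp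
  then have "(\<Sum>j<k. r j) \<le> root 3 M" using r0 by (simp add: real_root_power_cancel sum_nonneg)
  then show ?thesis using that c r0 by blast
qed

text \<open>On each piece the breaks are placed where \<open>sqrt t\<close> crosses equispaced levels, and \<open>t\<close> is
  averaged in between; the average stays monotone on the pieces and keeps the total mass.\<close>

lemma step_approximation:
  assumes t: "t \<in> prob_densities" and pm: "piecewise_monotone_on_partition k x t"
    and M: "M_partition k t x \<le> ennreal M" "0 < M" and D: "1 \<le> D"
  obtains B u where "finite B" "card B \<le> D + 2 * k" "u \<in> pm_densities k"
    "\<And>C y z. convex C \<Longrightarrow> C \<inter> B = {} \<Longrightarrow> y \<in> C \<Longrightarrow> z \<in> C \<Longrightarrow> u y = u z"
    "(hellinger t u)\<^sup>2 \<le> M / (real D)\<^sup>2"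
proof -
  have x: "x \<in> partitions k" using pm by (simp add: piecewise_monotone_on_partition_def)
  define R where "R = root 3 M"
  have R: "0 < R" "R ^ 3 = M" using M by (auto simp: R_def)
  obtain r where r: "\<And>j. j < k \<Longrightarrow> cbrt (emeasure lborel (piece x j) * (variation (piece x j) (\<lambda>y. sqrt (t y)))\<^sup>2) = ennreal (r j)"
    "\<And>j. 0 \<le> (r j :: real)" "(\<Sum>j<k. r j) \<le> R"
    using M_partition_cbrt[OF M(1)] M(2) unfolding R_def by auto
  have "\<exists>Bj \<delta>. finite Bj \<and> real (card Bj) \<le> real D * r j / R + 1 \<and> 0 \<le> \<delta> \<and>
    (\<forall>C y z. convex C \<longrightarrow> C \<subseteq> piece x j \<longrightarrow> C \<inter> Bj = {} \<longrightarrow> y \<in> C \<longrightarrow> z \<in> C \<longrightarrow>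
       \<bar>sqrt (t y) - sqrt (t z)\<bar> \<le> \<delta>) \<and>
    (emeasure lborel (piece x j) = \<infinity> \<longrightarrow> \<delta> = 0 \<and> (\<forall>y\<in>piece x j. t y = 0)) \<and>
    measure lborel (piece x j) * \<delta>\<^sup>2 \<le> r j * R\<^sup>2 / (real D)\<^sup>2" if j: "j < k" for j
    by (rule piece_level_breaks[OF t pm j r(1)[OF j] r(2) R(1) D], intro exI conjI) blast+
  then obtain Bj \<delta> where "\<And>j. j < k \<Longrightarrow> finite (Bj j) \<and> real (card (Bj j)) \<le> real D * r j / R + 1 \<and> 0 \<le> \<delta> j \<and>
    (\<forall>C y z. convex C \<longrightarrow> C \<subseteq> piece x j \<longrightarrow> C \<inter> Bj j = {} \<longrightarrow> y \<in> C \<longrightarrow> z \<in> C \<longrightarrow>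
       \<bar>sqrt (t y) - sqrt (t z)\<bar> \<le> \<delta> j) \<and>
    (emeasure lborel (piece x j) = \<infinity> \<longrightarrow> \<delta> j = 0 \<and> (\<forall>y\<in>piece x j. t y = 0)) \<and>
    measure lborel (piece x j) * (\<delta> j)\<^sup>2 \<le> r j * R\<^sup>2 / (real D)\<^sup>2"
    by metis
  then have finBj: "\<And>j. j < k \<Longrightarrow> finite (Bj j)"
    and cardBj: "\<And>j. j < k \<Longrightarrow> real (card (Bj j)) \<le> real D * r j / R + 1"
    and \<delta>0: "\<And>j. j < k \<Longrightarrow> 0 \<le> \<delta> j"
    and osc: "\<And>j C y z. j < k \<Longrightarrow> convex C \<Longrightarrow> C \<subseteq> piece x j \<Longrightarrow> C \<inter> Bj j = {} \<Longrightarrow> y \<in> C \<Longrightarrow> z \<in> C \<Longrightarrow>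
       \<bar>sqrt (t y) - sqrt (t z)\<bar> \<le> \<delta> j"
    and infp: "\<And>j. j < k \<Longrightarrow> emeasure lborel (piece x j) = \<infinity> \<Longrightarrow> \<delta> j = 0 \<and> (\<forall>y\<in>piece x j. t y = 0)"
    and L\<delta>: "\<And>j. j < k \<Longrightarrow> measure lborel (piece x j) * (\<delta> j)\<^sup>2 \<le> r j * R\<^sup>2 / (real D)\<^sup>2"
    by blast+
  define B where "B = breaks k x \<union> (\<Union>j<k. Bj j)"
  have B: "finite B" using breaks_finite_card(1) finBj by (auto simp: B_def)
  have cardB: "card B \<le> D + 2 * k"
  proof -
    \<comment> \<open>At most k partition breaks; summing D r / R + 1 over the pieces adds at most D
      + k level breaks.\<close>
    have "card B \<le> card (breaks k x) + card (\<Union>j<k. Bj j)" unfolding B_def by (rule card_Un_le)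
    also have "card (\<Union>j<k. Bj j) \<le> (\<Sum>j<k. card (Bj j))" by (rule card_UN_le) simp
    finally have 1: "card B \<le> k + (\<Sum>j<k. card (Bj j))" using breaks_finite_card(2)[of k x] by linarith
    have "real (\<Sum>j<k. card (Bj j)) \<le> (\<Sum>j<k. real D * r j / R + 1)"
      unfolding of_nat_sum by (intro sum_mono cardBj) auto
    also have "\<dots> = real D * (\<Sum>j<k. r j) / R + real k"
      by (simp add: sum.distrib sum_distrib_left sum_divide_distrib)
    also have "\<dots> \<le> real D * R / R + real k"
      using r(3) R by (intro add_right_mono divide_right_mono mult_left_mono) auto
    also have "\<dots> = real (D + k)" using R by simp
    finally have "(\<Sum>j<k. card (Bj j)) \<le> D + k" by linarith
    then show ?thesis using 1 by simp
  qed
  have B1: "breaks k x \<subseteq> B" by (auto simp: B_def)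
  have cell_disj: "open_cell B i \<inter> breaks k x = {}" "j < k \<Longrightarrow> open_cell B i \<inter> Bj j = {}" for i j
    using open_cell_disjoint[of B i] by (auto simp: B_def)
  have cell_sub: "open_cell B i \<subseteq> piece x j" if "j < k" "y \<in> open_cell B i" "y \<in> piece x j" for i j y
    by (rule convex_subset_piece[OF x that(1) convex_open_cell[OF B] cell_disj(1) that(2,3)])
  \<comment> \<open>The point w may itself be a level break. As the piece is open, it shares with
    the gap a point slightly to the right of w, and the gap avoids the partition breaks, so it
    cannot leave the piece.\<close>
  have cell_piece: "open_cell B (cell_index B w) \<subseteq> piece x j" if jw: "j < k" "w \<in> piece x j" for w j
  proof -
    obtain e where e: "0 < e" "{w<..<w + e} \<subseteq> open_cell B (cell_index B w)"
      using open_cell_right_interval[OF B] by metis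
    obtain e' where e': "0 < e'" "ball w e' \<subseteq> piece x j" using open_piece jw(2) open_contains_ball by metis
    define z where "z = w + min e e' / 2"
    have "z \<in> open_cell B (cell_index B w)" using e e' by (intro subsetD[OF e(2)]) (auto simp: z_def min_def)
    moreover have "z \<in> piece x j" using e e' by (intro subsetD[OF e'(2)]) (auto simp: z_def dist_real_def min_def)
    ultimately show ?thesis using cell_sub jw by blast
  qed
  have inf: "t y = 0" if "emeasure lborel (open_cell B i) = \<infinity>" "y \<in> open_cell B i" for i y
  proof -
    have "y \<notin> breaks k x" using cell_disj(1) that(2) by auto
    then obtain j where j: "j < k" "y \<in> piece x j" using piece_cover[OF x] by blast
    have "emeasure lborel (open_cell B i) \<le> emeasure lborel (piece x j)"
      using cell_sub[OF j(1) that(2) j(2)] by (intro emeasure_mono) (auto simp: open_piece borel_open)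
    then have "emeasure lborel (piece x j) = \<infinity>" using that(1) by (simp add: top_unique)
    then show ?thesis using infp[OF j(1)] j(2) by blast
  qed
  define u where "u = (\<lambda>x. cell_average B t (cell_index B x))"
  have u: "u \<in> prob_densities" unfolding u_def by (rule cell_average_density[OF B t inf])
  have u_hi: "u w \<le> hi" if "\<And>y. y \<in> open_cell B (cell_index B w) \<Longrightarrow> t y \<le> hi" for w hi
    unfolding u_def by (rule cell_average_bounds(1)[OF B t inf that])
  have u_lo: "lo \<le> u w" if "\<And>y. y \<in> open_cell B (cell_index B w) \<Longrightarrow> lo \<le> t y" for w lo
    unfolding u_def by (rule cell_average_bounds(2)[OF B t inf that])
  have cell_less: "a < b" if "cell_index B y < cell_index B z" "a \<in> open_cell B (cell_index B y)"
    "b \<in> open_cell B (cell_index B z)" for a b y z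
    using that cell_index_mono[OF B, of b a] by (auto simp: open_cell_def not_le[symmetric])
  have u_pm: "piecewise_monotone_on_partition k x u"
    unfolding piecewise_monotone_on_partition_def
  proof (intro conjI allI impI x)
    fix j assume j: "j < k"
    have eq_or_less: "u y = u z \<or> cell_index B y < cell_index B z" if "y \<le> z" for y z
      using cell_index_mono[OF B that] by (auto simp: u_def)
    have "mono_on (piece x j) t \<or> antimono_on (piece x j) t"
      using pm j by (simp add: piecewise_monotone_on_partition_def)
    then show "mono_on (piece x j) u \<or> antimono_on (piece x j) u"
    proof
      assume m: "mono_on (piece x j) t"
      have "u y \<le> u z" if yz: "y \<in> piece x j" "z \<in> piece x j" "y \<le> z" for y z
      proof -
        have "u y \<le> u z" if less: "cell_index B y < cell_index B z"
        proof (rule u_lo, rule u_hi)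
          fix b a assume ab: "b \<in> open_cell B (cell_index B z)" "a \<in> open_cell B (cell_index B y)"
          have "a < b" by (rule cell_less[OF less ab(2,1)])
          moreover have "a \<in> piece x j" "b \<in> piece x j" using cell_piece[OF j] yz ab by blast+
          ultimately show "t a \<le> t b" using m by (auto simp: monotone_on_def)
        qed
        then show ?thesis using eq_or_less[OF yz(3)] by auto
      qed
      then show ?thesis by (auto simp: monotone_on_def)
    next
      assume m: "antimono_on (piece x j) t"
      have "u z \<le> u y" if yz: "y \<in> piece x j" "z \<in> piece x j" "y \<le> z" for y z
      proof -
        have "u z \<le> u y" if less: "cell_index B y < cell_index B z"
        proof (rule u_lo, rule u_hi)
          fix a b assume ab: "b \<in> open_cell B (cell_index B z)" "a \<in> open_cell B (cell_index B y)"
          have "a < b" by (rule cell_less[OF less ab(2,1)])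
          moreover have "a \<in> piece x j" "b \<in> piece x j" using cell_piece[OF j] yz ab by blast+
          ultimately show "t b \<le> t a" using m by (auto simp: monotone_on_def)
        qed
        then show ?thesis using eq_or_less[OF yz(3)] by auto
      qed
      then show ?thesis by (auto simp: monotone_on_def)
    qed
  qed
  have close: "\<bar>sqrt (t w) - sqrt (u w)\<bar> \<le> \<delta> j" if w: "w \<notin> B" and j: "j < k" "w \<in> piece x j" for w j
  proof -
    let ?C = "open_cell B (cell_index B w)"
    have wC: "w \<in> ?C" using w by (simp add: open_cell_def)
    have o: "\<bar>sqrt (t y) - sqrt (t w)\<bar> \<le> \<delta> j" if "y \<in> ?C" for y
      by (rule osc[OF j(1) convex_open_cell[OF B] cell_piece[OF j] cell_disj(2)[OF j(1)] that wC])
    have t0: "0 \<le> t y" for y by (rule prob_densitiesD(2)[OF t])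
    \<comment> \<open>On the gap, sqrt t stays within \<delta> of sqrt t(w), so the average of t
      lies between the squares of the two extremes. In the lower one, the maximum with 0 keeps
      squaring monotone.\<close>
    have "u w \<le> (sqrt (t w) + \<delta> j)\<^sup>2"
    proof (rule u_hi)
      fix y assume "y \<in> ?C"
      then have "sqrt (t y) \<le> sqrt (t w) + \<delta> j" using o[of y] by linarith
      then have "(sqrt (t y))\<^sup>2 \<le> (sqrt (t w) + \<delta> j)\<^sup>2" using t0 by (intro power_mono) auto
      then show "t y \<le> (sqrt (t w) + \<delta> j)\<^sup>2" using t0 by simp
    qed
    then have 1: "sqrt (u w) \<le> sqrt (t w) + \<delta> j" using t0[of w] \<delta>0[OF j(1)] by (intro real_le_lsqrt) auto
    have "(max 0 (sqrt (t w) - \<delta> j))\<^sup>2 \<le> u w"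
    proof (rule u_lo)
      fix y assume "y \<in> ?C"
      then have "max 0 (sqrt (t w) - \<delta> j) \<le> sqrt (t y)" using o[of y] t0[of y] by auto
      then have "(max 0 (sqrt (t w) - \<delta> j))\<^sup>2 \<le> (sqrt (t y))\<^sup>2" by (intro power_mono) auto
      then show "(max 0 (sqrt (t w) - \<delta> j))\<^sup>2 \<le> t y" using t0 by simp
    qed
    then have "max 0 (sqrt (t w) - \<delta> j) \<le> sqrt (u w)" by (rule real_le_rsqrt)
    then show ?thesis using 1 by auto
  qed
  have hell: "(hellinger t u)\<^sup>2 \<le> M / (real D)\<^sup>2"
  proof -
    have pi: "integrable lborel (\<lambda>w. indicator (piece x j) w * (\<delta> j)\<^sup>2)" if "j < k" for j
    proof (cases "emeasure lborel (piece x j) = \<infinity>")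
      case True
      then show ?thesis using infp[OF that] by simp
    next
      case False
      then show ?thesis by (auto simp: top.not_eq_extremum open_piece borel_open)
    qed
    have "(\<integral>w. (sqrt (t w) - sqrt (u w))\<^sup>2 \<partial>lborel) \<le> (\<integral>w. (\<Sum>j<k. indicator (piece x j) w * (\<delta> j)\<^sup>2) \<partial>lborel)"
    proof (rule integral_mono_AE)
      show "integrable lborel (\<lambda>w. (sqrt (t w) - sqrt (u w))\<^sup>2)" by (rule integrable_sqrt_diff_sq[OF t u])
      show "integrable lborel (\<lambda>w. \<Sum>j<k. indicator (piece x j) w * (\<delta> j)\<^sup>2)"
        by (intro Bochner_Integration.integrable_sum pi) auto
      show "AE w in lborel. (sqrt (t w) - sqrt (u w))\<^sup>2 \<le> (\<Sum>j<k. indicator (piece x j) w * (\<delta> j)\<^sup>2)"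
        using AE_not_in_finite[OF B]
      proof eventually_elim
        fix w assume w: "w \<notin> B"
        then obtain j where j: "j < k" "w \<in> piece x j" using piece_cover[OF x] B1 by blast
        have "(sqrt (t w) - sqrt (u w))\<^sup>2 \<le> (\<delta> j)\<^sup>2"
          using close[OF w j] \<delta>0[OF j(1)] by (simp add: abs_le_square_iff[symmetric])
        also have "\<dots> = indicator (piece x j) w * (\<delta> j)\<^sup>2" using j by simp
        also have "\<dots> \<le> (\<Sum>j<k. indicator (piece x j) w * (\<delta> j)\<^sup>2)"
          by (rule member_le_sum[of j "{..<k}" "\<lambda>j. indicator (piece x j) w * (\<delta> j)\<^sup>2"]) (use j in auto)
        finally show "(sqrt (t w) - sqrt (u w))\<^sup>2 \<le> (\<Sum>j<k. indicator (piece x j) w * (\<delta> j)\<^sup>2)" .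
      qed
    qed
    also have "\<dots> = (\<Sum>j<k. \<integral>w. indicator (piece x j) w * (\<delta> j)\<^sup>2 \<partial>lborel)"
      by (rule Bochner_Integration.integral_sum) (use pi in auto)
    also have "\<dots> = (\<Sum>j<k. measure lborel (piece x j) * (\<delta> j)\<^sup>2)" by simp
    also have "\<dots> \<le> (\<Sum>j<k. r j * R\<^sup>2 / (real D)\<^sup>2)" by (intro sum_mono L\<delta>) auto
    also have "\<dots> = (\<Sum>j<k. r j) * R\<^sup>2 / (real D)\<^sup>2" by (simp add: sum_distrib_right sum_divide_distrib)
    also have "\<dots> \<le> R * R\<^sup>2 / (real D)\<^sup>2" using r(3) by (intro divide_right_mono mult_right_mono) auto
    also have "\<dots> = M / (real D)\<^sup>2" unfolding R(2)[symmetric] by (simp add: power2_eq_square power3_eq_cube)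
    finally have "(\<integral>w. (sqrt (t w) - sqrt (u w))\<^sup>2 \<partial>lborel) \<le> M / (real D)\<^sup>2" .
    moreover have "0 \<le> M / (real D)\<^sup>2" using M(2) by simp
    ultimately show ?thesis unfolding hellinger_sq by linarith
  qed
  have const: "u y = u z" if "convex C" "C \<inter> B = {}" "y \<in> C" "z \<in> C" for C y z
  proof -
    have *: "u a = u b" if ab: "a \<in> C" "b \<in> C" "a \<le> b" for a b
    proof -
      have "c \<in> C" if "a < c" "c \<le> b" for c
        using convex_realD[OF \<open>convex C\<close> ab(1,2)] that by simp
      then have "{a<..b} \<subseteq> C" by auto
      then have "B \<inter> {a<..b} = {}" using \<open>C \<inter> B = {}\<close> by blast
      then show ?thesis using cell_index_eq_iff[OF B ab(3)] by (simp add: u_def)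
    qed
    show ?thesis
    proof (cases "y \<le> z")
      case True
      then show ?thesis by (rule *[OF that(3,4)])
    next
      case False
      then show ?thesis by (intro *[OF that(4,3), symmetric]) simp
    qed
  qed
  have "u \<in> pm_densities k" using u u_pm unfolding pm_densities_def by blast
  from that[OF B cardB this _ hell] show ?thesis using const by metis
qed

section \<open>The test statistic\<close>

text \<open>The form sqrt (d / (a + d)) - sqrt (a / (a + d)) is a nondecreasing function of d minus
  a nonincreasing one.\<close>

lemma psi_sqrt_ratio_mono:
  assumes "0 \<le> a" "0 \<le> b" "b \<le> c"
  shows "psi (sqrt_ratio b a) \<le> psi (sqrt_ratio c a)"
proof -
  have *: "psi (sqrt_ratio d a) = sqrt (d / (a + d)) - sqrt (a / (a + d))" if "0 \<le> d" for d
    using that assms(1) by (simp add: psi_sqrt_ratio real_sqrt_divide diff_divide_distrib)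
  have "b / (a + b) \<le> c / (a + c)"
  proof (cases "a + b = 0")
    case False
    then have "0 < a + b" using assms by simp
    moreover have "b * a \<le> c * a" using assms by (intro mult_right_mono)
    ultimately show ?thesis using assms by (simp add: divide_le_eq le_divide_eq field_simps)
  qed (use assms in simp)
  moreover have "a / (a + c) \<le> a / (a + b)"
    using assms by (cases "a = 0") (auto intro!: divide_left_mono mult_pos_pos add_pos_nonneg)
  ultimately show ?thesis using assms by (simp add: * diff_mono)
qed

lemma monotone_off_psi:
  assumes u: "u \<in> prob_densities"
    and const: "\<And>C y z. convex C \<Longrightarrow> C \<inter> B = {} \<Longrightarrow> y \<in> C \<Longrightarrow> z \<in> C \<Longrightarrow> u y = u z"
    and v: "v \<in> prob_densities" "monotone_off B' v"
  shows "monotone_off (B \<union> B') (\<lambda>x. psi (sqrt_ratio (v x) (u x)))"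
  unfolding monotone_off_def
proof (intro allI impI)
  fix C assume C: "convex C" "C \<inter> (B \<union> B') = {}"
  then have dis: "C \<inter> B = {}" "C \<inter> B' = {}" by auto
  have m: "mono_on C v \<or> antimono_on C v" using v C dis by (auto simp: monotone_off_def)
  have le: "psi (sqrt_ratio (v y) (u y)) \<le> psi (sqrt_ratio (v z) (u z))"
    if "y \<in> C" "z \<in> C" "v y \<le> v z" for y z
    using const[OF C(1) dis(1) that(1,2)] psi_sqrt_ratio_mono[OF _ _ that(3), of "u z"]
      prob_densitiesD(2)[OF u] prob_densitiesD(2)[OF v(1)] by simp
  show "mono_on C (\<lambda>x. psi (sqrt_ratio (v x) (u x))) \<or> antimono_on C (\<lambda>x. psi (sqrt_ratio (v x) (u x)))"
    using m le unfolding monotone_on_def by blast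
qed

section \<open>Antisymmetry and boundedness of the statistic\<close>

lemma T_stat_swap:
  assumes "t \<in> prob_densities" "u \<in> prob_densities"
  shows "T_stat n X u t = - T_stat n X t u"
proof -
  have "psi (sqrt_ratio (t x) (u x)) = - psi (sqrt_ratio (u x) (t x))" for x
    by (intro psi_sqrt_ratio_swap prob_densitiesD assms)
  then show ?thesis
    unfolding T_stat_def by (simp add: add.commute[of "u _"] sum_negf algebra_simps)
qed

text \<open>This serves to make the real suprema in \<open>Upsilon\<close> range over bounded
  sets.\<close>

lemma T_stat_le:
  assumes t: "t \<in> prob_densities" and u: "u \<in> prob_densities"
  shows "T_stat n X t u \<le> 2 * real n"
proof -
  let ?r = "\<lambda>y. (t y + u y) / 2"
  have "(hellinger t ?r)\<^sup>2 \<le> 1" by (intro hellinger_sq_le_1 t midpoint_prob_densities u)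
  moreover have "0 \<le> (hellinger u ?r)\<^sup>2" by simp
  ultimately have "(hellinger t ?r)\<^sup>2 - (hellinger u ?r)\<^sup>2 \<le> 1" by linarith
  then have 1: "real n / 2 * ((hellinger t ?r)\<^sup>2 - (hellinger u ?r)\<^sup>2) \<le> real n / 2 * 1"
    by (intro mult_left_mono) auto
  have "(\<Sum>i<n. psi (sqrt_ratio (u (X i)) (t (X i)))) \<le> (\<Sum>i<n. 1)"
  proof (rule sum_mono)
    fix i
    show "psi (sqrt_ratio (u (X i)) (t (X i))) \<le> 1"
      using abs_psi_sqrt_ratio_le[of "t (X i)" "u (X i)"] prob_densitiesD(2)[OF t] prob_densitiesD(2)[OF u]
      by (simp add: abs_le_iff)
  qed
  then have "1 / sqrt 2 * (\<Sum>i<n. psi (sqrt_ratio (u (X i)) (t (X i)))) \<le> 1 / sqrt 2 * real n"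
    by (intro mult_left_mono) auto
  also have "\<dots> \<le> 1 * real n" by (intro mult_right_mono) auto
  finally show ?thesis using 1 unfolding T_stat_def by simp
qed

text \<open>By antisymmetry - T(p, t) = T(t, p), which is at most \<open>Upsilon\<close> at t, hence
  at most \<open>Upsilon\<close> at p plus c, hence at most A + c. Together with T(p, t) \<le> A - d
  t this bounds d t. The infimum is over a set bounded below because T(v, v) = 0 makes
  \<open>Upsilon\<close> nonnegative on S.\<close>

lemma near_minimizer_bound:
  assumes S: "S \<subseteq> prob_densities" and p: "p \<in> S" and t: "t \<in> S"
    and T: "\<And>t'. t' \<in> S \<Longrightarrow> T_stat n X p t' \<le> A - d t'" and d: "\<And>t'. 0 \<le> (d t' :: real)"
    and min: "Upsilon n X S t \<le> (INF t'\<in>S. Upsilon n X S t') + c"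
  shows "d t \<le> 2 * A + c"
proof -
  have bdd: "bdd_above ((\<lambda>t'. T_stat n X v t') ` S)" if "v \<in> S" for v
    using S that by (intro bdd_aboveI[of _ "2 * real n"]) (auto intro!: T_stat_le)
  have U_ge: "T_stat n X v w \<le> Upsilon n X S v" if "v \<in> S" "w \<in> S" for v w
    unfolding Upsilon_def using that bdd by (intro cSUP_upper)
  have U0: "0 \<le> Upsilon n X S v" if "v \<in> S" for v
  proof -
    have "T_stat n X v v = 0" using T_stat_swap[of v v n X] S that by auto
    then show ?thesis using U_ge[OF that that] by simp
  qed
  have "- T_stat n X p t = T_stat n X t p" using T_stat_swap[of p t n X] subsetD[OF S p] subsetD[OF S t] by simp
  also have "\<dots> \<le> Upsilon n X S t" by (rule U_ge[OF t p])
  also have "\<dots> \<le> (INF t'\<in>S. Upsilon n X S t') + c" by (rule min)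
  also have "(INF t'\<in>S. Upsilon n X S t') \<le> Upsilon n X S p"
    by (rule cINF_lower[OF _ p]) (auto intro!: bdd_belowI[of _ 0] U0)
  also have "Upsilon n X S p \<le> A"
    unfolding Upsilon_def
  proof (rule cSUP_least)
    fix t' assume "t' \<in> S"
    then show "T_stat n X p t' \<le> A" using T[of t'] d[of t'] by linarith
  qed (use p in auto)
  finally show ?thesis using T[OF t] by linarith
qed

lemma sample_sum_expectation:
  fixes f :: "real \<Rightarrow> real"
  assumes s: "s \<in> prob_densities" and f: "f \<in> borel_measurable borel" "\<And>x. \<bar>f x\<bar> \<le> K"
  shows "integrable (sample_law n s) (\<lambda>X. \<Sum>i<n. f (X i))"
    "(\<integral>X. (\<Sum>i<n. f (X i)) \<partial>sample_law n s) = real n * (\<integral>x. f x \<partial>law s)"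
proof -
  interpret M: prob_space "law s" by (rule prob_space_law[OF s])
  have fi: "integrable (law s) f" by (rule integrable_law[OF s f])
  have distr: "distr (sample_law n s) (law s) (\<lambda>X. X i) = law s" if "i < n" for i
    using that by (intro distr_PiM_component prob_space_law s) auto
  have meas: "(\<lambda>X. X i) \<in> sample_law n s \<rightarrow>\<^sub>M law s" if "i < n" for i
    using that by (intro measurable_component_singleton) auto
  have i: "integrable (sample_law n s) (\<lambda>X. f (X i))" if "i < n" for i
    using integrable_distr[OF meas[OF that], of f] fi by (simp add: distr[OF that])
  have e: "(\<integral>X. f (X i) \<partial>sample_law n s) = (\<integral>x. f x \<partial>law s)" if "i < n" for i
    using integral_distr[OF meas[OF that], of f] fi by (simp add: distr[OF that])
  show "integrable (sample_law n s) (\<lambda>X. \<Sum>i<n. f (X i))"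
    by (intro Bochner_Integration.integrable_sum i) auto
  show "(\<integral>X. (\<Sum>i<n. f (X i)) \<partial>sample_law n s) = real n * (\<integral>x. f x \<partial>law s)"
    by (subst Bochner_Integration.integral_sum) (auto simp: i e)
qed

lemma one_le_ln: "3 \<le> n \<Longrightarrow> 1 \<le> ln (real n)"
  using exp_le by (subst ln_ge_iff) auto

text \<open>The countable set \<open>S\<close> need not contain the step density \<open>u\<close>; an element \<open>p\<close> of \<open>S\<close> close to
  \<open>u\<close> replaces it in the test, while the deviations are still controlled through \<open>u\<close>.\<close>

lemma T_stat_step_bound:
  assumes n: "3 \<le> n" and s: "s \<in> prob_densities" and p: "p \<in> prob_densities"
    and u: "u \<in> prob_densities" and B: "finite B"
    and const: "\<And>C y z. convex C \<Longrightarrow> C \<inter> B = {} \<Longrightarrow> y \<in> C \<Longrightarrow> z \<in> C \<Longrightarrow> u y = u z"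
    and v: "v \<in> pm_densities k" and k: "1 \<le> k" and \<phi>: "0 \<le> \<phi>"
    and dev: "\<And>I m. convex I \<Longrightarrow> I \<in> sets borel \<Longrightarrow> 1 \<le> m \<Longrightarrow> m \<le> n \<Longrightarrow>
      \<bar>count_in n I X - real n * measure (law s) I\<bar>
        \<le> real m / 48 * measure (law s) I + 48 * real n / real m * \<phi> + 4"
  shows "T_stat n X p v \<le> real n * (7 / 4 * (hellinger s p)\<^sup>2 + 1 / 8 * (hellinger s u)\<^sup>2)
    + 4 * real (card B + k) * (48 * (1 + ln (real n)) * \<phi> + 4) + 4
    + (\<Sum>i<n. base_change (p (X i)) (u (X i)))
    + real n * (\<integral>x. base_change (p x) (u x) \<partial>law s)
    - real n / 8 * (hellinger s v)\<^sup>2"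
proof -
  interpret prob_space "law s" by (rule prob_space_law[OF s])
  note D = prob_densitiesD
  obtain x where x: "piecewise_monotone_on_partition k x v" and vd: "v \<in> prob_densities"
    using v by (auto simp: pm_densities_def)
  define f where "f w x = psi (sqrt_ratio (v x) (w x))" for w :: "real \<Rightarrow> real" and x
  define \<delta> where "\<delta> x = base_change (p x) (u x)" for x
  have fm: "f w \<in> borel_measurable borel" if "w \<in> prob_densities" for w
    unfolding f_def by (rule measurable_psi_sqrt_ratio[OF that vd])
  have f1: "\<bar>f w x\<bar> \<le> 1" if "w \<in> prob_densities" for w x
    unfolding f_def by (intro abs_psi_sqrt_ratio_le D that vd)
  have fi: "integrable (law s) (f w)" if "w \<in> prob_densities" for w
    by (rule integrable_law[OF s fm[OF that] f1[OF that]])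
  have \<delta>b: "\<bar>\<delta> x\<bar> \<le> 2" for x unfolding \<delta>_def using base_change_bounds[OF D(2)[OF u]] by simp
  have \<delta>i: "integrable (law s) \<delta>"
    by (rule integrable_law[OF s _ \<delta>b]) (simp add: \<delta>_def measurable_base_change[OF p u])
  have f\<delta>: "\<bar>f p x - f u x\<bar> \<le> \<delta> x" for x
    unfolding f_def \<delta>_def by (intro psi_base_change D p u vd)
  let ?B = "B \<union> breaks k x"
  have finB: "finite ?B" using B breaks_finite_card(1) by auto
  have mono: "monotone_off ?B (f u)"
    unfolding f_def by (rule monotone_off_psi[OF u const vd monotone_off_breaks[OF x]])
  have "card ?B \<le> card B + card (breaks k x)" by (rule card_Un_le)
  \<comment> \<open>A partition into k pieces has at most k - 1 inner breaks, which leaves room for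
    the additional 1.\<close>
  then have "card ?B + 1 \<le> card B + k" using breaks_finite_card(2)[of k x] k by linarith
  then have "real (card ?B) + 1 \<le> real (card B + k)" by linarith
  then have cB: "2 * (2 * real (card ?B) + 1) \<le> 4 * real (card B + k)" by argo
  let ?e = "48 * (1 + ln (real n)) * \<phi> + 4"
  have e0: "0 \<le> ?e" using \<phi> one_le_ln[OF n] by auto
  have "(\<Sum>i<n. f u (X i)) - real n * (\<integral>x. f u x \<partial>law s) \<le>
    real n / 48 * (\<integral>x. (f u x)\<^sup>2 \<partial>law s) + 2 * (2 * real (card ?B) + 1) * ?e + 4"
    using deviation_monotone_off[OF s n finB fm[OF u] f1[OF u] mono \<phi> dev] by linarith
  also have "(\<integral>x. (f u x)\<^sup>2 \<partial>law s) = (\<integral>x. s x * (f u x)\<^sup>2 \<partial>lborel)"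
    using fm[OF u] by (intro integral_law s) simp
  also have "\<dots> \<le> 6 * ((hellinger s u)\<^sup>2 + (hellinger s v)\<^sup>2)"
    unfolding f_def by (rule expected_psi_sq_le[OF s u vd])
  also have "2 * (2 * real (card ?B) + 1) * ?e \<le> 4 * real (card B + k) * ?e"
    using cB e0 by (rule mult_right_mono)
  finally have "(\<Sum>i<n. f u (X i)) - real n * (\<integral>x. f u x \<partial>law s) \<le>
    real n / 48 * (6 * ((hellinger s u)\<^sup>2 + (hellinger s v)\<^sup>2)) + 4 * real (card B + k) * ?e + 4"
    by (simp add: mult_left_mono)
  \<comment> \<open>The precision 48 is chosen here: 6 / 48 = 1 / 8 is half of the coefficient 1 / 4
    of the negative term in the mean, and the other half survives in the conclusion.\<close>
  moreover have "real n / 48 * (6 * ((hellinger s u)\<^sup>2 + (hellinger s v)\<^sup>2)) =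
    real n / 8 * ((hellinger s u)\<^sup>2 + (hellinger s v)\<^sup>2)" by simp
  ultimately have u_dev: "(\<Sum>i<n. f u (X i)) - real n * (\<integral>x. f u x \<partial>law s) \<le>
    real n / 8 * ((hellinger s u)\<^sup>2 + (hellinger s v)\<^sup>2) + 4 * real (card B + k) * ?e + 4"
    by linarith
  have sum_le: "(\<Sum>i<n. f p (X i)) \<le> (\<Sum>i<n. f u (X i)) + (\<Sum>i<n. \<delta> (X i))"
  proof -
    have "(\<Sum>i<n. f p (X i)) \<le> (\<Sum>i<n. f u (X i) + \<delta> (X i))"
    proof (rule sum_mono)
      fix i show "f p (X i) \<le> f u (X i) + \<delta> (X i)" using f\<delta>[of "X i"] by linarith
    qed
    then show ?thesis by (simp add: sum.distrib)
  qed
  have int_le: "(\<integral>x. f u x \<partial>law s) \<le> (\<integral>x. f p x \<partial>law s) + (\<integral>x. \<delta> x \<partial>law s)"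
  proof -
    have "(\<integral>x. f u x \<partial>law s) \<le> (\<integral>x. f p x + \<delta> x \<partial>law s)"
    proof (rule integral_mono)
      fix x show "f u x \<le> f p x + \<delta> x" using f\<delta>[of x] by linarith
    qed (use fi[OF p] fi[OF u] \<delta>i in auto)
    then show ?thesis using fi[OF p] \<delta>i by simp
  qed
  define Q where "Q = real n / 8 * ((hellinger s u)\<^sup>2 + (hellinger s v)\<^sup>2) + 4 * real (card B + k) * ?e + 4
    + (\<Sum>i<n. \<delta> (X i)) + real n * (\<integral>x. \<delta> x \<partial>law s)"
  have \<delta>0: "0 \<le> \<delta> x" for x unfolding \<delta>_def by (rule base_change_bounds(1)[OF D(2)[OF u]])
  \<comment> \<open>Nonnegativity permits enlarging the factor 1 / sqrt 2 to 1 further down.\<close>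
  have Q0: "0 \<le> Q"
  proof -
    have "0 \<le> 4 * real (card B + k) * ?e" using e0 by (intro mult_nonneg_nonneg) auto
    moreover have "0 \<le> (\<Sum>i<n. \<delta> (X i))" "0 \<le> real n * (\<integral>x. \<delta> x \<partial>law s)"
      using \<delta>0 by (auto intro!: sum_nonneg Bochner_Integration.integral_nonneg mult_nonneg_nonneg)
    moreover have "0 \<le> real n / 8 * ((hellinger s u)\<^sup>2 + (hellinger s v)\<^sup>2)" by simp
    ultimately show ?thesis unfolding Q_def by linarith
  qed
  have p_dev: "(\<Sum>i<n. f p (X i)) - real n * (\<integral>x. f p x \<partial>law s) \<le> Q"
  proof -
    have "real n * (\<integral>x. f u x \<partial>law s) \<le> real n * (\<integral>x. f p x \<partial>law s) + real n * (\<integral>x. \<delta> x \<partial>law s)"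
      using mult_left_mono[OF int_le, of "real n"] by (simp add: distrib_left)
    then show ?thesis using u_dev sum_le unfolding Q_def by linarith
  qed
  have "1 / sqrt 2 * ((\<Sum>i<n. f p (X i)) - real n * (\<integral>x. f p x \<partial>law s)) \<le> 1 / sqrt 2 * Q"
    using p_dev by (rule mult_left_mono) simp
  also have "\<dots> \<le> 1 * Q" using Q0 by (intro mult_right_mono) auto
  finally have *: "1 / sqrt 2 * ((\<Sum>i<n. f p (X i)) - real n * (\<integral>x. f p x \<partial>law s)) \<le> Q" by simp
  let ?r = "\<lambda>y. (p y + v y) / 2"
  have "1 / 2 * ((hellinger p ?r)\<^sup>2 - (hellinger v ?r)\<^sup>2) + 1 / sqrt 2 * (\<integral>x. f p x \<partial>law s)
    \<le> 7 / 4 * (hellinger s p)\<^sup>2 - 1 / 4 * (hellinger s v)\<^sup>2"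
    using expected_T_stat_le[OF s p vd] integral_law[OF s fm[OF p]] by (simp add: f_def)
  from mult_left_mono[OF this, of "real n"]
  have "real n / 2 * ((hellinger p ?r)\<^sup>2 - (hellinger v ?r)\<^sup>2) + 1 / sqrt 2 * (real n * (\<integral>x. f p x \<partial>law s))
    \<le> real n * (7 / 4 * (hellinger s p)\<^sup>2 - 1 / 4 * (hellinger s v)\<^sup>2)"
    by (simp add: algebra_simps)
  then have "T_stat n X p v \<le> real n * (7 / 4 * (hellinger s p)\<^sup>2 - 1 / 4 * (hellinger s v)\<^sup>2) + Q"
    using * unfolding T_stat_def f_def[symmetric] by (simp add: right_diff_distrib)
  then show ?thesis unfolding Q_def \<delta>_def by (simp add: algebra_simps)
qed

section \<open>Risk of the estimator\<close>

lemma risk_step_bound: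
  assumes n: "3 \<le> n" and k: "1 \<le> k" and est: "rho_estimator n (pm_densities k) shat"
    and s: "s \<in> prob_densities" and u: "u \<in> pm_densities k" and B: "finite B"
    and const: "\<And>C y z. convex C \<Longrightarrow> C \<inter> B = {} \<Longrightarrow> y \<in> C \<Longrightarrow> z \<in> C \<Longrightarrow> u y = u z"
  shows "risk n s shat \<le> 640 * (hellinger s u)\<^sup>2 + 70000 * real (card B + k) * (ln (real n))\<^sup>2 / real n"
proof -
  interpret prob_space "sample_law n s" by (rule prob_space_sample_law[OF s])
  have n0: "0 < real n" using n by simp
  have ud: "u \<in> prob_densities" using u by (simp add: pm_densities_def)
  obtain S where S: "S \<subseteq> pm_densities k" "pm_densities k \<subseteq> hellinger_closure S"
    and shat: "\<And>X. X \<in> space (\<Pi>\<^sub>M i\<in>{..<n}. (borel :: real measure)) \<Longrightarrow> shat X \<in> hellinger_closure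
      {t \<in> S. Upsilon n X S t \<le> (INF t'\<in>S. Upsilon n X S t') + 357 / 10}"
    using est unfolding rho_estimator_def by blast
  have Sd: "S \<subseteq> prob_densities" using S(1) by (auto simp: pm_densities_def)
  \<comment> \<open>At precision 1 / n, both n h^2(u, p) and the part 6 n e of the base-change
    bound, with e = 1 / n, are bounded by constants.\<close>
  obtain p where p: "p \<in> S" "hellinger u p < 1 / real n"
    using subsetD[OF S(2) u] n0 unfolding hellinger_closure_def by (auto elim!: allE[of _ "1 / real n"])
  have pd: "p \<in> prob_densities" using p Sd by auto
  have small: "(hellinger v w)\<^sup>2 \<le> 1 / real n" if "hellinger v w < 1 / real n" for v w
  proof -
    have "(hellinger v w)\<^sup>2 \<le> (1 / real n)\<^sup>2" using that hellinger_nonneg[of v w] by (intro power_mono) auto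
    also have "\<dots> \<le> (1 / real n) * 1" unfolding power2_eq_square using n by (intro mult_left_mono) auto
    finally show ?thesis by simp
  qed
  obtain \<Phi> where \<Phi>: "integrable (sample_law n s) \<Phi>" "(\<integral>X. \<Phi> X \<partial>sample_law n s) \<le> 5 * ln (real n)"
    "\<And>X. 0 \<le> \<Phi> X"
    and dev: "\<And>X I m. convex I \<Longrightarrow> I \<in> sets borel \<Longrightarrow> 1 \<le> m \<Longrightarrow> m \<le> n \<Longrightarrow>
      \<bar>count_in n I X - real n * measure (law s) I\<bar>
        \<le> real m / 48 * measure (law s) I + 48 * real n / real m * \<Phi> X + 4"
    using uniform_interval_deviation[OF s n] by metis
  define \<delta> where "\<delta> x = base_change (p x) (u x)" for x
  have \<delta>m: "\<delta> \<in> borel_measurable borel" unfolding \<delta>_def by (rule measurable_base_change[OF pd ud])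
  have \<delta>b: "\<bar>\<delta> x\<bar> \<le> 2" for x
    unfolding \<delta>_def using base_change_bounds[OF prob_densitiesD(2)[OF ud]] by simp
  note \<delta>sum = sample_sum_expectation[OF s \<delta>m \<delta>b, of n]
  define e\<delta> where "e\<delta> = (\<integral>x. \<delta> x \<partial>law s)"
  have e\<delta>: "real n * e\<delta> \<le> 8 * real n * (hellinger s u)\<^sup>2 + 6"
  proof -
    have "e\<delta> = (\<integral>x. s x * \<delta> x \<partial>lborel)" unfolding e\<delta>_def by (rule integral_law[OF s \<delta>m])
    also have "\<dots> \<le> 8 * (hellinger s u)\<^sup>2 + 6 * (1 / real n)"
      unfolding \<delta>_def using p(2) n0
      by (intro expected_base_change_le s pd ud) (auto simp: hellinger_commute[of p u])
    finally have "real n * e\<delta> \<le> real n * (8 * (hellinger s u)\<^sup>2 + 6 * (1 / real n))"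
      by (rule mult_left_mono) simp
    then show ?thesis using n0 by (simp add: algebra_simps)
  qed
  define c where "c = real (card B + k)"
  have c1: "1 \<le> c" using k by (simp add: c_def)
  define L where "L = ln (real n)"
  have L: "1 \<le> L" unfolding L_def by (rule one_le_ln[OF n])
  define H where "H = (hellinger s u)\<^sup>2"
  have H0: "0 \<le> H" by (simp add: H_def)
  define A where "A X = 4 * real n * H + 4 + 4 * c * (48 * (1 + L) * \<Phi> X + 4) + 4
    + (\<Sum>i<n. \<delta> (X i)) + real n * e\<delta>" for X
  have sp: "(hellinger s p)\<^sup>2 \<le> 2 * H + 2 / real n"
    using hellinger_sq_triangle[OF s ud pd] small[OF p(2)] by (simp add: H_def)
  have T: "T_stat n X p t' \<le> A X - real n / 8 * (hellinger s t')\<^sup>2" if "t' \<in> S" for X t'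
  proof -
    have "T_stat n X p t' \<le> real n * (7 / 4 * (hellinger s p)\<^sup>2 + 1 / 8 * H)
      + 4 * c * (48 * (1 + L) * \<Phi> X + 4) + 4 + (\<Sum>i<n. \<delta> (X i)) + real n * e\<delta>
      - real n / 8 * (hellinger s t')\<^sup>2"
      unfolding c_def L_def \<delta>_def e\<delta>_def H_def
      by (rule T_stat_step_bound[OF n s pd ud B const _ k \<Phi>(3) dev]) (use that S(1) in auto)
    moreover have "real n * (7 / 4 * (hellinger s p)\<^sup>2 + 1 / 8 * H) \<le> real n * (4 * H + 4 / real n)"
    proof (rule mult_left_mono)
      have "0 \<le> 1 / real n" by simp
      moreover have "2 / real n = 2 * (1 / real n)" "4 / real n = 4 * (1 / real n)" by simp_all
      ultimately show "7 / 4 * (hellinger s p)\<^sup>2 + 1 / 8 * H \<le> 4 * H + 4 / real n"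
        using sp H0 by linarith
    qed simp
    moreover have "real n * (4 * H + 4 / real n) = 4 * real n * H + 4" using n0 by (simp add: field_simps)
    ultimately show ?thesis unfolding A_def by linarith
  qed
  \<comment> \<open>The selected t contributes 2 * 8 * (2 A + 35.7) = 32 A + 571.2, and its distance
    to the estimator 2 more.\<close>
  have loss: "(hellinger s (shat X))\<^sup>2 \<le> (32 * A X + 574) / real n" if X: "X \<in> space (sample_law n s)" for X
  proof -
    have "X \<in> space (\<Pi>\<^sub>M i\<in>{..<n}. (borel :: real measure))" using X by (simp add: space_PiM)
    from shat[OF this] obtain t where sX: "shat X \<in> prob_densities" and t: "t \<in> S"
      "Upsilon n X S t \<le> (INF t'\<in>S. Upsilon n X S t') + 357 / 10" "hellinger (shat X) t < 1 / real n"
      using n0 unfolding hellinger_closure_def by (auto elim!: allE[of _ "1 / real n"])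
    have "real n / 8 * (hellinger s t)\<^sup>2 \<le> 2 * A X + 357 / 10"
      by (rule near_minimizer_bound[OF Sd p(1) t(1) T _ t(2)]) auto
    moreover have "(hellinger s (shat X))\<^sup>2 \<le> 2 * (hellinger s t)\<^sup>2 + 2 * (1 / real n)"
      using hellinger_sq_triangle[OF s subsetD[OF Sd t(1)] sX] small[OF t(3)]
      by (simp add: hellinger_commute[of t "shat X"])
    then have "real n * (hellinger s (shat X))\<^sup>2 \<le> real n * (2 * (hellinger s t)\<^sup>2 + 2 * (1 / real n))"
      by (rule mult_left_mono) simp
    then have "real n * (hellinger s (shat X))\<^sup>2 \<le> 2 * (real n * (hellinger s t)\<^sup>2) + 2"
      using n0 by (simp add: algebra_simps)
    ultimately have "real n * (hellinger s (shat X))\<^sup>2 \<le> 32 * A X + 574" by linarith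
    then show ?thesis using n0 by (simp add: le_divide_eq mult.commute)
  qed
  have Ai: "integrable (sample_law n s) A" unfolding A_def using \<Phi>(1) \<delta>sum(1) by auto
  have EA: "(\<integral>X. A X \<partial>sample_law n s) = 4 * real n * H + 4
    + 4 * c * (48 * (1 + L) * (\<integral>X. \<Phi> X \<partial>sample_law n s) + 4) + 4 + real n * e\<delta> + real n * e\<delta>"
    unfolding A_def using \<Phi>(1) \<delta>sum by (simp add: prob_space e\<delta>_def)
  \<comment> \<open>In the abbreviations of the proof, d \<le> 8 h + 6 gives 32 (4 + 16) = 640 for
    h. For a, 48 * 10 + 4 = 484 and 32 * 4 * 484 = 61952; the constants 32 * 20 + 574 = 1214 fit
    below 70000 because a \<ge> 1.\<close>
  have bound: "32 * (\<integral>X. A X \<partial>sample_law n s) + 574 \<le> 640 * real n * H + 70000 * c * L\<^sup>2"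
  proof -
    have "(1 + L) * (\<integral>X. \<Phi> X \<partial>sample_law n s) \<le> (2 * L) * (5 * L)"
      using L \<Phi>(2,3) unfolding L_def[symmetric] by (intro mult_mono Bochner_Integration.integral_nonneg) auto
    then have "48 * ((1 + L) * (\<integral>X. \<Phi> X \<partial>sample_law n s)) \<le> 480 * L\<^sup>2" by (simp add: power2_eq_square)
    then have "48 * (1 + L) * (\<integral>X. \<Phi> X \<partial>sample_law n s) \<le> 480 * L\<^sup>2" by (simp only: mult.assoc)
    moreover have L2: "1 \<le> L\<^sup>2" using L by simp
    ultimately have "48 * (1 + L) * (\<integral>X. \<Phi> X \<partial>sample_law n s) + 4 \<le> 484 * L\<^sup>2" by linarith
    from mult_left_mono[OF this, of "4 * c"]
    have 1: "4 * c * (48 * (1 + L) * (\<integral>X. \<Phi> X \<partial>sample_law n s) + 4) \<le> 1936 * (c * L\<^sup>2)" using c1 by simp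
    have "1 * 1 \<le> c * L\<^sup>2" using c1 L2 by (intro mult_mono) auto
    moreover have "real n * e\<delta> \<le> 8 * (real n * H) + 6" using e\<delta> by (simp add: H_def mult.assoc)
    moreover define h d a W where "h = real n * H" and "d = real n * e\<delta>" and "a = c * L\<^sup>2"
      and "W = 4 * c * (48 * (1 + L) * (\<integral>X. \<Phi> X \<partial>sample_law n s) + 4)"
    moreover have "(\<integral>X. A X \<partial>sample_law n s) = 4 * h + 4 + W + 4 + d + d"
      unfolding EA h_def d_def W_def by simp
    moreover have "640 * real n * H + 70000 * c * L\<^sup>2 = 640 * h + 70000 * a"
      unfolding h_def a_def by simp
    ultimately show ?thesis using 1 by linarith
  qed
  have "risk n s shat \<le> (\<integral>X. (32 * A X + 574) / real n \<partial>sample_law n s)"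
    unfolding risk_def
  proof (rule integral_mono_AE')
    show "integrable (sample_law n s) (\<lambda>X. (32 * A X + 574) / real n)" using Ai by auto
    show "AE X in sample_law n s. (hellinger s (shat X))\<^sup>2 \<le> (32 * A X + 574) / real n"
      by (rule AE_I2) (rule loss)
    show "AE X in sample_law n s. 0 \<le> (32 * A X + 574) / real n"
      by (rule AE_I2) (rule order_trans[OF zero_le_power2 loss])
  qed
  also have "\<dots> = (32 * (\<integral>X. A X \<partial>sample_law n s) + 574) / real n" using Ai by (simp add: prob_space)
  also have "\<dots> \<le> (640 * real n * H + 70000 * c * L\<^sup>2) / real n"
    by (rule divide_right_mono[OF bound]) simp
  also have "\<dots> = 640 * H + 70000 * c * L\<^sup>2 / real n" using n0 by (simp add: add_divide_distrib)
  finally show ?thesis unfolding H_def c_def L_def .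
qed

lemma risk_bound:
  assumes n: "3 \<le> n" and k: "1 \<le> k" and est: "rho_estimator n (pm_densities (k + 2)) shat"
    and s: "s \<in> prob_densities" and M: "0 < M" and t: "t \<in> pm_densities_le (k + 2) M"
  shows "risk n s shat \<le> 10 ^ 6 * ((hellinger s t)\<^sup>2 +
    (ln (real n))\<^sup>2 * max ((M / (real n)\<^sup>2) powr (1 / 3)) (real k / real n * ln (real n)))"
proof -
  have n0: "0 < real n" using n by simp
  have td: "t \<in> prob_densities" using t by (simp add: pm_densities_le_def pm_densities_def)
  have "M_functional (k + 2) t \<le> ennreal M" using t by (simp add: pm_densities_le_def)
  \<comment> \<open>The functional is an infimum that need not be attained; the factor 2 buys an
    actual partition.\<close>
  also have "\<dots> < ennreal (2 * M)" using M by (simp add: ennreal_less_iff)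
  finally obtain x where x: "piecewise_monotone_on_partition (k + 2) x t" "M_partition (k + 2) t x < ennreal (2 * M)"
    unfolding M_functional_def by (auto simp: INF_less_iff)
  define L where "L = ln (real n)"
  have L: "1 \<le> L" unfolding L_def by (rule one_le_ln[OF n])
  define Q where "Q = (M / (real n)\<^sup>2) powr (1 / 3)"
  have Q: "0 < Q" using M n0 by (simp add: Q_def)
  have Q3: "Q ^ 3 = M / (real n)\<^sup>2"
    unfolding Q_def using M n0 by (simp add: powr_powr flip: powr_numeral)
  \<comment> \<open>This is (M n)^(1/3) / log n. It gives M / D^2 \<le> Q L^2, the order allowed by
    the claim, while D L^2 / n is at most Q L plus L^2 / n from rounding up.\<close>
  define D where "D = nat \<lceil>real n * Q / L\<rceil>"
  have q: "0 < real n * Q / L" using Q L n0 by simp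
  have D: "real n * Q / L \<le> real D" "real D \<le> real n * Q / L + 1" "1 \<le> D"
    unfolding D_def using q by linarith+
  obtain B u where B: "finite B" "card B \<le> D + 2 * (k + 2)" and u: "u \<in> pm_densities (k + 2)"
    and const: "\<And>C y z. convex C \<Longrightarrow> C \<inter> B = {} \<Longrightarrow> y \<in> C \<Longrightarrow> z \<in> C \<Longrightarrow> u y = u z"
    and tu: "(hellinger t u)\<^sup>2 \<le> 2 * M / (real D)\<^sup>2"
    using step_approximation[OF td x(1) less_imp_le[OF x(2)] _ D(3)] M by (metis mult_pos_pos zero_less_numeral)
  have ud: "u \<in> prob_densities" using u by (simp add: pm_densities_def)
  have MD: "M / (real D)\<^sup>2 \<le> Q * L\<^sup>2"
  proof -
    have "M / (real D)\<^sup>2 \<le> M / (real n * Q / L)\<^sup>2"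
      using M D q by (intro divide_left_mono power_mono mult_pos_pos zero_less_power) auto
    also have "\<dots> = (M / (real n)\<^sup>2) * L\<^sup>2 / Q\<^sup>2" using L by (simp add: power_divide power_mult_distrib)
    also have "\<dots> = Q * L\<^sup>2" unfolding Q3[symmetric] using Q by (simp add: power2_eq_square power3_eq_cube)
    finally show ?thesis .
  qed
  define m where "m = max Q (real k / real n * L)"
  have su: "(hellinger s u)\<^sup>2 \<le> 2 * (hellinger s t)\<^sup>2 + 4 * (L\<^sup>2 * m)"
  proof -
    have "Q * L\<^sup>2 \<le> m * L\<^sup>2" by (intro mult_right_mono) (auto simp: m_def)
    then show ?thesis using hellinger_sq_triangle[OF s td ud] tu MD by (simp add: mult.commute)
  qed
  have cB: "real (card B + (k + 2)) * L\<^sup>2 / real n \<le> 11 * (L\<^sup>2 * m)"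
  proof -
    have "real (card B + (k + 2)) \<le> real (D + 3 * (k + 2))" using B(2) by (intro of_nat_mono) simp
    \<comment> \<open>For k \<ge> 1, 3 (k + 2) \<le> 9 k, and rounding D up adds 1 \<le> k.\<close>
    also have "\<dots> \<le> real n * Q / L + 10 * real k" using D(2) k by simp
    also have "\<dots> \<le> real n * Q + 10 * (real k * L)"
    proof (rule add_mono)
      show "real n * Q / L \<le> real n * Q" using L Q n0 divide_left_mono[of 1 L "real n * Q"] by simp
      show "10 * real k \<le> 10 * (real k * L)" using L by (simp add: mult_le_cancel_left1)
    qed
    finally have "real (card B + (k + 2)) / real n \<le> (real n * Q + 10 * (real k * L)) / real n"
      by (rule divide_right_mono) simp
    also have "\<dots> = Q + 10 * (real k / real n * L)" using n0 by (simp add: field_simps)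
    also have "\<dots> \<le> 11 * m"
    proof -
      have "Q \<le> m" "real k / real n * L \<le> m" by (simp_all add: m_def)
      then show ?thesis by linarith
    qed
    finally have "real (card B + (k + 2)) / real n * L\<^sup>2 \<le> 11 * m * L\<^sup>2" by (rule mult_right_mono) simp
    then show ?thesis by (simp add: mult_ac)
  qed
  have "risk n s shat \<le> 640 * (hellinger s u)\<^sup>2 + 70000 * (real (card B + (k + 2)) * L\<^sup>2 / real n)"
  proof -
    have "risk n s shat \<le> 640 * (hellinger s u)\<^sup>2 + 70000 * real (card B + (k + 2)) * (ln (real n))\<^sup>2 / real n"
      by (rule risk_step_bound[OF n _ est s u B(1)]) (simp, rule const)
    then show ?thesis by (simp only: L_def mult.assoc times_divide_eq_right)
  qed
  \<comment> \<open>640 * 4 + 70000 * 11 = 772560, which is then rounded up to 10^6.\<close>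
  also have "\<dots> \<le> 1280 * (hellinger s t)\<^sup>2 + 772560 * (L\<^sup>2 * m)" using su cB by linarith
  also have "\<dots> \<le> 10 ^ 6 * (hellinger s t)\<^sup>2 + 10 ^ 6 * (L\<^sup>2 * m)"
    using Q by (intro add_mono mult_right_mono mult_nonneg_nonneg) (auto simp: m_def)
  finally show ?thesis unfolding m_def Q_def L_def by (simp add: distrib_left)
qed

text \<open>Real infima and suprema over empty sets would be meaningless, so the classes must be
  inhabited. The witness is the uniform density on [0, 1] with inner endpoints 0, 1, 2, ...; three
  pieces are enough to have both 0 and 1 among them, and every variation is then zero.\<close>

lemma pm_densities_le_nonempty:
  assumes "3 \<le> K" "0 \<le> M"
  shows "pm_densities_le K M \<noteq> {}"
proof -
  define t :: "real \<Rightarrow> real" where "t = indicator {0..1}"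
  define x :: "nat \<Rightarrow> ereal" where
    "x j = (if j = 0 then - \<infinity> else if j < K then ereal (real j - 1) else \<infinity>)" for j
  have x: "x \<in> partitions K" using assms(1) by (auto simp: partitions_def x_def)
  have const: "\<exists>c. \<forall>y\<in>piece x j. t y = c" if "j < K" for j
  proof (cases "j = 1")
    case True
    then have "t y = 1" if "y \<in> piece x j" for y
      using that assms(1) by (auto simp: piece_def x_def t_def indicator_def zero_ereal_def one_ereal_def)
    then show ?thesis by blast
  next
    case False
    have "t y = 0" if y: "y \<in> piece x j" for y
    proof -
      have "y < 0 \<or> 1 < y"
      proof (cases "j = 0")
        case True
        then show ?thesis using y assms(1) by (auto simp: piece_def x_def zero_ereal_def)
      next
        case j0: False
        then have "real j - 1 < y" using y \<open>j < K\<close> by (auto simp: piece_def x_def)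
        moreover have "2 \<le> real j" using j0 False by linarith
        ultimately show ?thesis by linarith
      qed
      then show ?thesis by (auto simp: t_def)
    qed
    then show ?thesis by blast
  qed
  have td: "t \<in> prob_densities"
    by (rule prob_densitiesI) (auto simp: t_def)
  have pm: "piecewise_monotone_on_partition K x t"
    unfolding piecewise_monotone_on_partition_def
  proof (intro conjI allI impI x)
    fix j assume "j < K"
    then show "mono_on (piece x j) t \<or> antimono_on (piece x j) t"
      using const by (fastforce simp: monotone_on_def)
  qed
  have "cbrt (emeasure lborel (piece x j) * (variation (piece x j) (\<lambda>y. sqrt (t y)))\<^sup>2) = 0" if j: "j < K" for j
  proof -
    obtain c where c: "\<And>y. y \<in> piece x j \<Longrightarrow> t y = c" using const[OF j] by blast
    have ne: "piece x j \<noteq> {}" by (rule piece_nonnull(2)[OF x j])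
    have "(SUP y\<in>piece x j. ereal (sqrt (t y))) = (SUP y\<in>piece x j. ereal (sqrt c))"
      "(INF y\<in>piece x j. ereal (sqrt (t y))) = (INF y\<in>piece x j. ereal (sqrt c))"
      using c by auto
    then have "variation (piece x j) (\<lambda>y. sqrt (t y)) = 0"
      using ne by (simp add: variation_def interior_open[OF open_piece])
    then show ?thesis by (simp add: cbrt_def)
  qed
  then have "M_partition K t x = 0" by (simp add: M_partition_def)
  then have "M_functional K t \<le> 0"
    unfolding M_functional_def using pm by (metis INF_lower mem_Collect_eq)
  then have "t \<in> pm_densities_le K M"
    using td pm assms(2) by (auto simp: pm_densities_le_def pm_densities_def)
  then show ?thesis by auto
qed

theorem theorem3:
  shows "\<exists>C C' :: real. 0 < C \<and> C \<le> 1 \<and> 0 < C' \<and>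
    (\<forall>(n::nat) (k::nat) (shat :: (nat \<Rightarrow> real) \<Rightarrow> real \<Rightarrow> real).
       3 \<le> n \<longrightarrow> 1 \<le> k \<longrightarrow> rho_estimator n (pm_densities (k + 2)) shat \<longrightarrow>
       (\<forall>s\<in>prob_densities.
          C * risk n s shat \<le>
            (INF M\<in>{0::real<..}.
               (hellinger_set s (pm_densities_le (k + 2) M))\<^sup>2 +
               (ln (real n))\<^sup>2 *
                 max ((M / (real n)\<^sup>2) powr (1 / 3)) (real k / real n * ln (real n)))) \<and>
       (\<forall>M>0::real.
          (SUP s\<in>pm_densities_le (k + 2) M. risk n s shat) \<le>
            C' * (ln (real n))\<^sup>2 *
              max ((M / (real n)\<^sup>2) powr (1 / 3)) (real k / real n * ln (real n))))"
proof (rule exI[of _ "1 / 10 ^ 6"], rule exI[of _ "10 ^ 6"], intro conjI allI impI ballI)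
  fix n k :: nat and shat :: "(nat \<Rightarrow> real) \<Rightarrow> real \<Rightarrow> real" and s
  assume n: "3 \<le> n" and k: "1 \<le> k" and est: "rho_estimator n (pm_densities (k + 2)) shat"
    and s: "s \<in> prob_densities"
  show "1 / 10 ^ 6 * risk n s shat \<le>
    (INF M\<in>{0::real<..}. (hellinger_set s (pm_densities_le (k + 2) M))\<^sup>2 +
      (ln (real n))\<^sup>2 * max ((M / (real n)\<^sup>2) powr (1 / 3)) (real k / real n * ln (real n)))"
  proof (rule cINF_greatest)
    fix M :: real assume "M \<in> {0<..}"
    then have M: "0 < M" by simp
    let ?A = "pm_densities_le (k + 2) M"
    define R where "R = (ln (real n))\<^sup>2 * max ((M / (real n)\<^sup>2) powr (1 / 3)) (real k / real n * ln (real n))"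
    have ne: "?A \<noteq> {}" using k M by (intro pm_densities_le_nonempty) auto
    \<comment> \<open>A lower bound for all squared distances has to pass to the square of their
      infimum. Truncating at 0 makes sqrt g a lower bound for every distance, hence for the infimum,
      and squaring returns g.\<close>
    define g where "g = max 0 (1 / 10 ^ 6 * risk n s shat - R)"
    have "sqrt g \<le> hellinger_set s ?A"
      unfolding hellinger_set_def
    proof (rule cINF_greatest[OF ne])
      fix t assume "t \<in> ?A"
      then have "risk n s shat \<le> 10 ^ 6 * ((hellinger s t)\<^sup>2 + R)"
        unfolding R_def by (rule risk_bound[OF n k est s M])
      then have "g \<le> (hellinger s t)\<^sup>2" by (simp add: g_def)
      then show "sqrt g \<le> hellinger s t" using hellinger_nonneg by (intro real_le_lsqrt) (auto simp: g_def)
    qed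
    then have "(sqrt g)\<^sup>2 \<le> (hellinger_set s ?A)\<^sup>2" by (intro power_mono) (auto simp: g_def)
    then have "g \<le> (hellinger_set s ?A)\<^sup>2" by (simp add: g_def)
    then show "1 / 10 ^ 6 * risk n s shat \<le> (hellinger_set s ?A)\<^sup>2 +
      (ln (real n))\<^sup>2 * max ((M / (real n)\<^sup>2) powr (1 / 3)) (real k / real n * ln (real n))"
      unfolding R_def[symmetric] g_def by linarith
  qed simp
next
  fix n k :: nat and shat :: "(nat \<Rightarrow> real) \<Rightarrow> real \<Rightarrow> real" and M :: real
  assume n: "3 \<le> n" and k: "1 \<le> k" and est: "rho_estimator n (pm_densities (k + 2)) shat" and M: "0 < M"
  show "(SUP s\<in>pm_densities_le (k + 2) M. risk n s shat) \<le>
    10 ^ 6 * (ln (real n))\<^sup>2 * max ((M / (real n)\<^sup>2) powr (1 / 3)) (real k / real n * ln (real n))"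
  proof (rule cSUP_least)
    show "pm_densities_le (k + 2) M \<noteq> {}" using k M by (intro pm_densities_le_nonempty) auto
    fix s assume s: "s \<in> pm_densities_le (k + 2) M"
    then have "s \<in> prob_densities" by (simp add: pm_densities_le_def pm_densities_def)
    \<comment> \<open>The approximating density is s itself, at distance 0.\<close>
    from risk_bound[OF n k est this M s]
    show "risk n s shat \<le> 10 ^ 6 * (ln (real n))\<^sup>2 *
      max ((M / (real n)\<^sup>2) powr (1 / 3)) (real k / real n * ln (real n))"
      by (simp add: hellinger_self mult.assoc)
  qed
qed auto

end
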